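(* Let $M$ be a prime and $(M,q)=1$. Then $$\lim_{q\to\infty}\mathfrak P_{\mathrm{GL}}(n,q,M)=\sum_{\substack{\lambda\vdash n\\ \lambda=1^{m_1}\cdots i^{m_i}\cdots}}\frac{1}{M^{\pi_{o(q)}(\lambda)}}\prod_i\frac{1}{m_i!\,i^{m_i}},$$ where, since the right-hand side depends on $q$ only through $o(q)$, the limit is taken along prime powers $q$ with a given value of $o(q)$. Thus, there are $\nu(M-1)$ subsequential limits of $\mathfrak P_{\mathrm{GL}}(n,q,M)$ as $q\to\infty$ (with $(M,q)=1$), where $\nu(M-1)=|\{a : 1\le a\le n,\ a\mid M-1\}|$.
   Context: Here $n\ge 1$ is an integer and $q$ is a prime power. $\mathrm{GL}(n,q)$ is the general linear group of $n\times n$ invertible matrices over the field with $q$ elements, $\mathrm{GL}(n,q)^M=\{x^M : x\in\mathrm{GL}(n,q)\}$, and $\mathfrak P_{\mathrm{GL}}(n,q,M)=|\mathrm{GL}(n,q)^M|/|\mathrm{GL}(n,q)|$ is the proportion of $M$-th powers. For $q$ coprime to the prime $M$, $o(q)$ denotes the order of $q$ in $(\mathbb Z/M\mathbb Z)^\times$. For a partition $\lambda$ of $n$ and $1\le a\le n$, $\pi_a(\lambda)$ is the number of parts of $\lambda$, counted with multiplicity, that are divisible by $a$; the same definition gives $\pi_a(\lambda)=0$ when $a>n$. Partitions are written in power notation $\lambda=1^{m_1}2^{m_2}\cdots i^{m_i}\cdots$, where $m_i\ge 0$ is the number of parts of $\lambda$ equal to $i$.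
   Formalization: The count of ν(M−1) subsequential limits is proved as stated when M−1 ≤ n; when M−1 > n it is false (n=1, M=3 gives the limits 1/3 and 1, but ν(2)=1) and is corrected to: 1 is a subsequential limit and there are exactly ν(M−1) others. *)

theory Defs
  imports
    Complex_Main
    "HOL-Library.Multiset"
    "HOL-Algebra.Coset"
    "HOL-Algebra.Ring"
    "HOL-Number_Theory.Number_Theory"
    "Jordan_Normal_Form.Matrix"
begin

text \<open>
  The field varies with \<open>q\<close> inside a limit, so it cannot be a type of class \<open>field\<close>; it is a
  HOL-Algebra record instead. Only the carrier type of matrices is taken from
  Jordan_Normal_Form, since the arithmetic there refers to the type classes.
\<close>

definition mat_monoid :: "nat \<Rightarrow> 'a ring \<Rightarrow> 'a mat monoid" where
  "mat_monoid n R =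
     \<lparr>carrier = {A \<in> carrier_mat n n. \<forall>i<n. \<forall>j<n. A $$ (i, j) \<in> carrier R},
      monoid.mult = (\<lambda>A B. mat n n (\<lambda>(i, j).
        \<Oplus>\<^bsub>R\<^esub>k\<in>{..<n}. A $$ (i, k) \<otimes>\<^bsub>R\<^esub> B $$ (k, j))),
      one = mat n n (\<lambda>(i, j). if i = j then \<one>\<^bsub>R\<^esub> else \<zero>\<^bsub>R\<^esub>)\<rparr>"

definition GL :: "nat \<Rightarrow> 'a ring \<Rightarrow> 'a mat monoid" where
  "GL n R = units_of (mat_monoid n R)"

definition GL_powers :: "nat \<Rightarrow> 'a ring \<Rightarrow> nat \<Rightarrow> 'a mat set" where
  "GL_powers n R M = (\<lambda>x. x [^]\<^bsub>GL n R\<^esub> M) ` carrier (GL n R)"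

definition GL_power_proportion :: "nat \<Rightarrow> 'a ring \<Rightarrow> nat \<Rightarrow> real" where
  "GL_power_proportion n R M = real (card (GL_powers n R M)) / real (order (GL n R))"

text \<open>
  A partition is the multiset of its parts, so the exponent \<open>m\<^sub>i\<close> of the power notation is
  \<open>count \<mu> i\<close>.
\<close>

definition partitions_of :: "nat \<Rightarrow> nat multiset set" where
  "partitions_of n = {\<mu>. 0 \<notin># \<mu> \<and> sum_mset \<mu> = n}"

definition parts_divisible_by :: "nat \<Rightarrow> nat multiset \<Rightarrow> nat" where
  "parts_divisible_by a \<mu> = size (filter_mset (\<lambda>i. a dvd i) \<mu>)"

lemma finite_partitions_of: "finite (partitions_of n)"
proof (rule finite_subset)
  show "partitions_of n \<subseteq> mset ` {xs. set xs \<subseteq> {..n} \<and> length xs \<le> n}"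
  proof
    fix \<mu> assume "\<mu> \<in> partitions_of n"
    then have z: "0 \<notin># \<mu>" and s: "sum_mset \<mu> = n" by (auto simp: partitions_of_def)
    obtain xs where xs: "mset xs = \<mu>" using ex_mset by blast
    have "size \<mu> = (\<Sum>i\<in>#\<mu>. 1)" by simp
    also have "\<dots> \<le> (\<Sum>i\<in>#\<mu>. i)"
    proof (rule sum_mset_mono)
      fix i assume "i \<in># \<mu>"
      then show "1 \<le> i" using z by (cases i) auto
    qed
    finally have "length xs \<le> n" using s xs by auto
    moreover have "set_mset \<mu> \<subseteq> {..n}"
      using s by (auto dest!: multi_member_split)
    then have "set xs \<subseteq> {..n}" using xs by auto
    ultimately show "\<mu> \<in> mset ` {xs. set xs \<subseteq> {..n} \<and> length xs \<le> n}"
      using xs by blast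
  qed
  show "finite (mset ` {xs. set xs \<subseteq> {..n} \<and> length xs \<le> n})"
    by (intro finite_imageI finite_lists_length_le) simp
qed

text \<open>The product may stop at \<open>n\<close>: later factors have \<open>m\<^sub>i = 0\<close> and equal 1.\<close>

definition limit_proportion :: "nat \<Rightarrow> nat \<Rightarrow> nat \<Rightarrow> real" where
  "limit_proportion n M a =
     (\<Sum>\<mu>\<in>partitions_of n. 1 / real M ^ parts_divisible_by a \<mu> *
        (\<Prod>i=1..n. 1 / (fact (count \<mu> i) * real i ^ count \<mu> i)))"

definition coprime_primepows :: "nat \<Rightarrow> nat set" where
  "coprime_primepows M = {q. primepow q \<and> coprime M q}"

definition subsequential_limits :: "(nat \<Rightarrow> real) \<Rightarrow> nat set \<Rightarrow> real set" where
  "subsequential_limits f Q =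
     {l. \<exists>r. strict_mono r \<and> range r \<subseteq> Q \<and> (\<lambda>k. f (r k)) \<longlonglongrightarrow> l}"

text \<open>
  Divisors of \<open>m\<close> beyond \<open>n\<close> are left out. For \<open>m = M - 1\<close> these are the orders \<open>a > n\<close> of
  \<open>q\<close> modulo \<open>M\<close>, which all give the limit 1.
\<close>

definition num_divisors_upto :: "nat \<Rightarrow> nat \<Rightarrow> nat" where
  "num_divisors_upto n m = card {a. 1 \<le> a \<and> a \<le> n \<and> a dvd m}"

end

theory Submission
  imports
    Defs
    "HOL-Computational_Algebra.Squarefree"
    "HOL-Algebra.Polynomial_Divisibility"
begin

text \<open>
  A uniformly random pair of a matrix \<open>x\<close> and a vector \<open>v\<close> is, up to an error \<open>O(1/q)\<close>, a cyclic pair,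
  and cyclic pairs correspond bijectively to a basis \<open>B = (v, xv, x\<^sup>2v, \<dots>)\<close> together with the monic
  polynomial \<open>f\<close> for which \<open>x\<close> is conjugate under \<open>B\<close> to the companion matrix of \<open>f\<close>. So
  \<open>B\<close> and \<open>f\<close> are independent and uniform. The matrices commuting with the companion matrix are
  multiplications on \<open>F[X]/(f)\<close>, hence \<open>x\<close> is an \<open>M\<close>-th power iff \<open>f(0) \<noteq> 0\<close> and the class of \<open>X\<close> is
  an \<open>M\<close>-th power in \<open>F[X]/(f)\<close>. This property is multiplicative on squarefree \<open>f\<close>, and an
  irreducible \<open>p \<noteq> X\<close> of degree \<open>d\<close> has it iff \<open>p\<close> divides \<open>X\<^sup>m - 1\<close> with
  \<open>m = (q\<^sup>d - 1) / gcd M (q\<^sup>d - 1)\<close>. Counting the irreducible factors of this squarefree polynomial,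
  a proportion close to \<open>1/M\<close> of the irreducibles of degree \<open>d\<close> qualifies if \<open>o(q)\<close> divides \<open>d\<close>, and
  close to \<open>1\<close> otherwise. Marking an irreducible factor gives the same recursion for the density of
  good squarefree polynomials as the one obtained for the sum over partitions by marking a part.

  The sum over partitions is the coefficient of \<open>u\<^sup>n\<close> in \<open>(1 - u\<^sup>a)\<^sup>\<alpha> / (1 - u)\<close>, where
  \<open>\<alpha> = (1 - 1/M) / a\<close> and \<open>a = o(q)\<close>, and is
  therefore strictly increasing in \<open>a \<le> n\<close> and equal to \<open>1\<close> for \<open>a > n\<close>. All divisors \<open>a\<close> of \<open>M - 1\<close> occur as
  orders infinitely often, by taking powers of one prime that is a primitive root modulo \<open>M\<close>.
\<close>

section \<open>A prime that is a primitive root modulo a given prime\<close>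

text \<open>Three shortcuts shape the proof. Non-cyclic pairs are not classified: the pairs
  \<open>(B, c)\<close> inject into the pairs \<open>(x, v)\<close>, both sets have known size up to
  the number of singular matrices, and the non-cyclic pairs are what remains. Non-squarefree
  polynomials are treated likewise: the recursion with \<open>M = 1\<close> shows that almost all
  monic polynomials are squarefree with nonzero constant term, and this bounds the rest. The prime
  that is a primitive root needs less than Dirichlet's theorem on primes in a residue class: if a
  prime power is a primitive root then so is its base, so it suffices to find a prime power
  congruent to a given primitive root, and the von Mangoldt function can be used as it is. All
  errors have the form \<open>D / q\<close> with \<open>D\<close> independent of the field, since
  the field itself changes along the limit.\<close>

lemma sum_pairs_mult_le:
  fixes f :: "nat \<Rightarrow> nat \<Rightarrow> 'a::comm_monoid_add"
  shows "(\<Sum>n=1..N. \<Sum>d | d dvd n. f d (n div d)) = (\<Sum>d=1..N. \<Sum>m=1..N div d. f d m)"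
proof -
  have "(\<Sum>n=1..N. \<Sum>d | d dvd n. f d (n div d)) =
      (\<Sum>(n,d)\<in>(SIGMA n:{1..N}. {d. d dvd n}). f d (n div d))"
    by (rule sum.Sigma) (auto intro: finite_divisors_nat)
  also have "\<dots> = (\<Sum>(d,m)\<in>(SIGMA d:{1..N}. {1..N div d}). f d m)"
    by (rule sum.reindex_bij_witness[of _ "\<lambda>(d,m). (d * m, d)" "\<lambda>(n,d). (d, n div d)"])
       (auto simp: div_le_mono less_eq_div_iff_mult_less_eq mult.commute
          dest: dvd_imp_le elim!: dvdE, metis One_nat_def le_trans mult.right_neutral mult_le_mono2)
  also have "\<dots> = (\<Sum>d=1..N. \<Sum>m=1..N div d. f d m)"
    by (rule sum.Sigma[symmetric]) auto
  finally show ?thesis .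
qed

section \<open>Moebius inversion for the von Mangoldt function\<close>

definition moebius :: "nat \<Rightarrow> int" where
  "moebius n = (if squarefree n then (-1) ^ card (prime_factors n) else 0)"

text \<open>Only squarefree divisors count, and they are the products of sets of prime factors of
  \<open>n\<close>. The alternating sum over all these sets is a product of factors
  \<open>-1 + 1\<close>, which is empty exactly for \<open>n = 1\<close>.\<close>

lemma sum_moebius_divisors:
  assumes "n > 0"
  shows "(\<Sum>d | d dvd n. moebius d) = (if n = 1 then 1 else 0)"
proof -
  let ?P = "prime_factors n"
  have fin: "finite ?P" by simp
  have "(\<Sum>d | d dvd n. moebius d) = (\<Sum>d | d dvd n \<and> squarefree d. (-1) ^ card (prime_factors d))"
    using assms by (intro sum.mono_neutral_cong_right) (auto simp: moebius_def)
  also have "\<dots> = (\<Sum>A\<in>Pow ?P. (-1) ^ card A)"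
  proof (rule sum.reindex_bij_witness[of _ "\<lambda>A. \<Prod>A" prime_factors])
    fix d assume d: "d \<in> {d. d dvd n \<and> squarefree d}"
    then have "d \<noteq> 0" using assms by auto
    have "d = (\<Prod>p\<in>prime_factors d. p ^ multiplicity p d)"
      using prime_factorization_nat[of d] \<open>d \<noteq> 0\<close> by simp
    also have "\<dots> = \<Prod>(prime_factors d)"
      using d by (intro prod.cong refl) (auto simp: squarefree_factorial_semiring'' prime_factors_multiplicity
          \<open>d \<noteq> 0\<close> le_Suc_eq)
    finally show "\<Prod>(prime_factors d) = d" by simp
    show "prime_factors d \<in> Pow ?P"
      using d assms by (auto intro: dvd_prime_factors[THEN subsetD])
    show "(- 1) ^ card (prime_factors d) = (- 1 :: int) ^ card (prime_factors d)" by simp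
  next
    fix A assume A: "A \<in> Pow ?P"
    then have finA: "finite A" and pr: "\<And>p. p \<in> A \<Longrightarrow> Factorial_Ring.prime p"
      using fin by (auto intro: finite_subset)
    have nz: "\<Prod>A \<noteq> 0" using finA pr not_prime_0 by (metis prod_zero_iff)
    have mult: "multiplicity p (\<Prod>A) = (if p \<in> A then 1 else 0)" if "Factorial_Ring.prime p" for p
      using multiplicity_prod_prime_powers[OF finA pr that, of "\<lambda>_. 1"] by simp
    show pf: "prime_factors (\<Prod>A) = A"
      using mult pr nz by (auto simp: prime_factors_multiplicity split: if_splits)
    show "\<Prod>A \<in> {d. d dvd n \<and> squarefree d}"
    proof (intro CollectI conjI)
      show "squarefree (\<Prod>A)"
        using mult nz by (auto simp: squarefree_factorial_semiring'')
      have "\<Prod>A dvd \<Prod>?P" using A by (intro prod_dvd_prod_subset) auto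
      also have "\<Prod>?P dvd n"
      proof -
        have "\<Prod>?P dvd (\<Prod>p\<in>?P. p ^ multiplicity p n)"
          by (intro prod_dvd_prod dvd_power) (auto simp: prime_factors_multiplicity)
        then show ?thesis using prime_factorization_nat[of n] assms by simp
      qed
      finally show "\<Prod>A dvd n" .
    qed
  qed
  also have "\<dots> = (\<Sum>A\<in>Pow ?P. (\<Prod>p\<in>A. -1) * (\<Prod>p\<in>?P - A. 1))"
    by simp
  also have "\<dots> = (\<Prod>p\<in>?P. -1 + (1::int))"
    by (rule prod_add[OF fin, symmetric])
  also have "\<dots> = (if ?P = {} then 1 else 0)" by (auto simp: card_gt_0_iff)
  also have "?P = {} \<longleftrightarrow> n = 1" using assms
    by (auto simp: prime_factorization_empty_iff)
  finally show ?thesis by simp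
qed

text \<open>Moebius inversion of the formula for \<open>ln n\<close> as a divisor sum of
  \<open>mangoldt\<close>: after exchanging the two sums, the inner Moebius sum over the divisors of
  \<open>n div e\<close> leaves only \<open>e = n\<close>.\<close>

lemma mangoldt_eq_sum_moebius:
  assumes "n > 0"
  shows "(\<Sum>d | d dvd n. real_of_int (moebius d) * ln (real (n div d))) = mangoldt n"
proof -
  let ?\<mu> = "\<lambda>d. real_of_int (moebius d)"
  have "(\<Sum>d | d dvd n. ?\<mu> d * ln (real (n div d))) =
      (\<Sum>d | d dvd n. \<Sum>e | e dvd n div d. ?\<mu> d * mangoldt e)"
  proof (intro sum.cong refl)
    fix d assume "d \<in> {d. d dvd n}"
    then have "n div d \<noteq> 0" using assms by (auto elim!: dvdE)
    from mangoldt_sum[OF this, where 'a = real]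
    show "?\<mu> d * ln (real (n div d)) = (\<Sum>e | e dvd n div d. ?\<mu> d * mangoldt e)"
      by (simp add: sum_distrib_left[symmetric])
  qed
  also have "\<dots> = (\<Sum>(d,e)\<in>(SIGMA d:{d. d dvd n}. {e. e dvd n div d}). ?\<mu> d * mangoldt e)"
    using assms by (intro sum.Sigma) (auto intro!: finite_divisors_nat elim!: dvdE)
  also have "\<dots> = (\<Sum>(e,d)\<in>(SIGMA e:{e. e dvd n}. {d. d dvd n div e}). ?\<mu> d * mangoldt e)"
    using assms
    by (intro sum.reindex_bij_witness[of _ "\<lambda>(x,y). (y,x)" "\<lambda>(x,y). (y,x)"])
       (auto simp: dvd_div_iff_mult mult.commute elim!: dvdE)
  also have "\<dots> = (\<Sum>e | e dvd n. \<Sum>d | d dvd n div e. ?\<mu> d * mangoldt e)"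
    using assms by (intro sum.Sigma[symmetric]) (auto intro!: finite_divisors_nat elim!: dvdE)
  also have "\<dots> = (\<Sum>e | e dvd n. mangoldt e * of_int (\<Sum>d | d dvd n div e. moebius d))"
    by (simp add: sum_distrib_left mult.commute)
  also have "\<dots> = (\<Sum>e | e dvd n. if e = n then mangoldt e else 0)"
    using assms by (intro sum.cong refl, subst sum_moebius_divisors) (auto elim!: dvdE)
  also have "\<dots> = mangoldt n" using assms by (subst sum.delta) auto
  finally show ?thesis .
qed

section \<open>Elementary estimates and Abel summation\<close>

lemma real_divide_le_Suc_div:
  assumes "d > 0" shows "real N / real d \<le> real (Suc (N div d))"
proof -
  have "N \<le> Suc (N div d) * d" using dividend_less_times_div[OF assms, of N] by (simp add: mult.commute)
  then have "real N \<le> real (Suc (N div d)) * real d" by (metis of_nat_le_iff of_nat_mult)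
  then show ?thesis using assms by (simp add: divide_le_eq)
qed

lemma norm_moebius_le: "norm (of_int (moebius n) :: complex) \<le> 1"
  by (simp add: moebius_def norm_power)

lemma sum_inverse_sqrt_le: "(\<Sum>d=1..N. 1 / sqrt (real d)) \<le> 2 * sqrt (real N)"
proof (induction N)
  case (Suc N)
  have "1 / sqrt (real (Suc N)) \<le> 2 * (sqrt (real (Suc N)) - sqrt (real N))"
  proof -
    \<comment> \<open>Expanding this square bounds one summand by twice an increment of the square
      root, and these increments telescope.\<close>
    have "(sqrt (real (Suc N)) - sqrt (real N))\<^sup>2 \<ge> 0" by simp
    then have "2 * sqrt (real N) * sqrt (real (Suc N)) \<le> real N + real (Suc N)"
      by (simp add: power2_diff algebra_simps)
    then have "1 \<le> 2 * (sqrt (real (Suc N)) - sqrt (real N)) * sqrt (real (Suc N))"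
      by (simp add: algebra_simps)
    then show ?thesis by (simp add: divide_le_eq)
  qed
  then show ?case using Suc by simp
qed simp

lemma ln_le_sqrt:
  assumes "x > (0::real)" shows "ln x + 1 \<le> 2 * sqrt x" "ln x \<le> 2 * sqrt x"
proof -
  have "ln (sqrt x) \<le> sqrt x - 1" using assms by (intro ln_le_minus_one) auto
  then show "ln x + 1 \<le> 2 * sqrt x" using assms by (simp add: ln_sqrt)
  then show "ln x \<le> 2 * sqrt x" by simp
qed

text \<open>In the applications \<open>e d\<close> is the error of a partial sum stopped at
  \<open>N div d\<close>. Weighted by \<open>1 / d\<close>, a merely bounded error would cost a
  factor \<open>ln N\<close>. Decay like the square root of \<open>d / N\<close> keeps the total
  bounded, and it is weak enough to absorb a logarithm of \<open>N / d\<close>.\<close>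

lemma sum_convolution_bound:
  assumes "\<And>d. d \<in> {1..N} \<Longrightarrow> norm (h d) \<le> 1"
    and "\<And>d. d \<in> {1..N} \<Longrightarrow> norm (e d) \<le> c * sqrt (real d / real N)" and "c \<ge> 0"
  shows "norm (\<Sum>d=1..N. h d / of_nat d * e d :: complex) \<le> 2 * c"
proof (cases "N = 0")
  case False
  have "norm (\<Sum>d=1..N. h d / of_nat d * e d) \<le> (\<Sum>d=1..N. 1 / real d * (c * sqrt (real d / real N)))"
  proof (intro sum_norm_le)
    fix d assume d: "d \<in> {1..N}"
    have "norm (h d / of_nat d) \<le> 1 / real d"
      using assms(1)[OF d] by (simp add: norm_divide divide_right_mono)
    then show "norm (h d / of_nat d * e d) \<le> 1 / real d * (c * sqrt (real d / real N))"
      using assms(2)[OF d] unfolding norm_mult by (intro mult_mono) auto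
  qed
  also have "\<dots> = (\<Sum>d=1..N. c / sqrt (real N) * (1 / sqrt (real d)))"
    by (intro sum.cong refl) (auto simp: real_sqrt_divide field_simps)
  also have "\<dots> = c / sqrt (real N) * (\<Sum>d=1..N. 1 / sqrt (real d))"
    by (simp add: sum_distrib_left)
  also have "\<dots> \<le> c / sqrt (real N) * (2 * sqrt (real N))"
    using assms by (intro mult_left_mono sum_inverse_sqrt_le) auto
  also have "\<dots> = 2 * c" using False by simp
  finally show ?thesis .
qed (use assms in auto)

text \<open>Abel summation. The two boundary terms and the telescoping sum of the differences of
  \<open>f\<close> add up to \<open>2 * B * f (Suc m)\<close>, since the terms with
  \<open>f (Suc n)\<close> cancel.\<close>

lemma norm_sum_diff_antimono_le:
  fixes \<chi> :: "nat \<Rightarrow> complex" and f :: "nat \<Rightarrow> real"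
  assumes B: "\<And>n. norm (\<Sum>k=1..n. \<chi> k) \<le> B"
    and dec: "\<And>m n. 1 \<le> m \<Longrightarrow> m \<le> n \<Longrightarrow> f n \<le> f m" and pos: "\<And>n. f n \<ge> 0"
    and "m \<le> n"
  shows "norm ((\<Sum>k=1..n. \<chi> k * of_real (f k)) - (\<Sum>k=1..m. \<chi> k * of_real (f k))) \<le> 2 * B * f (Suc m)"
proof -
  define Z where "Z = (\<lambda>n. \<Sum>k=1..n. \<chi> k)"
  have eq: "(\<Sum>k=1..n. \<chi> k * of_real (f k)) - (\<Sum>k=1..m. \<chi> k * of_real (f k)) =
      Z n * f (Suc n) - Z m * f (Suc m) + (\<Sum>k=Suc m..n. Z k * (f k - f (Suc k)))"
    using \<open>m \<le> n\<close>
  proof (induction n rule: dec_induct)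
    case (step n)
    then show ?case by (simp add: Z_def algebra_simps)
  qed (simp add: algebra_simps)
  have tele: "(\<Sum>k=Suc m..n. f k - f (Suc k)) = f (Suc m) - f (Suc n)"
    using \<open>m \<le> n\<close> by (induction n rule: dec_induct) auto
  have "B \<ge> 0" using B[of 0] by simp
  have "norm (\<Sum>k=Suc m..n. Z k * (f k - f (Suc k))) \<le> (\<Sum>k=Suc m..n. B * (f k - f (Suc k)))"
  proof (intro sum_norm_le)
    fix k assume "k \<in> {Suc m..n}"
    then have "f k - f (Suc k) \<ge> 0" using dec[of k "Suc k"] by auto
    then have "norm (of_real (f k - f (Suc k)) :: complex) = f k - f (Suc k)"
      by (subst norm_of_real) simp
    then show "norm (Z k * (f k - f (Suc k))) \<le> B * (f k - f (Suc k))"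
      using B[of k] \<open>f k - f (Suc k) \<ge> 0\<close> unfolding norm_mult Z_def by (metis mult_right_mono)
  qed
  also have "\<dots> = B * (f (Suc m) - f (Suc n))"
    by (simp add: sum_distrib_left[symmetric] tele)
  finally have 1: "norm (\<Sum>k=Suc m..n. Z k * (f k - f (Suc k))) \<le> B * (f (Suc m) - f (Suc n))" .
  have 2: "norm (Z k * f j) \<le> B * f j" for k j
    using B[of k] pos[of j] by (simp add: norm_mult Z_def mult_right_mono)
  have "norm (Z n * f (Suc n) - Z m * f (Suc m) + (\<Sum>k=Suc m..n. Z k * (f k - f (Suc k))))
      \<le> B * f (Suc n) + B * f (Suc m) + B * (f (Suc m) - f (Suc n))"
    by (intro norm_triangle_mono norm_triangle_le_diff add_mono 1 2)
  then show ?thesis unfolding eq by (simp add: algebra_simps)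
qed

text \<open>Letting \<open>n\<close> tend to infinity in the preceding bound. The explicit rate is
  kept because partial sums will be compared with the limit at all arguments \<open>N div d\<close>
  simultaneously.\<close>

lemma sum_antimono_limit:
  fixes \<chi> :: "nat \<Rightarrow> complex" and f :: "nat \<Rightarrow> real"
  assumes B: "\<And>n. norm (\<Sum>k=1..n. \<chi> k) \<le> B"
    and dec: "\<And>m n. 1 \<le> m \<Longrightarrow> m \<le> n \<Longrightarrow> f n \<le> f m" and pos: "\<And>n. f n \<ge> 0"
    and lim: "f \<longlonglongrightarrow> 0"
  shows "\<exists>L. \<forall>m. norm ((\<Sum>k=1..m. \<chi> k * of_real (f k)) - L) \<le> 2 * B * f (Suc m)"
proof -
  define S where "S = (\<lambda>n. \<Sum>k=1..n. \<chi> k * of_real (f k))"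
  have bd: "norm (S n - S m) \<le> 2 * B * f (Suc m)" if "m \<le> n" for m n
    unfolding S_def using norm_sum_diff_antimono_le[OF B dec pos that] .
  have lim': "(\<lambda>m. 2 * B * f (Suc m)) \<longlonglongrightarrow> 0"
    using tendsto_mult_left[OF LIMSEQ_Suc[OF lim], of "2 * B"] by simp
  have "Cauchy S"
  proof (rule metric_CauchyI)
    fix e :: real assume "e > 0"
    then obtain M where M: "\<And>m. m \<ge> M \<Longrightarrow> 2 * B * f (Suc m) < e"
      using order_tendstoD(2)[OF lim' \<open>e > 0\<close>] by (auto simp: eventually_sequentially)
    have "dist (S m) (S n) < e" if "M \<le> m" "M \<le> n" for m n
    proof (cases "m \<le> n")
      case True
      then show ?thesis using bd[OF True] M[of m] that by (simp add: dist_norm norm_minus_commute)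
    next
      case False
      then show ?thesis using bd[of n m] M[of n] that by (simp add: dist_norm)
    qed
    then show "\<exists>M. \<forall>m\<ge>M. \<forall>n\<ge>M. dist (S m) (S n) < e" by blast
  qed
  then obtain L where L: "S \<longlonglongrightarrow> L" by (auto simp: Cauchy_convergent_iff convergent_def)
  have "norm (S m - L) \<le> 2 * B * f (Suc m)" for m
  proof (rule tendsto_upperbound)
    show "(\<lambda>n. norm (S m - S n)) \<longlonglongrightarrow> norm (S m - L)" by (intro tendsto_intros L)
    show "\<forall>\<^sub>F n in sequentially. norm (S m - S n) \<le> 2 * B * f (Suc m)"
      using eventually_ge_at_top[of m] by eventually_elim (use bd norm_minus_commute in metis)
  qed simp
  then show ?thesis unfolding S_def by blast
qed

text \<open>The derivative of \<open>(ln x + 1) / x\<close> is \<open>- ln x / x^2\<close>. This is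
  the purpose of the summand 1: \<open>ln x / x\<close> itself increases until Euler's number
  e.\<close>

lemma ln_plus_one_over_antimono:
  assumes "1 \<le> m" "m \<le> n" shows "(ln (real n) + 1) / real n \<le> (ln (real m) + 1) / real m"
proof -
  let ?f = "\<lambda>x::real. (ln x + 1) / x"
  have "?f (real n) \<le> ?f (real m)"
  proof (rule DERIV_nonpos_imp_nonincreasing[of "real m" "real n" ?f])
    fix x assume "real m \<le> x" "x \<le> real n"
    then have "x \<ge> 1" using assms by linarith
    then have "(?f has_real_derivative ((1/x) * x - (ln x + 1)) / (x * x)) (at x)"
      by (auto intro!: derivative_eq_intros)
    moreover have "((1/x) * x - (ln x + 1)) / (x * x) \<le> 0"
      using \<open>x \<ge> 1\<close> by (intro divide_nonpos_pos) auto
    ultimately show "\<exists>y. (?f has_real_derivative y) (at x) \<and> y \<le> 0" by blast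
  qed (use assms in auto)
  then show ?thesis .
qed

section \<open>Shapiro's method for sums of a character against the von Mangoldt function\<close>

locale bounded_character =
  fixes \<chi> :: "nat \<Rightarrow> complex" and B :: real
  assumes mult: "\<And>m n. \<chi> (m * n) = \<chi> m * \<chi> n"
    and one: "\<chi> 1 = 1"
    and norm_le: "\<And>n. norm (\<chi> n) \<le> 1"
    and sum_bound: "\<And>n. norm (\<Sum>k=1..n. \<chi> k) \<le> B"
begin

text \<open>Partial sums of the Dirichlet series of \<open>\<chi>\<close> at 1; those in
  \<open>partial_mangoldt\<close> belong to minus its logarithmic derivative.\<close>

definition "partial_L n = (\<Sum>k=1..n. \<chi> k / of_nat k)"

definition "partial_mangoldt n = (\<Sum>k=1..n. \<chi> k * mangoldt k / of_nat k)"

lemma B_nonneg: "B \<ge> 0"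
  using sum_bound[of 0] by simp

lemma partial_L_limit:
  obtains L where "\<And>n. norm (partial_L n - L) \<le> 2 * B / real (Suc n)"
proof -
  have "(\<lambda>n. 1 / real n) \<longlonglongrightarrow> 0" by (rule lim_1_over_n)
  moreover have "1 / real n \<le> 1 / real m" if "1 \<le> m" "m \<le> n" for m n
    using that by (simp add: frac_le)
  ultimately have "\<exists>L. \<forall>m. norm ((\<Sum>k=1..m. \<chi> k * of_real (1 / real k)) - L) \<le> 2 * B * (1 / real (Suc m))"
    using sum_antimono_limit[where f = "\<lambda>n. 1 / real n", OF sum_bound] by simp
  then show ?thesis using that by (auto simp: partial_L_def)
qed

text \<open>The limit is L(1) - L'(1) for the Dirichlet series L of \<open>\<chi>\<close>.\<close>

lemma partial_log_L_limit:
  obtains L where "\<And>n. norm ((\<Sum>k=1..n. \<chi> k * of_real ((ln (real k) + 1) / real k)) - L)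
     \<le> 2 * B * ((ln (real (Suc n)) + 1) / real (Suc n))"
proof -
  have "(\<lambda>n. (ln (real n) + 1) / real n) \<longlonglongrightarrow> 0"
  proof (rule tendsto_sandwich)
    show "\<forall>\<^sub>F n in sequentially. 0 \<le> (ln (real n) + 1) / real n"
      using eventually_gt_at_top[of 0] by eventually_elim auto
    show "\<forall>\<^sub>F n in sequentially. (ln (real n) + 1) / real n \<le> 2 * inverse (sqrt (real n))"
      using eventually_gt_at_top[of 0]
    proof eventually_elim
      case (elim n)
      have "(ln (real n) + 1) / real n \<le> 2 * sqrt (real n) / real n"
        using elim by (intro divide_right_mono ln_le_sqrt) auto
      also have "\<dots> = 2 * inverse (sqrt (real n))"
        using sqrt_divide_self_eq[of "real n"] by simp
      finally show ?case .
    qed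
    show "(\<lambda>n. 2 * inverse (sqrt (real n))) \<longlonglongrightarrow> 0"
      by (intro tendsto_mult_right_zero tendsto_inverse_0_at_top
          filterlim_compose[OF sqrt_at_top] filterlim_real_sequentially)
  qed simp
  moreover have "0 \<le> (ln (real n) + 1) / real n" for n by (cases "n = 0") auto
  ultimately have "\<exists>L. \<forall>n. norm ((\<Sum>k=1..n. \<chi> k * of_real ((ln (real k) + 1) / real k)) - L)
     \<le> 2 * B * ((ln (real (Suc n)) + 1) / real (Suc n))"
    using sum_antimono_limit[where f = "\<lambda>n. (ln (real n) + 1) / real n", OF sum_bound ln_plus_one_over_antimono]
    by blast
  then show ?thesis using that by blast
qed

text \<open>As \<open>\<chi>\<close> is completely multiplicative, the weight
  \<open>\<chi> n / n\<close> splits over \<open>n = d * m\<close>, so a Dirichlet convolution turns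
  into a sum over \<open>d\<close> of partial sums up to \<open>N div d\<close>.\<close>

lemma convolution_sum:
  "(\<Sum>n=1..N. \<chi> n / of_nat n * (\<Sum>d | d dvd n. a d * b (n div d))) =
   (\<Sum>d=1..N. \<chi> d * a d / of_nat d * (\<Sum>m=1..N div d. \<chi> m * b m / of_nat m))"
proof -
  have "(\<Sum>n=1..N. \<chi> n / of_nat n * (\<Sum>d | d dvd n. a d * b (n div d))) =
     (\<Sum>n=1..N. \<Sum>d | d dvd n. (\<lambda>d m. (\<chi> d * a d / of_nat d) * (\<chi> m * b m / of_nat m)) d (n div d))"
  proof (intro sum.cong refl, subst sum_distrib_left, intro sum.cong refl)
    fix n d assume n: "n \<in> {1..N}" and "d \<in> {d. d dvd n}"
    then obtain m where "n = d * m" "d > 0" "m > 0" by (auto elim!: dvdE)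
    then show "\<chi> n / of_nat n * (a d * b (n div d)) =
      (\<lambda>d m. (\<chi> d * a d / of_nat d) * (\<chi> m * b m / of_nat m)) d (n div d)"
      by (simp add: mult field_simps)
  qed
  also have "\<dots> = (\<Sum>d=1..N. \<Sum>m=1..N div d. (\<chi> d * a d / of_nat d) * (\<chi> m * b m / of_nat m))"
    by (rule sum_pairs_mult_le)
  finally show ?thesis by (simp add: sum_distrib_left)
qed

text \<open>For replacing partial sums by their limit inside a Moebius sum; the point is that the
  cost does not grow with \<open>N\<close>.\<close>

lemma convolution_moebius_tail:
  assumes "\<And>k. norm (D k - L) \<le> C * (1 / sqrt (real (Suc k)))" and "C \<ge> 0"
  shows "norm (\<Sum>d=1..N. \<chi> d * of_int (moebius d) / of_nat d * (D (N div d) - L)) \<le> 2 * C"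
proof (rule sum_convolution_bound)
  fix d assume d: "d \<in> {1..N}"
  show "norm (\<chi> d * of_int (moebius d)) \<le> 1"
    using norm_le[of d] norm_moebius_le[of d] unfolding norm_mult by (intro mult_le_one) auto
  have "real N / real d \<le> real (Suc (N div d))"
    using d by (intro real_divide_le_Suc_div) simp
  then have "1 / sqrt (real (Suc (N div d))) \<le> 1 / sqrt (real N / real d)"
    using d by (intro divide_left_mono) auto
  then have "1 / sqrt (real (Suc (N div d))) \<le> sqrt (real d / real N)"
    by (simp add: real_sqrt_divide)
  then show "norm (D (N div d) - L) \<le> C * sqrt (real d / real N)"
    using assms(1)[of "N div d"] mult_left_mono[OF _ \<open>C \<ge> 0\<close>] order_trans by blast
qed fact

text \<open>The Moebius function convolved with 1 is the unit, so the sum weighted by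
  \<open>partial_L (N div d)\<close> is exactly 1 for \<open>N > 0\<close>. Replacing these weights
  by \<open>L\<close> costs at most \<open>4 * B\<close>, and then one divides by
  \<open>L\<close>.\<close>

lemma sum_moebius_bounded:
  assumes "L \<noteq> 0" and L: "\<And>n. norm (partial_L n - L) \<le> 2 * B / real (Suc n)"
  shows "norm (\<Sum>d=1..N. \<chi> d * of_int (moebius d) / of_nat d) \<le> (1 + 4 * B) / norm L"
proof -
  let ?M = "\<Sum>d=1..N. \<chi> d * of_int (moebius d) / of_nat d"
  have eq: "(\<Sum>d=1..N. \<chi> d * of_int (moebius d) / of_nat d * partial_L (N div d)) = (if N = 0 then 0 else 1)"
  proof -
    have "(\<Sum>d=1..N. \<chi> d * of_int (moebius d) / of_nat d * partial_L (N div d)) =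
      (\<Sum>n=1..N. \<chi> n / of_nat n * (\<Sum>d | d dvd n. of_int (moebius d) * 1))"
      unfolding partial_L_def by (subst convolution_sum[where b = "\<lambda>_. 1"]) simp
    also have "\<dots> = (\<Sum>n=1..N. \<chi> n / of_nat n * of_int (\<Sum>d | d dvd n. moebius d))" by simp
    also have "\<dots> = (\<Sum>n=1..N. if n = 1 then 1 else 0)"
      by (intro sum.cong refl, subst sum_moebius_divisors) (use one in auto)
    finally show ?thesis by (simp add: sum.delta')
  qed
  have "norm (\<Sum>d=1..N. \<chi> d * of_int (moebius d) / of_nat d * (partial_L (N div d) - L)) \<le> 2 * (2 * B)"
  proof (rule convolution_moebius_tail)
    fix k
    have "1 / real (Suc k) \<le> 1 / sqrt (real (Suc k))"
      by (intro divide_left_mono real_le_lsqrt) (auto simp: power2_eq_square)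
    then show "norm (partial_L k - L) \<le> 2 * B * (1 / sqrt (real (Suc k)))"
      using L[of k] mult_left_mono[of _ _ "2 * B"] B_nonneg by fastforce
  qed (use B_nonneg in simp)
  also have "(\<Sum>d=1..N. \<chi> d * of_int (moebius d) / of_nat d * (partial_L (N div d) - L)) =
     (if N = 0 then 0 else 1) - ?M * L"
    unfolding eq[symmetric] by (simp add: right_diff_distrib sum_subtractf sum_distrib_right)
  finally have "norm ((if N = 0 then 0 else 1) - ?M * L) \<le> 4 * B" by simp
  then have "norm (?M * L) \<le> 1 + 4 * B"
    using norm_triangle_sub[of "?M * L" "if N = 0 then 0 else 1"] norm_minus_commute[of "?M * L"]
    by (cases "N = 0") simp_all
  then show ?thesis using \<open>L \<noteq> 0\<close> by (simp add: norm_mult field_simps)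
qed

text \<open>The Moebius function convolved with \<open>ln + 1\<close> is \<open>mangoldt\<close>
  plus the unit. Once the partial sums \<open>D\<close> are replaced by their limit
  \<open>L'\<close>, only a multiple of the Moebius sum remains, and \<open>L \<noteq> 0\<close>
  makes that sum bounded.\<close>

lemma mangoldt_sum_bounded:
  assumes "L \<noteq> 0" and L: "\<And>n. norm (partial_L n - L) \<le> 2 * B / real (Suc n)"
  shows "\<exists>C. \<forall>N. norm (partial_mangoldt N) \<le> C"
proof -
  define D where "D = (\<lambda>n. \<Sum>k=1..n. \<chi> k * of_real (ln (real k) + 1) / of_nat k)"
  have D: "(\<Sum>k=1..n. \<chi> k * of_real ((ln (real k) + 1) / real k)) = D n" for n
    by (simp add: D_def)
  obtain L' where L': "\<And>n. norm (D n - L') \<le> 2 * B * ((ln (real (Suc n)) + 1) / real (Suc n))"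
    using partial_log_L_limit[unfolded D] by blast
  let ?M = "\<lambda>N. \<Sum>d=1..N. \<chi> d * of_int (moebius d) / of_nat d"
  have "norm (partial_mangoldt N) \<le> 1 + (8 * B + norm L' * ((1 + 4 * B) / norm L))" for N
  proof -
    have eq: "(\<Sum>d=1..N. \<chi> d * of_int (moebius d) / of_nat d * D (N div d)) =
        partial_mangoldt N + (if N = 0 then 0 else 1)"
    proof -
      have "(\<Sum>d=1..N. \<chi> d * of_int (moebius d) / of_nat d * D (N div d)) =
        (\<Sum>n=1..N. \<chi> n / of_nat n * (\<Sum>d | d dvd n. of_int (moebius d) * of_real (ln (real (n div d)) + 1)))"
        unfolding D_def by (subst convolution_sum) simp
      also have "\<dots> = (\<Sum>n=1..N. \<chi> n / of_nat n * (mangoldt n + (if n = 1 then 1 else 0)))"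
      proof (intro sum.cong refl arg_cong2[where f = "(*)"])
        fix n assume "n \<in> {1..N}"
        then have n: "n > 0" by simp
        have "(\<Sum>d | d dvd n. of_int (moebius d) * of_real (ln (real (n div d)) + 1)) =
          (of_real ((\<Sum>d | d dvd n. of_int (moebius d) * ln (real (n div d))) +
            of_int (\<Sum>d | d dvd n. moebius d)) :: complex)"
          by (simp add: algebra_simps sum.distrib)
        then show "(\<Sum>d | d dvd n. of_int (moebius d) * of_real (ln (real (n div d)) + 1)) =
          (mangoldt n + (if n = 1 then 1 else 0) :: complex)"
          unfolding mangoldt_eq_sum_moebius[OF n] sum_moebius_divisors[OF n] by simp
      qed
      also have "\<dots> = partial_mangoldt N + (\<Sum>n=1..N. if n = 1 then 1 else 0)"
        unfolding partial_mangoldt_def sum.distrib[symmetric]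
        using one by (intro sum.cong refl) auto
      finally show ?thesis by (simp add: sum.delta')
    qed
    have "norm (\<Sum>d=1..N. \<chi> d * of_int (moebius d) / of_nat d * (D (N div d) - L')) \<le> 2 * (4 * B)"
    proof (rule convolution_moebius_tail)
      fix k
      have "(ln (real (Suc k)) + 1) / real (Suc k) \<le> 2 * sqrt (real (Suc k)) / real (Suc k)"
        by (intro divide_right_mono ln_le_sqrt) auto
      also have "\<dots> = 2 * (1 / sqrt (real (Suc k)))"
        using sqrt_divide_self_eq[of "real (Suc k)"] by (simp add: inverse_eq_divide)
      finally have "2 * B * ((ln (real (Suc k)) + 1) / real (Suc k)) \<le> 2 * B * (2 * (1 / sqrt (real (Suc k))))"
        using B_nonneg by (intro mult_left_mono) auto
      then show "norm (D k - L') \<le> 4 * B * (1 / sqrt (real (Suc k)))"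
        using L'[of k] by simp
    qed (use B_nonneg in simp)
    also have "(\<Sum>d=1..N. \<chi> d * of_int (moebius d) / of_nat d * (D (N div d) - L')) =
      partial_mangoldt N + (if N = 0 then 0 else 1) - ?M N * L'"
      unfolding eq[symmetric] by (simp add: right_diff_distrib sum_subtractf sum_distrib_right)
    finally have 1: "norm (partial_mangoldt N + (if N = 0 then 0 else 1) - ?M N * L') \<le> 8 * B" by simp
    have "norm (?M N * L') \<le> (1 + 4 * B) / norm L * norm L'"
      unfolding norm_mult by (intro mult_right_mono sum_moebius_bounded assms) auto
    moreover have "partial_mangoldt N =
       (partial_mangoldt N + (if N = 0 then 0 else 1) - ?M N * L') + ?M N * L' - (if N = 0 then 0 else 1)"
      by simp
    moreover have "norm (if N = 0 then 0 else 1 :: complex) \<le> 1" by simp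
    ultimately have "norm (partial_mangoldt N) \<le> 8 * B + (1 + 4 * B) / norm L * norm L' + 1"
      using 1 by (metis (no_types, lifting) norm_triangle_le_diff norm_triangle_mono add_mono)
    then show ?thesis by (simp add: mult.commute)
  qed
  then show ?thesis by blast
qed

text \<open>The Moebius function is now weighted by \<open>ln (N / d)\<close>, which is
  \<open>ln (n / d) + (ln N - ln n)\<close>; its divisor sum is therefore \<open>mangoldt n\<close>,
  plus \<open>ln N\<close> at \<open>n = 1\<close>. There is no main term to subtract, because
  \<open>partial_L (N div d)\<close> is itself of size \<open>d / N\<close> and the logarithm costs
  only a square root.\<close>

lemma mangoldt_sum_vanishing:
  assumes L: "\<And>n. norm (partial_L n) \<le> 2 * B / real (Suc n)" and "N > 0"
  shows "norm (partial_mangoldt N + of_real (ln (real N))) \<le> 8 * B"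
proof -
  let ?c = "\<lambda>d. of_int (moebius d) * of_real (ln (real N / real d)) :: complex"
  have "(\<Sum>d=1..N. \<chi> d * ?c d / of_nat d * partial_L (N div d)) =
     (\<Sum>n=1..N. \<chi> n / of_nat n * (\<Sum>d | d dvd n. ?c d * 1))"
    unfolding partial_L_def by (subst convolution_sum[where b = "\<lambda>_. 1"]) simp
  also have "\<dots> = (\<Sum>n=1..N. \<chi> n / of_nat n * (mangoldt n + (if n = 1 then of_real (ln (real N)) else 0)))"
  proof (intro sum.cong refl arg_cong2[where f = "(*)"])
    fix n assume "n \<in> {1..N}"
    then have n: "n > 0" by simp
    have "ln (real N / real d) = ln (real (n div d)) + (ln (real N) - ln (real n))" if "d dvd n" for d
      using that n \<open>N > 0\<close> by (auto elim!: dvdE simp: ln_div ln_mult)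
    then have "(\<Sum>d | d dvd n. ?c d * 1) =
       (\<Sum>d | d dvd n. of_int (moebius d) * of_real (ln (real (n div d)) + (ln (real N) - ln (real n))))"
      by simp
    also have "\<dots> = (of_real ((\<Sum>d | d dvd n. of_int (moebius d) * ln (real (n div d))) +
            (ln (real N) - ln (real n)) * of_int (\<Sum>d | d dvd n. moebius d)) :: complex)"
      by (simp add: algebra_simps sum.distrib sum_distrib_left sum_subtractf)
    also have "\<dots> = mangoldt n + (if n = 1 then of_real (ln (real N)) else 0)"
      unfolding mangoldt_eq_sum_moebius[OF n] sum_moebius_divisors[OF n] by auto
    finally show "(\<Sum>d | d dvd n. ?c d * 1) = mangoldt n + (if n = 1 then of_real (ln (real N)) else 0)" .
  qed
  also have "\<dots> = partial_mangoldt N + (\<Sum>n=1..N. if n = 1 then of_real (ln (real N)) else 0)"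
    unfolding partial_mangoldt_def sum.distrib[symmetric]
    using one by (intro sum.cong refl) auto
  also have "(\<Sum>n=1..N. if n = 1 then of_real (ln (real N)) else 0) = (of_real (ln (real N)) :: complex)"
    using \<open>N > 0\<close> by (simp add: sum.delta')
  finally have eq: "(\<Sum>d=1..N. \<chi> d * of_int (moebius d) / of_nat d *
      (of_real (ln (real N / real d)) * partial_L (N div d))) = partial_mangoldt N + of_real (ln (real N))"
    by (simp add: mult_ac)
  have "norm (\<Sum>d=1..N. \<chi> d * of_int (moebius d) / of_nat d *
      (of_real (ln (real N / real d)) * partial_L (N div d))) \<le> 2 * (4 * B)"
  proof (rule sum_convolution_bound)
    fix d assume d: "d \<in> {1..N}"
  show "norm (\<chi> d * of_int (moebius d)) \<le> 1"
      using norm_le[of d] norm_moebius_le[of d] unfolding norm_mult by (intro mult_le_one) auto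
    let ?y = "real N / real d"
    have y: "?y \<ge> 1" using d by simp
    have "?y \<le> real (Suc (N div d))"
      using d by (intro real_divide_le_Suc_div) simp
    then have "2 * B / real (Suc (N div d)) \<le> 2 * B / ?y"
      using B_nonneg y by (intro divide_left_mono mult_pos_pos) linarith+
    then have "norm (partial_L (N div d)) \<le> 2 * B / ?y" using L order_trans by blast
    moreover have "norm (of_real (ln ?y) :: complex) \<le> 2 * sqrt ?y"
      using y ln_le_sqrt(2)[of ?y] by (subst norm_of_real) auto
    ultimately have "norm (of_real (ln ?y) * partial_L (N div d)) \<le> 2 * sqrt ?y * (2 * B / ?y)"
      unfolding norm_mult using y by (intro mult_mono) auto
    also have "\<dots> = 4 * B * (sqrt ?y / ?y)" by simp
    also have "sqrt ?y / ?y = sqrt (real d / real N)"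
      using y sqrt_divide_self_eq[of ?y] by (simp add: real_sqrt_divide)
    finally show "norm (of_real (ln ?y) * partial_L (N div d)) \<le> 4 * B * sqrt (real d / real N)" .
  qed (use B_nonneg in simp)
  then show ?thesis unfolding eq by simp
qed

end

section \<open>Roots of unity and their orthogonality\<close>

definition root_unity :: "nat \<Rightarrow> nat \<Rightarrow> complex" where
  "root_unity N k = cis (2 * pi * real k / real N)"

lemma root_unity_0 [simp]: "root_unity N 0 = 1"
  by (simp add: root_unity_def)

lemma root_unity_add: "root_unity N (a + b) = root_unity N a * root_unity N b"
  by (simp add: root_unity_def cis_mult add_divide_distrib algebra_simps)

lemma root_unity_mult: "root_unity N (a * b) = root_unity N a ^ b"
  by (induction b) (simp_all add: root_unity_add)

lemma root_unity_self [simp]: "N > 0 \<Longrightarrow> root_unity N N = 1"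
  by (simp add: root_unity_def)

lemma norm_root_unity [simp]: "norm (root_unity N k) = 1"
  by (simp add: root_unity_def)

lemma root_unity_mod: "N > 0 \<Longrightarrow> root_unity N (k mod N) = root_unity N k"
  using root_unity_add[of N "N * (k div N)" "k mod N"] by (simp add: root_unity_mult)

lemma root_unity_cong: "N > 0 \<Longrightarrow> [a = b] (mod N) \<Longrightarrow> root_unity N a = root_unity N b"
  by (metis root_unity_mod cong_def)

lemma root_unity_eq_1_iff: "N > 0 \<Longrightarrow> root_unity N k = 1 \<longleftrightarrow> N dvd k"
proof -
  assume N: "N > 0"
  have "root_unity N (k mod N) = root_unity N 0 \<longleftrightarrow> k mod N = 0"
    using N bij_betw_imp_inj_on[OF bij_betw_roots_unity[OF N]]
    by (auto simp: root_unity_def inj_on_def)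
  then show ?thesis using N by (simp add: root_unity_mod mod_eq_0_iff_dvd)
qed

lemma sum_root_unity:
  assumes "N > 0"
  shows "(\<Sum>i<N. root_unity N (k * i)) = (if N dvd k then of_nat N else 0)"
proof (cases "N dvd k")
  case True
  then show ?thesis using assms
    by (simp add: root_unity_mult root_unity_eq_1_iff[THEN iffD2])
next
  case False
  then have ne: "root_unity N k \<noteq> 1" using assms by (simp add: root_unity_eq_1_iff)
  have "root_unity N k ^ N = 1"
    using assms by (metis mult.commute root_unity_mult root_unity_self power_one)
  then have "(\<Sum>i<N. root_unity N k ^ i) = 0"
    using ne geometric_sum[OF ne, of N] by simp
  then show ?thesis using False by (simp add: root_unity_mult)
qed

text \<open>Exponents are natural numbers, so \<open>N - k\<close> stands for the negative of
  \<open>k\<close>.\<close>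

lemma cnj_root_unity:
  assumes "k \<le> N" "N > 0" shows "cnj (root_unity N (k * a)) = root_unity N ((N - k) * a)"
proof -
  have "root_unity N (k * a) * root_unity N ((N - k) * a) = root_unity N (N * a)"
    using assms by (simp add: root_unity_add[symmetric] algebra_simps)
  also have "\<dots> = 1" using assms by (simp add: root_unity_mult)
  finally have 1: "root_unity N (k * a) * root_unity N ((N - k) * a) = 1" .
  have "cnj (root_unity N (k * a)) * root_unity N (k * a) = 1"
    by (simp add: root_unity_def cis_cnj cis_mult)
  then show ?thesis using 1
    by (metis mult.assoc mult.commute mult.right_neutral)
qed

section \<open>Bounds of Mertens type obtained from the factorial\<close>

lemma ln_fact_ge: "ln (fact N) \<ge> real N * ln (real N) - real N"
proof (induction N)
  case (Suc N)
  show ?case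
  proof (cases "N = 0")
    case False
    have "ln (real (Suc N)) - ln (real N) = ln (1 + 1 / real N)"
      using False ln_div[of "real (Suc N)" "real N"] by (simp add: field_simps)
    also have "\<dots> \<le> 1 / real N" by (rule ln_add_one_self_le_self) simp
    finally have "real N * (ln (real (Suc N)) - ln (real N)) \<le> 1"
      using False by (simp add: field_simps)
    moreover have "ln (fact (Suc N)) = ln (real (Suc N)) + ln (fact N :: real)"
      by (simp add: ln_mult)
    ultimately show ?thesis using Suc by (simp add: algebra_simps)
  qed simp
qed simp

text \<open>Legendre's formula: \<open>ln n\<close> is the sum of \<open>mangoldt\<close> over the
  divisors of \<open>n\<close>, and \<open>N div d\<close> of the numbers up to \<open>N\<close> are
  multiples of \<open>d\<close>.\<close>

lemma ln_fact_eq_mangoldt: "ln (fact N :: real) = (\<Sum>d=1..N. mangoldt d * real (N div d))"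
proof -
  have "ln (fact N :: real) = (\<Sum>n=1..N. ln (real n))"
    using ln_prod[of "{1..N}" real] by (simp add: fact_prod)
  also have "\<dots> = (\<Sum>n=1..N. \<Sum>d | d dvd n. mangoldt d)"
    by (intro sum.cong refl) (use mangoldt_sum[where 'a = real] in auto)
  also have "\<dots> = (\<Sum>d=1..N. \<Sum>m=1..N div d. mangoldt d)"
    using sum_pairs_mult_le[of "\<lambda>d m. mangoldt d :: real" N] by simp
  finally show ?thesis by (simp add: mult.commute)
qed

lemma mangoldt_over_n_lower:
  assumes "N > 0" shows "ln (real N) - 1 \<le> (\<Sum>d=1..N. mangoldt d / real d)"
proof -
  have "real N * ln (real N) - real N \<le> (\<Sum>d=1..N. mangoldt d * real (N div d))"
    using ln_fact_ge[of N] ln_fact_eq_mangoldt[of N] by simp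
  also have "\<dots> \<le> (\<Sum>d=1..N. mangoldt d * (real N / real d))"
    by (intro sum_mono mult_left_mono of_nat_div_le_of_nat mangoldt_nonneg)
  also have "\<dots> = real N * (\<Sum>d=1..N. mangoldt d / real d)"
    by (simp add: sum_distrib_left mult_ac)
  finally have "real N * (ln (real N) - 1) \<le> real N * (\<Sum>d=1..N. mangoldt d / real d)"
    by (simp add: algebra_simps)
  then show ?thesis using assms by simp
qed

text \<open>
  Any constant below \<open>2\<close> in place of \<open>3/2\<close> excludes two vanishing \<open>L\<close>-values in
  \<open>exists_prime_primitive_root\<close>, so no Chebyshev bound is needed.
\<close>

lemma mangoldt_over_n_upper:
  assumes "N > 0" shows "(\<Sum>d=1..N. mangoldt d / real d) \<le> 3 / 2 * (ln (real N) + ln 2)"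
proof -
  \<comment> \<open>Doubling makes \<open>?K div d\<close> at least 2 for all
    \<open>d \<le> N\<close>, and an integer part that is at least 2 is at least two thirds of the
    number. This is the origin of \<open>3 / 2\<close>.\<close>
  let ?K = "2 * N"
  have "2 / 3 * real ?K * (\<Sum>d=1..N. mangoldt d / real d) = (\<Sum>d=1..N. mangoldt d * (2 / 3 * (real ?K / real d)))"
    by (simp add: sum_distrib_left mult_ac)
  also have "\<dots> \<le> (\<Sum>d=1..N. mangoldt d * real (?K div d))"
  proof (intro sum_mono mult_left_mono mangoldt_nonneg)
    fix d assume d: "d \<in> {1..N}"
    then have "2 \<le> ?K div d" by (simp add: less_eq_div_iff_mult_less_eq)
    moreover have "real ?K / real d \<le> real (Suc (?K div d))"
      using d by (intro real_divide_le_Suc_div) auto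
    ultimately show "2 / 3 * (real ?K / real d) \<le> real (?K div d)" by linarith
  qed
  also have "\<dots> \<le> (\<Sum>d=1..?K. mangoldt d * real (?K div d))"
    by (intro sum_mono2) (auto intro!: mult_nonneg_nonneg mangoldt_nonneg)
  also have "\<dots> = ln (fact ?K)" by (rule ln_fact_eq_mangoldt[symmetric])
  also have "\<dots> \<le> ln (real ?K ^ ?K)"
    by (subst ln_le_cancel_iff) (use assms in \<open>auto simp del: power_mult intro: fact_le_power[THEN order_trans]\<close>)
  also have "\<dots> = real ?K * (ln (real N) + ln 2)"
    using assms by (simp add: ln_realpow ln_mult distrib_left del: power_mult)
  finally have "real ?K * (2 / 3 * (\<Sum>d=1..N. mangoldt d / real d)) \<le> real ?K * (ln (real N) + ln 2)"
    by (simp add: mult_ac)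
  then show ?thesis using assms by simp
qed

text \<open>A prime power divisible by the prime \<open>M\<close> is a power of \<open>M\<close>, so
  a geometric series with ratio at most one half bounds the sum.\<close>

lemma mangoldt_multiples_le:
  assumes "Factorial_Ring.prime (M::nat)"
  shows "(\<Sum>n | n \<in> {1..N} \<and> M dvd n. mangoldt n / real n) \<le> ln (real M)"
proof -
  have M: "M \<ge> 2" using assms by (rule prime_ge_2_nat)
  have sub: "{n \<in> {1..N}. M dvd n \<and> primepow n} \<subseteq> (\<lambda>k. M ^ k) ` {1..N}"
  proof
    fix n assume n: "n \<in> {n \<in> {1..N}. M dvd n \<and> primepow n}"
    then obtain p k where pk: "Factorial_Ring.prime p" "k > 0" "n = p ^ k" by (auto simp: primepow_def)
    then have "M = p" using n assms prime_dvd_power[of M p k] primes_dvd_imp_eq[of M p] by simp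
    moreover have "k \<le> N"
    proof -
      have "k < 2 ^ k" by (rule less_exp)
      also have "\<dots> \<le> M ^ k" using M by (rule power_mono) simp
      finally show ?thesis using n pk \<open>M = p\<close> by simp
    qed
    ultimately show "n \<in> (\<lambda>k. M ^ k) ` {1..N}" using pk by auto
  qed
  have "(\<Sum>n | n \<in> {1..N} \<and> M dvd n. mangoldt n / real n) =
      (\<Sum>n | n \<in> {1..N} \<and> M dvd n \<and> primepow n. mangoldt n / real n)"
    by (intro sum.mono_neutral_right) (auto simp: mangoldt_def)
  also have "\<dots> \<le> (\<Sum>n\<in>(\<lambda>k. M ^ k) ` {1..N}. mangoldt n / real n)"
    by (intro sum_mono2) (use sub in \<open>auto intro!: divide_nonneg_nonneg mangoldt_nonneg\<close>)
  also have "\<dots> = (\<Sum>k=1..N. ln (real M) * (1 / real M) ^ k)"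
    using M assms by (subst sum.reindex)
      (auto simp: inj_on_def power_divide intro!: sum.cong)
  also have "\<dots> \<le> (\<Sum>k=1..N. ln (real M) * (1 / 2) ^ k)"
    using M by (intro sum_mono mult_left_mono power_mono) (auto simp: field_simps)
  also have "\<dots> = ln (real M) * (\<Sum>k=1..N. (1 / 2) ^ k)" by (simp add: sum_distrib_left)
  also have "(\<Sum>k=1..N. (1 / 2) ^ k) = 1 - (1 / 2 :: real) ^ N"
    by (induction N) auto
  also have "ln (real M) * \<dots> \<le> ln (real M) * 1"
    using M by (intro mult_left_mono) auto
  finally show ?thesis by simp
qed

section \<open>Dirichlet characters modulo a prime\<close>

locale primroot_modulus =
  fixes M g :: nat
  assumes prime_M: "Factorial_Ring.prime M" and primroot: "residue_primroot M g"
begin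

definition "N = M - 1"

lemma N_pos: "N > 0" using prime_gt_1_nat[OF prime_M] by (simp add: N_def)

lemma totient_M: "totient M = N"
  using totient_prime[OF prime_M] by (simp add: N_def)

lemma coprime_g: "coprime M g" and ord_g: "ord M g = N"
  using primroot totient_M by (auto simp: residue_primroot_def)

text \<open>Only the class modulo \<open>N\<close> matters: every use is inside
  \<open>root_unity N\<close> or in a congruence modulo \<open>N\<close>. At multiples of
  \<open>M\<close> the value is arbitrary, and \<open>character\<close> discards it.\<close>

definition dlog :: "nat \<Rightarrow> nat" where
  "dlog n = (SOME i. [g ^ i = n] (mod M))"

lemma dlog:
  assumes "\<not> M dvd n" shows "[g ^ dlog n = n] (mod M)"
proof -
  have "n mod M \<in> totatives M"
    using assms prime_M prime_gt_1_nat[OF prime_M]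
    by (auto simp: totatives_def mod_greater_zero_iff_not_dvd prime_imp_coprime coprime_commute
        intro!: less_imp_le)
  also have "totatives M = (\<lambda>i. g ^ i mod M) ` {..<totient M}"
    using bij_betw_imp_surj_on[OF residue_primroot_is_generator[OF prime_gt_1_nat[OF prime_M] primroot]] ..
  finally obtain i where "[g ^ i = n] (mod M)" by (auto simp: cong_def)
  then show ?thesis unfolding dlog_def by (rule someI)
qed

lemma dlog_cong_iff:
  assumes "\<not> M dvd n" shows "[dlog n = e] (mod N) \<longleftrightarrow> [n = g ^ e] (mod M)"
  using order_divides_expdiff[OF coprime_g, of "dlog n" e] dlog[OF assms] ord_g
  by (metis cong_sym cong_trans)

text \<open>The Dirichlet characters modulo \<open>M\<close>: the unit group is generated by
  \<open>g\<close>, so they are the powers of the one with value \<open>root_unity N 1\<close> at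
  \<open>g\<close>. The principal one is \<open>k = 0\<close>.\<close>

definition character :: "nat \<Rightarrow> nat \<Rightarrow> complex" where
  "character k n = (if M dvd n then 0 else root_unity N (k * dlog n))"

lemma character_mult: "character k (m * n) = character k m * character k n"
proof (cases "M dvd m \<or> M dvd n")
  case False
  then have nd: "\<not> M dvd m * n" using prime_M by (simp add: prime_dvd_mult_iff)
  have "[m * n = g ^ (dlog m + dlog n)] (mod M)"
    using False dlog[of m] dlog[of n] unfolding power_add by (metis cong_mult cong_sym)
  then have "[dlog (m * n) = dlog m + dlog n] (mod N)" using nd by (simp add: dlog_cong_iff)
  then have "[k * dlog (m * n) = k * (dlog m + dlog n)] (mod N)" by (rule cong_scalar_left)
  from root_unity_cong[OF N_pos this] show ?thesis using False nd
    by (simp add: character_def distrib_left root_unity_add)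
qed (auto simp: character_def)

lemma character_cong:
  assumes "[m = n] (mod M)" shows "character k m = character k n"
proof (cases "M dvd n")
  case False
  then have "\<not> M dvd m" using assms by (simp add: cong_dvd_iff)
  then have "[dlog m = dlog n] (mod N)"
    using dlog_cong_iff assms dlog[OF False] by (metis cong_sym cong_trans)
  then have "[k * dlog m = k * dlog n] (mod N)" by (rule cong_scalar_left)
  from root_unity_cong[OF N_pos this] show ?thesis
    using False \<open>\<not> M dvd m\<close> by (simp add: character_def)
qed (use assms in \<open>simp add: character_def cong_dvd_iff\<close>)

lemma character_one: "character k 1 = 1"
proof -
  have "\<not> M dvd 1" using prime_M by auto
  then have "[dlog 1 = 0] (mod N)" by (subst dlog_cong_iff) auto
  then have "[k * dlog 1 = k * 0] (mod N)" by (rule cong_scalar_left)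
  from root_unity_cong[OF N_pos this] show ?thesis using \<open>\<not> M dvd 1\<close> by (simp add: character_def)
qed

lemma norm_character: "norm (character k n) \<le> 1"
  by (simp add: character_def)

text \<open>For \<open>n = 0\<close> the units are listed as powers of \<open>g\<close>, which gives
  a full sum of roots of unity; it vanishes because \<open>N\<close> does not divide
  \<open>k\<close>. Shifting the window by one exchanges a term for a congruent one.\<close>

lemma sum_character_block:
  assumes "0 < k" "k < N"
  shows "(\<Sum>j=1..M. character k (n + j)) = 0"
proof (induction n)
  case 0
  have M: "M > 1" using prime_M by (rule prime_gt_1_nat)
  have "(\<Sum>j=1..M. character k j) = (\<Sum>j\<in>totatives M. character k j)"
  proof (rule sum.mono_neutral_right)
    show "\<forall>i\<in>{1..M} - totatives M. character k i = 0"
      using prime_M by (auto simp: totatives_def character_def coprime_commute dest: prime_imp_coprime)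
  qed (auto simp: totatives_def)
  also have "\<dots> = (\<Sum>i<totient M. character k (g ^ i mod M))"
    using residue_primroot_is_generator[OF M primroot] by (rule sum.reindex_bij_betw[symmetric])
  also have "\<dots> = (\<Sum>i<N. root_unity N (k * i))"
  proof (intro sum.cong)
    fix i
    have "\<not> M dvd g ^ i" using prime_M coprime_g
      by (metis prime_dvd_power coprime_absorb_left not_prime_unit)
    moreover from this have "[dlog (g ^ i) = i] (mod N)" by (simp add: dlog_cong_iff)
    then have "[k * dlog (g ^ i) = k * i] (mod N)" by (rule cong_scalar_left)
    from root_unity_cong[OF N_pos this] have "root_unity N (k * dlog (g ^ i)) = root_unity N (k * i)" .
    ultimately have "character k (g ^ i) = root_unity N (k * i)" by (simp add: character_def)
    then show "character k (g ^ i mod M) = root_unity N (k * i)"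
      using character_cong[of "g ^ i mod M" "g ^ i"] by (simp add: cong_def)
  qed (simp add: totient_M)
  also have "\<dots> = 0"
    using assms N_pos by (subst sum_root_unity) (auto dest: dvd_imp_le)
  finally show ?case by simp
next
  case (Suc n)
  have M: "M > 0" using prime_gt_0_nat[OF prime_M] .
  have "(\<Sum>j=1..M. character k (Suc n + j)) = (\<Sum>j=Suc 1..Suc M. character k (n + j))"
    by (subst sum.shift_bounds_cl_Suc_ivl) simp
  also have "\<dots> = (\<Sum>j=1..M. character k (n + j)) + character k (n + Suc M) - character k (n + 1)"
    using M sum.atLeast_Suc_atMost[of 1 M "\<lambda>j. character k (n + j)"] by simp
  also have "character k (n + Suc M) = character k (n + 1)"
    by (rule character_cong) (use mod_add_self2[of "Suc n" M] in \<open>simp add: cong_def\<close>)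
  finally show ?case using Suc by simp
qed

text \<open>Blocks of length \<open>M\<close> cancel, and fewer than \<open>M\<close> terms of norm
  at most 1 remain.\<close>

lemma sum_character_bound:
  assumes "0 < k" "k < N"
  shows "norm (\<Sum>j=1..n. character k j) \<le> real M"
proof (induction n rule: less_induct)
  case (less n)
  show ?case
  proof (cases "n < M")
    case True
    have "norm (\<Sum>j=1..n. character k j) \<le> (\<Sum>j=1..n. 1)"
      by (intro sum_norm_le norm_character)
    then show ?thesis using True by simp
  next
    case False
    then have "(\<Sum>j=1..n. character k j) =
       (\<Sum>j=1..n - M. character k j) + (\<Sum>j=Suc (n - M)..n. character k j)"
      using sum.ub_add_nat[of 1 "n - M" "character k" M] by simp
    also have "(\<Sum>j=Suc (n - M)..n. character k j) = (\<Sum>j=1..M. character k ((n - M) + j))"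
      using False sum.shift_bounds_cl_nat_ivl[of "character k" 1 "n - M" M] by (simp add: add.commute)
    also have "\<dots> = 0" by (rule sum_character_block[OF assms])
    finally show ?thesis using less[of "n - M"] False prime_gt_0_nat[OF prime_M] by simp
  qed
qed

lemma bounded_character: "0 < k \<Longrightarrow> k < N \<Longrightarrow> bounded_character (character k) (real M)"
  using character_mult character_one norm_character sum_character_bound
  by unfold_locales auto

definition "chi_mangoldt k n = (\<Sum>j=1..n. character k j * mangoldt j / of_nat j)"

text \<open>The nonprincipal characters with L(1) = 0. This set is not shown to be empty: the
  existence proof bounds its size by 1 and copes with a real character in it.\<close>

definition "vanishing = {k \<in> {1..<N}. (\<lambda>n. \<Sum>j=1..n. character k j / of_nat j) \<longlonglongrightarrow> 0}"

lemma chi_mangoldt_asymp: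
  assumes "k \<in> {1..<N}"
  shows "\<exists>C. \<forall>n>0. norm (chi_mangoldt k n + (if k \<in> vanishing then of_real (ln (real n)) else 0)) \<le> C"
proof -
  interpret bounded_character "character k" "real M"
    using assms by (intro bounded_character) auto
  obtain L where L: "\<And>n. norm (partial_L n - L) \<le> 2 * real M / real (Suc n)"
    using partial_L_limit by blast
  have lim: "partial_L \<longlonglongrightarrow> L"
  proof (rule LIM_zero_cancel, rule tendsto_norm_zero_cancel, rule tendsto_sandwich)
    show "\<forall>\<^sub>F n in sequentially. 0 \<le> norm (partial_L n - L)" by simp
    show "(\<lambda>n. 0 :: real) \<longlonglongrightarrow> 0" by simp
    show "\<forall>\<^sub>F n in sequentially. norm (partial_L n - L) \<le> 2 * real M / real (Suc n)" using L by simp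
    show "(\<lambda>n. 2 * real M / real (Suc n)) \<longlonglongrightarrow> 0"
      using LIMSEQ_Suc[OF lim_const_over_n[of "2 * real M"]] by simp
  qed
  have eq: "chi_mangoldt k = partial_mangoldt"
    by (simp add: fun_eq_iff chi_mangoldt_def partial_mangoldt_def)
  have van: "k \<in> vanishing \<longleftrightarrow> L = 0"
    using lim assms unfolding vanishing_def partial_L_def[abs_def]
    by (auto dest: LIMSEQ_unique)
  show ?thesis
  proof (cases "L = 0")
    case True
    then have "\<forall>n>0. norm (partial_mangoldt n + of_real (ln (real n))) \<le> 8 * real M"
      using L by (auto intro!: mangoldt_sum_vanishing)
    then show ?thesis using True van by (auto simp: eq)
  next
    case False
    then show ?thesis using mangoldt_sum_bounded[OF False L] van by (auto simp: eq)
  qed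
qed

lemma chi_mangoldt_0: "chi_mangoldt 0 n = of_real (\<Sum>j | j \<in> {1..n} \<and> \<not> M dvd j. mangoldt j / real j)"
proof -
  have "chi_mangoldt 0 n = (\<Sum>j | j \<in> {1..n} \<and> \<not> M dvd j. mangoldt j / of_nat j)"
    unfolding chi_mangoldt_def character_def
    by (intro sum.mono_neutral_cong_right) auto
  then show ?thesis by simp
qed

text \<open>For the lower bound, dropping the multiples of \<open>M\<close> from the sum over all
  prime powers costs at most \<open>ln M\<close>.\<close>

lemma chi_mangoldt_0_bounds:
  assumes "n > 0"
  shows "ln (real n) - 1 - ln (real M) \<le> Re (chi_mangoldt 0 n)"
    and "Re (chi_mangoldt 0 n) \<le> 3 / 2 * (ln (real n) + ln 2)"
proof -
  let ?f = "\<lambda>j. mangoldt j / real j"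
  have "(\<Sum>j=1..n. ?f j) = (\<Sum>j | j \<in> {1..n} \<and> \<not> M dvd j. ?f j) + (\<Sum>j | j \<in> {1..n} \<and> M dvd j. ?f j)"
    by (subst sum.union_disjoint[symmetric]) (auto intro!: sum.cong)
  then show "ln (real n) - 1 - ln (real M) \<le> Re (chi_mangoldt 0 n)"
    using mangoldt_over_n_lower[OF assms] mangoldt_multiples_le[OF prime_M, of n]
    unfolding chi_mangoldt_0 Re_complex_of_real by linarith
  have "(\<Sum>j | j \<in> {1..n} \<and> \<not> M dvd j. ?f j) \<le> (\<Sum>j=1..n. ?f j)"
    by (intro sum_mono2) (auto intro!: divide_nonneg_nonneg mangoldt_nonneg)
  then show "Re (chi_mangoldt 0 n) \<le> 3 / 2 * (ln (real n) + ln 2)"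
    using mangoldt_over_n_upper[OF assms] unfolding chi_mangoldt_0 Re_complex_of_real by linarith
qed

text \<open>Orthogonality of characters: the twists \<open>root_unity N (k * a)\<close> select the
  \<open>j\<close> with \<open>dlog j\<close> congruent to \<open>- a\<close> modulo
  \<open>N\<close>.\<close>

lemma sum_chi_mangoldt:
  "(\<Sum>k<N. root_unity N (k * a) * chi_mangoldt k n) =
    (\<Sum>j | j \<in> {1..n} \<and> \<not> M dvd j \<and> N dvd a + dlog j. of_nat N * mangoldt j / of_nat j)"
proof -
  have "(\<Sum>k<N. root_unity N (k * a) * chi_mangoldt k n) =
     (\<Sum>j=1..n. (\<Sum>k<N. root_unity N (k * a) * character k j) * (mangoldt j / of_nat j))"
    unfolding chi_mangoldt_def sum_distrib_left sum_distrib_right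
    by (subst sum.swap) (simp add: mult.assoc)
  also have "\<dots> = (\<Sum>j=1..n. (if \<not> M dvd j \<and> N dvd a + dlog j then of_nat N else 0) * (mangoldt j / of_nat j))"
  proof (intro sum.cong refl arg_cong2[where f = "(*)"])
    fix j
    show "(\<Sum>k<N. root_unity N (k * a) * character k j) =
       (if \<not> M dvd j \<and> N dvd a + dlog j then of_nat N else 0)"
    proof (cases "M dvd j")
      case False
      then have "(\<Sum>k<N. root_unity N (k * a) * character k j) = (\<Sum>k<N. root_unity N ((a + dlog j) * k))"
        by (intro sum.cong refl) (simp add: character_def root_unity_add[symmetric] algebra_simps)
      then show ?thesis using False sum_root_unity[OF N_pos, of "a + dlog j"] by simp
    qed (simp add: character_def)
  qed
  also have "\<dots> = (\<Sum>j | j \<in> {1..n} \<and> \<not> M dvd j \<and> N dvd a + dlog j. of_nat N * mangoldt j / of_nat j)"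
    by (intro sum.mono_neutral_cong_right) auto
  finally show ?thesis .
qed

lemma vanishing_conj:
  assumes "k \<in> vanishing" shows "N - k \<in> vanishing"
proof -
  have k: "0 < k" "k < N" using assms by (auto simp: vanishing_def)
  have "(\<lambda>n. cnj (\<Sum>j=1..n. character k j / of_nat j)) \<longlonglongrightarrow> cnj 0"
    using assms unfolding vanishing_def by (intro tendsto_cnj) auto
  moreover have "cnj (character k j) = character (N - k) j" for j
    using k by (simp add: character_def cnj_root_unity)
  ultimately show ?thesis using k by (auto simp: vanishing_def)
qed

end

lemma ln_bounded_contradiction:
  assumes "\<And>n. n > 0 \<Longrightarrow> c * ln (real n) \<le> C" "c > 0" shows False
proof -
  have "filterlim (\<lambda>n. ln (real n)) at_top sequentially"
    by (rule filterlim_compose[OF ln_at_top filterlim_real_sequentially])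
  then have "eventually (\<lambda>n. ln (real n) > C / c) sequentially"
    by (rule filterlim_at_top_dense[THEN iffD1, rule_format])
  then obtain n0 where n0: "\<And>n. n \<ge> n0 \<Longrightarrow> ln (real n) > C / c" by (auto simp: eventually_sequentially)
  from n0[of "Suc n0"] assms(1)[of "Suc n0"] \<open>c > 0\<close> show False
    by (simp add: field_simps)
qed

text \<open>
  Non-vanishing of \<open>L(1,\<chi>)\<close> is only needed for complex \<open>\<chi>\<close>: the quadratic character takes the value
  \<open>-1\<close> at a primitive root, so there a zero of its \<open>L\<close>-function increases the main term.
\<close>
theorem exists_prime_primitive_root:
  assumes "Factorial_Ring.prime (M::nat)"
  shows "\<exists>p. Factorial_Ring.prime p \<and> ord M p = M - 1"
proof (rule ccontr)
  assume no: "\<not> ?thesis"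
  obtain g where "residue_primroot M g"
    using prime_primitive_root_exists[OF prime_gt_1_nat[OF assms] assms] by blast
  then interpret primroot_modulus M g using assms by unfold_locales
  define V where "V = vanishing"
  have V: "V \<subseteq> {1..<N}" by (auto simp: V_def vanishing_def)
  then have finV: "finite V" by (rule finite_subset) simp
  define \<delta> where "\<delta> = (\<lambda>k n. chi_mangoldt k n + (if k \<in> V then of_real (ln (real n)) else 0))"
  obtain C where C: "\<And>k n. k \<in> {1..<N} \<Longrightarrow> n > 0 \<Longrightarrow> norm (\<delta> k n) \<le> C k"
    using chi_mangoldt_asymp unfolding V_def \<delta>_def by metis
  define C' where "C' = (\<Sum>k\<in>{1..<N}. C k)"
  \<comment> \<open>Each character in \<open>V\<close> contributes \<open>- ln n\<close> times its
    twist, every other nonprincipal one only a bounded term; \<open>\<delta>\<close> collects the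
    bounded parts.\<close>
  have split: "Re (\<Sum>k<N. root_unity N (k * a) * chi_mangoldt k n) =
     Re (chi_mangoldt 0 n) + Re (\<Sum>k\<in>{1..<N}. root_unity N (k * a) * \<delta> k n) -
     (\<Sum>k\<in>V. Re (root_unity N (k * a))) * ln (real n)" for a n
  proof -
    have "(\<Sum>k<N. root_unity N (k * a) * chi_mangoldt k n) =
       chi_mangoldt 0 n + (\<Sum>k\<in>{1..<N}. root_unity N (k * a) * chi_mangoldt k n)"
      using N_pos by (simp add: lessThan_atLeast0 sum.atLeast_Suc_lessThan)
    also have "(\<Sum>k\<in>{1..<N}. root_unity N (k * a) * chi_mangoldt k n) =
        (\<Sum>k\<in>{1..<N}. root_unity N (k * a) * \<delta> k n) -
        (\<Sum>k\<in>{1..<N}. if k \<in> V then root_unity N (k * a) * of_real (ln (real n)) else 0)"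
      unfolding sum_subtractf[symmetric] by (intro sum.cong) (auto simp: \<delta>_def algebra_simps)
    also have "(\<Sum>k\<in>{1..<N}. if k \<in> V then root_unity N (k * a) * of_real (ln (real n)) else 0) =
       (\<Sum>k\<in>V. root_unity N (k * a) * of_real (ln (real n)))"
      using V by (simp add: sum.If_cases Int_absorb1)
    finally show ?thesis by (simp add: sum_distrib_right)
  qed
  have bd: "\<bar>Re (\<Sum>k\<in>{1..<N}. root_unity N (k * a) * \<delta> k n)\<bar> \<le> C'" if "n > 0" for a n
  proof -
    have "\<bar>Re (\<Sum>k\<in>{1..<N}. root_unity N (k * a) * \<delta> k n)\<bar> \<le> norm (\<Sum>k\<in>{1..<N}. root_unity N (k * a) * \<delta> k n)"
      by (rule abs_Re_le_cmod)
    also have "\<dots> \<le> C'" unfolding C'_def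
      by (intro sum_norm_le) (use C that in \<open>auto simp: norm_mult\<close>)
    finally show ?thesis .
  qed
  \<comment> \<open>For \<open>a = 0\<close> the twisted sum has nonnegative terms only, while it is
    at most \<open>(3 / 2 - card V) * ln n\<close> plus a constant.\<close>
  have "card V \<le> 1"
  proof (rule ccontr)
    assume "\<not> card V \<le> 1"
    then have V2: "real (card V) \<ge> 2" by simp
    show False
    proof (rule ln_bounded_contradiction)
      fix n :: nat assume n: "n > 0"
      have pos: "0 \<le> Re (\<Sum>k<N. root_unity N (k * 0) * chi_mangoldt k n)"
      proof -
        have "(\<Sum>k<N. root_unity N (k * 0) * chi_mangoldt k n) =
          of_real (\<Sum>j | j \<in> {1..n} \<and> \<not> M dvd j \<and> N dvd 0 + dlog j. real N * mangoldt j / real j)"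
          unfolding sum_chi_mangoldt by simp
        then show ?thesis
          by (simp add: sum_nonneg mangoldt_nonneg)
      qed
      have card: "(\<Sum>k\<in>V. Re (root_unity N (k * 0))) = real (card V)" by simp
      have "0 \<le> 3 / 2 * (ln (real n) + ln 2) + C' - real (card V) * ln (real n)"
        using pos split[of 0 n] bd[OF n, of 0] chi_mangoldt_0_bounds(2)[OF n] unfolding card by linarith
      moreover have "2 * ln (real n) \<le> real (card V) * ln (real n)"
        using n V2 by (intro mult_right_mono) auto
      ultimately show "1 / 2 * ln (real n) \<le> 3 / 2 * ln 2 + C'" by argo
    qed simp
  qed
  \<comment> \<open>Conjugation permutes \<open>V\<close>, so a single element is a real character,
    that is \<open>2 * k = N\<close>. Its twist for \<open>a = N - 1\<close>, which stands for
    \<open>a = -1\<close>, is an odd power of \<open>-1\<close>.\<close>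
  have half: "Re (root_unity N (k * N - k)) = -1" if "k \<in> V" for k
  proof -
    have k: "0 < k" "k < N" using that V by auto
    have "N - k \<in> V" using that vanishing_conj unfolding V_def by simp
    then have "N - k = k" using that \<open>card V \<le> 1\<close> finV by (auto simp: card_le_Suc0_iff_eq)
    then have N2: "N = 2 * k" using k by simp
    have "root_unity N k = cis pi" using k unfolding N2 root_unity_def by simp
    then have "root_unity N k = -1" by simp
    moreover have "k * N - k = k * (N - 1)" by (simp add: diff_mult_distrib2)
    moreover have "odd (N - 1)" using N2 k by presburger
    ultimately have "root_unity N (k * N - k) = -1" by (simp add: root_unity_mult)
    then show ?thesis by simp
  qed
  show False
  proof (rule ln_bounded_contradiction)
    fix n :: nat assume n: "n > 0"
    \<comment> \<open>This twist selects the prime powers congruent to \<open>g\<close>. If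
      \<open>p ^ i\<close> has order \<open>N\<close> then so has \<open>p\<close>, so any prime
      power in this class already contradicts \<open>no\<close>.\<close>
    have "mangoldt j = (0::complex)" if "\<not> M dvd j" "N dvd (N - 1) + dlog j" for j
    proof (rule ccontr)
      assume "mangoldt j \<noteq> (0::complex)"
      then obtain p i where p: "Factorial_Ring.prime p" "i > 0" "j = p ^ i"
        by (auto simp: mangoldt_def primepow_def split: if_splits)
      have "[(N - 1) + dlog j = (N - 1) + 1] (mod N)"
        using that(2) N_pos by (simp add: cong_def mod_eq_0_iff_dvd)
      then have "[dlog j = 1] (mod N)" by (simp only: cong_add_lcancel_nat)
      then have "[j = g] (mod M)" using that(1) by (simp add: dlog_cong_iff)
      then have "ord M j = N" using ord_cong ord_g by metis
      moreover have "coprime M p"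
        using that(1) p prime_M by (intro prime_imp_coprime) (auto intro: dvd_trans dvd_power)
      ultimately have "ord M p div gcd i (ord M p) = N" using p by (simp add: ord_power)
      then have "N dvd ord M p" by (metis dvd_triv_left dvd_div_mult_self gcd_dvd2)
      moreover have "ord M p dvd N"
        using order_divides_totient[OF \<open>coprime M p\<close>] totient_M by simp
      ultimately have "ord M p = N" by (rule dvd_antisym[rotated])
      then show False using no p unfolding N_def by blast
    qed
    then have "(\<Sum>k<N. root_unity N (k * (N - 1)) * chi_mangoldt k n) = 0"
      unfolding sum_chi_mangoldt by (intro sum.neutral) auto
    moreover have "(\<Sum>k\<in>V. Re (root_unity N (k * (N - 1)))) = - real (card V)"
      using half by (simp add: diff_mult_distrib2)
    \<comment> \<open>The contribution of \<open>V\<close> has the same sign as the main term of the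
      principal character, so the sum cannot be 0 for large \<open>n\<close>.\<close>
    ultimately have "0 \<ge> ln (real n) - 1 - ln (real M) - C' + real (card V) * ln (real n)"
      using split[of "N - 1" n] bd[OF n, of "N - 1"] chi_mangoldt_0_bounds(1)[OF n] by simp
    moreover have "real (card V) * ln (real n) \<ge> 0" using n by simp
    ultimately show "1 * ln (real n) \<le> 1 + ln (real M) + C'" by simp
  qed simp
qed

section \<open>The sum over partitions\<close>

definition part_weight :: "nat \<Rightarrow> nat \<Rightarrow> nat \<Rightarrow> real" where
  "part_weight M a i = (if a dvd i then 1 / real M else 1)"

text \<open>For \<open>c = 1\<close> this is the proportion of permutations with cycle type
  \<open>\<mu>\<close>; in general every cycle of length \<open>i\<close> carries an extra factor
  \<open>c i\<close>.\<close>

definition partition_weight :: "(nat \<Rightarrow> real) \<Rightarrow> nat multiset \<Rightarrow> real" where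
  "partition_weight c \<mu> = (\<Prod>i\<in>set_mset \<mu>. (c i / real i) ^ count \<mu> i / fact (count \<mu> i))"

lemma mset_le_sum_mset: "i \<in># \<mu> \<Longrightarrow> i \<le> sum_mset (\<mu> :: nat multiset)"
  by (auto dest!: multi_member_split)

lemma sum_mset_eq_sum_count:
  "sum_mset \<mu> = (\<Sum>i\<in>set_mset \<mu>. count \<mu> i * (i :: nat))"
proof -
  \<comment> \<open>Over a fixed superset \<open>A\<close> of the parts, the index set stays the
    same when a part is added.\<close>
  have "sum_mset \<mu> = (\<Sum>i\<in>A. count \<mu> i * i)" if "finite A" "set_mset \<mu> \<subseteq> A" for A
    using that(2)
  proof (induction \<mu>)
    case (add x \<mu>)
    have "(\<Sum>i\<in>A. count (add_mset x \<mu>) i * i) = (\<Sum>i\<in>A. count \<mu> i * i + (if i = x then x else 0))"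
      by (intro sum.cong) auto
    also have "\<dots> = (\<Sum>i\<in>A. count \<mu> i * i) + x"
      using add that(1) by (simp add: sum.distrib)
    finally show ?case using add by simp
  qed simp
  then show ?thesis by simp
qed

lemma set_mset_partition: "\<mu> \<in> partitions_of n \<Longrightarrow> set_mset \<mu> \<subseteq> {1..n}"
  by (auto simp: partitions_of_def Suc_le_eq mset_le_sum_mset intro: Nat.gr0I)

lemma limit_proportion_eq:
  "limit_proportion n M a = (\<Sum>\<mu>\<in>partitions_of n. partition_weight (part_weight M a) \<mu>)"
  unfolding limit_proportion_def
proof (rule sum.cong[OF refl])
  fix \<mu> assume \<mu>: "\<mu> \<in> partitions_of n"
  have "(\<Prod>i=1..n. 1 / (fact (count \<mu> i) * real i ^ count \<mu> i)) =
      (\<Prod>i\<in>set_mset \<mu>. 1 / (fact (count \<mu> i) * real i ^ count \<mu> i))"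
    using set_mset_partition[OF \<mu>] by (intro prod.mono_neutral_right) (auto simp: not_in_iff)
  moreover have "1 / real M ^ parts_divisible_by a \<mu> = (\<Prod>i\<in>set_mset \<mu>. part_weight M a i ^ count \<mu> i)"
  proof -
    have "(\<Prod>i\<in>set_mset \<mu>. part_weight M a i ^ count \<mu> i) = (\<Prod>i\<in>#\<mu>. part_weight M a i)"
      by (simp add: image_prod_mset_multiplicity)
    also have "\<dots> = 1 / real M ^ parts_divisible_by a \<mu>"
      by (induction \<mu>) (auto simp: part_weight_def parts_divisible_by_def)
    finally show ?thesis ..
  qed
  ultimately show "1 / real M ^ parts_divisible_by a \<mu> *
      (\<Prod>i=1..n. 1 / (fact (count \<mu> i) * real i ^ count \<mu> i)) = partition_weight (part_weight M a) \<mu>"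
    by (simp add: partition_weight_def prod.distrib[symmetric] power_divide mult.commute)
qed

text \<open>Adding a part \<open>i\<close> to \<open>m\<close> copies of it multiplies the weight by
  \<open>c i / (i * (m + 1))\<close>, and the mark on the left cancels this denominator.\<close>

lemma partition_weight_add:
  assumes "i > 0"
  shows "real (count (add_mset i \<nu>) i) * real i * partition_weight c (add_mset i \<nu>) = c i * partition_weight c \<nu>"
proof -
  let ?m = "count \<nu> i" and ?A = "set_mset \<nu> - {i}"
  let ?f = "\<lambda>\<mu> j. (c j / real j) ^ count \<mu> j / fact (count \<mu> j)"
  have 1: "partition_weight c (add_mset i \<nu>) = ?f (add_mset i \<nu>) i * (\<Prod>j\<in>?A. ?f \<nu> j)"
    unfolding partition_weight_def by (subst prod.remove[of _ i]) (auto intro!: arg_cong2[where f="(*)"] prod.cong)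
  have 2: "partition_weight c \<nu> = ?f \<nu> i * (\<Prod>j\<in>?A. ?f \<nu> j)"
  proof (cases "i \<in># \<nu>")
    case True
    then show ?thesis unfolding partition_weight_def by (subst prod.remove[of _ i]) auto
  next
    case False
    then show ?thesis by (simp add: partition_weight_def not_in_iff)
  qed
  have 3: "real (Suc ?m) / fact (Suc ?m) = 1 / fact ?m" by (simp del: of_nat_Suc)
  have "real (count (add_mset i \<nu>) i) * real i * (?f (add_mset i \<nu>) i * (\<Prod>j\<in>?A. ?f \<nu> j)) =
     (real (Suc ?m) / fact (Suc ?m)) * (real i * (c i / real i)) * (c i / real i) ^ ?m * (\<Prod>j\<in>?A. ?f \<nu> j)"
    by (simp del: of_nat_Suc fact_Suc)
  also have "\<dots> = c i * (?f \<nu> i * (\<Prod>j\<in>?A. ?f \<nu> j))" unfolding 3 using assms by simp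
  finally show ?thesis unfolding 1 2 .
qed

lemma partition_weight_recursion:
  "real n * (\<Sum>\<mu>\<in>partitions_of n. partition_weight c \<mu>) =
     (\<Sum>i=1..n. c i * (\<Sum>\<nu>\<in>partitions_of (n - i). partition_weight c \<nu>))"
proof -
  let ?w = "partition_weight c"
  \<comment> \<open>Each distinct part \<open>i\<close> is marked once with weight
    \<open>count \<mu> i * i\<close>; these weights add up to \<open>n\<close>.\<close>
  have "real n * (\<Sum>\<mu>\<in>partitions_of n. ?w \<mu>) =
      (\<Sum>\<mu>\<in>partitions_of n. \<Sum>i\<in>set_mset \<mu>. real (count \<mu> i) * real i * ?w \<mu>)"
    unfolding sum_distrib_left
  proof (rule sum.cong[OF refl])
    fix \<mu> assume "\<mu> \<in> partitions_of n"
    then have "n = (\<Sum>i\<in>set_mset \<mu>. count \<mu> i * i)"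
      by (auto simp: partitions_of_def sum_mset_eq_sum_count)
    then have "real n = (\<Sum>i\<in>set_mset \<mu>. real (count \<mu> i) * real i)"
      by (metis (no_types, lifting) of_nat_mult of_nat_sum sum.cong)
    then show "real n * ?w \<mu> = (\<Sum>i\<in>set_mset \<mu>. real (count \<mu> i) * real i * ?w \<mu>)"
      by (simp add: sum_distrib_right)
  qed
  also have "\<dots> = (\<Sum>(\<mu>,i)\<in>(SIGMA \<mu>:partitions_of n. set_mset \<mu>). real (count \<mu> i) * real i * ?w \<mu>)"
    by (rule sum.Sigma) (auto simp: finite_partitions_of)
  also have "\<dots> = (\<Sum>(i,\<nu>)\<in>(SIGMA i:{1..n}. partitions_of (n - i)). c i * ?w \<nu>)"
  proof (rule sum.reindex_bij_witness[of _ "\<lambda>(i,\<nu>). (add_mset i \<nu>, i)" "\<lambda>(\<mu>,i). (i, \<mu> - {#i#})"])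
    fix x assume "x \<in> (SIGMA \<mu>:partitions_of n. set_mset \<mu>)"
    then obtain \<mu> i where x: "x = (\<mu>, i)" "\<mu> \<in> partitions_of n" "i \<in># \<mu>" by auto
    then obtain \<nu> where \<nu>: "\<mu> = add_mset i \<nu>" by (blast dest: multi_member_split)
    then show "(case case x of (\<mu>, i) \<Rightarrow> (i, \<mu> - {#i#}) of (i, \<nu>) \<Rightarrow> (add_mset i \<nu>, i)) = x"
      using x by simp
    show "(case x of (\<mu>, i) \<Rightarrow> (i, \<mu> - {#i#})) \<in> (SIGMA i:{1..n}. partitions_of (n - i))"
      using x \<nu> by (auto simp: partitions_of_def intro: Nat.gr0I)
    have "i > 0" using x \<nu> by (auto simp: partitions_of_def intro: Nat.gr0I)
    then show "(case case x of (\<mu>, i) \<Rightarrow> (i, \<mu> - {#i#}) of (i, \<nu>) \<Rightarrow> c i * ?w \<nu>) =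
       (case x of (\<mu>, i) \<Rightarrow> real (count \<mu> i) * real i * ?w \<mu>)"
      using x \<nu> partition_weight_add[of i \<nu> c] by simp
  qed (auto simp: partitions_of_def)
  also have "\<dots> = (\<Sum>i=1..n. \<Sum>\<nu>\<in>partitions_of (n - i). c i * ?w \<nu>)"
    by (rule sum.Sigma[symmetric]) (auto simp: finite_partitions_of)
  finally show ?thesis by (simp add: sum_distrib_left)
qed

lemma limit_proportion_recursion:
  "real n * limit_proportion n M a = (\<Sum>i=1..n. part_weight M a i * limit_proportion (n - i) M a)"
  unfolding limit_proportion_eq by (rule partition_weight_recursion)

lemma limit_proportion_0: "limit_proportion 0 M a = 1"
proof -
  have "partitions_of 0 = {{#}}"
    by (auto simp: partitions_of_def) (metis multiset_nonemptyE)
  then show ?thesis by (simp add: limit_proportion_def parts_divisible_by_def)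
qed

text \<open>The coefficient of \<open>x^k\<close> in the power series of \<open>1 - x\<close> to the
  exponent \<open>\<alpha> - 1\<close>, hence also the sum of the coefficients up to index
  \<open>k\<close> for the exponent \<open>\<alpha>\<close>.\<close>

definition binomial_partial :: "real \<Rightarrow> nat \<Rightarrow> real" where
  "binomial_partial \<alpha> k = (\<Prod>l=1..k. 1 - \<alpha> / real l)"

text \<open>With \<open>Q\<close> for \<open>binomial_partial \<alpha>\<close>, the sum telescopes
  because \<open>(k + 1) * Q (k + 1) = (k + 1 - \<alpha>) * Q k\<close>.\<close>

lemma sum_binomial_partial: "(1 - \<alpha>) * (\<Sum>l<k. binomial_partial \<alpha> l) = real k * binomial_partial \<alpha> k"
proof (induction k)
  case (Suc k)
  have "(1 - \<alpha>) * (\<Sum>l<Suc k. binomial_partial \<alpha> l) = (real k + 1 - \<alpha>) * binomial_partial \<alpha> k"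
    using Suc by (simp add: algebra_simps)
  also have "\<dots> = real (Suc k) * binomial_partial \<alpha> (Suc k)"
    by (simp add: binomial_partial_def field_simps)
  finally show ?case .
qed simp

lemma sum_div_blocks:
  fixes f :: "nat \<Rightarrow> real"
  assumes "r \<le> a" "a > 0"
  shows "(\<Sum>j<k * a + r. f (j div a)) = real a * (\<Sum>l<k. f l) + real r * f k"
proof -
  have block: "(\<Sum>j=m * a..<m * a + s. f (j div a)) = real s * f m" if "s \<le> a" for m s
  proof -
    have "(\<Sum>j=m * a..<m * a + s. f (j div a)) = (\<Sum>j=m * a..<m * a + s. f m)"
      using that assms by (intro sum.cong refl arg_cong[where f = f]) (auto intro!: div_nat_eqI simp: mult.commute)
    then show ?thesis by simp
  qed
  have "(\<Sum>j<k * a + r. f (j div a)) = (\<Sum>j<k * a. f (j div a)) + (\<Sum>j=k * a..<k * a + r. f (j div a))"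
    by (simp add: lessThan_atLeast0 sum.atLeastLessThan_concat)
  also have "(\<Sum>j<k * a. f (j div a)) = (\<Sum>m<k. \<Sum>j=m * a..<m * a + a. f (j div a))"
    by (rule sum.nat_group[symmetric])
  finally show ?thesis using block[of a] block[of r k] assms by (simp add: sum_distrib_left)
qed

text \<open>For \<open>i = a * m\<close> the quotient is \<open>n div a - m\<close>, so the
  multiples of \<open>a\<close> run through the quotients below \<open>n div a\<close> once
  each.\<close>

lemma sum_multiples:
  fixes f :: "nat \<Rightarrow> real"
  assumes "a > 0"
  shows "(\<Sum>i | i \<in> {1..n} \<and> a dvd i. f ((n - i) div a)) = (\<Sum>l<n div a. f l)"
proof (rule sum.reindex_bij_witness[of _ "\<lambda>l. a * (n div a - l)" "\<lambda>i. (n - i) div a"])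
  fix i assume "i \<in> {i. i \<in> {1..n} \<and> a dvd i}"
  then obtain m where m: "i = a * m" "m > 0" "a * m \<le> n" by (auto elim!: dvdE)
  have le: "m \<le> n div a" using m assms by (simp add: less_eq_div_iff_mult_less_eq mult.commute)
  then have "n - i = n mod a + a * (n div a - m)"
    using m mult_div_mod_eq[of a n] by (simp add: diff_mult_distrib2)
  then have eq: "(n - i) div a = n div a - m" using assms by simp
  from le show "a * (n div a - (n - i) div a) = i" "(n - i) div a \<in> {..<n div a}"
    using eq m by auto
next
  fix l assume l: "l \<in> {..<n div a}"
  have "a * (n div a - l) \<le> a * (n div a)" by simp
  also have "\<dots> \<le> n" by simp
  finally have le: "a * (n div a - l) \<le> n" .
  have "n - a * (n div a - l) = n mod a + a * l"
    using l mult_div_mod_eq[of a n] mult_le_mono2[of l "n div a" a]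
    unfolding diff_mult_distrib2 lessThan_iff by linarith
  then show "(n - a * (n div a - l)) div a = l" using assms by simp
  show "a * (n div a - l) \<in> {i. i \<in> {1..n} \<and> a dvd i}" using l le assms by auto
qed simp

text \<open>The right-hand side depends on \<open>n div a\<close> only, so the recursion reduces to
  sums over blocks of length \<open>a\<close>. All indices have weight 1 there, except that
  multiples of \<open>a\<close> lose \<open>1 - 1 / M\<close>, which is
  \<open>a * \<alpha>\<close>.\<close>

lemma limit_proportion_closed:
  assumes "a > 0"
  shows "limit_proportion n M a = binomial_partial ((1 - 1 / real M) / real a) (n div a)"
proof (induction n rule: less_induct)
  case (less n)
  define \<alpha> where "\<alpha> = (1 - 1 / real M) / real a"
  let ?Q = "binomial_partial \<alpha>"
  show ?case
  proof (cases "n = 0")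
    case True
    then show ?thesis by (simp add: limit_proportion_0 binomial_partial_def)
  next
    case False
    have "real n * limit_proportion n M a = (\<Sum>i=1..n. part_weight M a i * ?Q ((n - i) div a))"
      unfolding limit_proportion_recursion using less False by (intro sum.cong refl) (simp add: \<alpha>_def)
    also have "\<dots> = (\<Sum>i=1..n. ?Q ((n - i) div a)) - (1 - 1 / real M) * (\<Sum>i | i \<in> {1..n} \<and> a dvd i. ?Q ((n - i) div a))"
    proof -
      have "(\<Sum>i | i \<in> {1..n} \<and> a dvd i. ?Q ((n - i) div a)) =
         (\<Sum>i=1..n. if a dvd i then ?Q ((n - i) div a) else 0)"
        by (intro sum.mono_neutral_cong_left) auto
      note eq = this
      show ?thesis
        unfolding eq sum_distrib_left sum_subtractf[symmetric]
        by (intro sum.cong) (auto simp: part_weight_def algebra_simps)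
    qed
    also have "(\<Sum>i=1..n. ?Q ((n - i) div a)) = (\<Sum>j<n. ?Q (j div a))"
      by (rule sum.reindex_bij_witness[of _ "\<lambda>j. n - j" "\<lambda>i. n - i"]) auto
    also have "(\<Sum>j<n. ?Q (j div a)) = real a * (\<Sum>l<n div a. ?Q l) + real (n mod a) * ?Q (n div a)"
      using sum_div_blocks[of "n mod a" a ?Q "n div a"] assms by simp
    also have "(\<Sum>i | i \<in> {1..n} \<and> a dvd i. ?Q ((n - i) div a)) = (\<Sum>l<n div a. ?Q l)"
      using assms by (rule sum_multiples)
    also have "real a * (\<Sum>l<n div a. ?Q l) + real (n mod a) * ?Q (n div a) - (1 - 1 / real M) * (\<Sum>l<n div a. ?Q l)
      = real a * ((1 - \<alpha>) * (\<Sum>l<n div a. ?Q l)) + real (n mod a) * ?Q (n div a)"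
      using assms by (simp add: \<alpha>_def field_simps)
    also have "\<dots> = real (a * (n div a) + n mod a) * ?Q (n div a)"
      unfolding sum_binomial_partial of_nat_add of_nat_mult by (simp add: algebra_simps)
    also have "\<dots> = real n * ?Q (n div a)" by simp
    finally show ?thesis using False by (simp add: \<alpha>_def)
  qed
qed

lemma limit_proportion_eq_1: "a > n \<Longrightarrow> limit_proportion n M a = 1"
  by (simp add: limit_proportion_closed binomial_partial_def)

text \<open>From \<open>a\<close> to \<open>b\<close> the parameter \<open>\<alpha>\<close>
  decreases and some factors, all between 0 and 1, drop out. Strictness comes from the factor at
  \<open>l = 1\<close>, which is still present because \<open>b \<le> n\<close>.\<close>

lemma limit_proportion_strict_mono:
  assumes "0 < a" "a < b" "b \<le> n" "M \<ge> 2"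
  shows "limit_proportion n M a < limit_proportion n M b"
proof -
  define \<alpha> \<beta> where "\<alpha> = (1 - 1 / real M) / real a" and "\<beta> = (1 - 1 / real M) / real b"
  have M: "0 < 1 - 1 / real M" "1 - 1 / real M < 1" using assms by auto
  have b0: "0 < \<beta>" using M assms by (simp add: \<beta>_def)
  have ab: "\<beta> < \<alpha>" unfolding \<alpha>_def \<beta>_def using M assms by (intro divide_strict_left_mono) auto
  have "\<alpha> \<le> (1 - 1 / real M) / 1" unfolding \<alpha>_def using M assms by (intro divide_left_mono) auto
  then have a1: "\<alpha> < 1" using M(2) unfolding div_by_1 by linarith
  have pos: "0 < 1 - \<alpha> / real l" "1 - \<alpha> / real l \<le> 1" if "l \<ge> 1" for l
  proof -
    have "\<alpha> / real l \<le> \<alpha> / 1" using that b0 ab by (intro divide_left_mono) auto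
    then show "0 < 1 - \<alpha> / real l" using a1 by simp
    show "1 - \<alpha> / real l \<le> 1" using b0 ab by simp
  qed
  have le: "n div b \<le> n div a" using assms by (simp add: div_le_mono2)
  have b1: "n div b \<ge> 1" using assms by (simp add: less_eq_div_iff_mult_less_eq)
  have "binomial_partial \<alpha> (n div a) = (\<Prod>l=1..n div b. 1 - \<alpha> / real l) * (\<Prod>l=Suc (n div b)..n div a. 1 - \<alpha> / real l)"
    unfolding binomial_partial_def using le prod.ub_add_nat[of 1 "n div b" "\<lambda>l. 1 - \<alpha> / real l" "n div a - n div b"] b1 by simp
  also have "\<dots> \<le> (\<Prod>l=1..n div b. 1 - \<alpha> / real l) * 1"
    using pos by (intro mult_left_mono prod_le_1 prod_nonneg) (auto intro: less_imp_le)
  also have "\<dots> < (\<Prod>l=1..n div b. 1 - \<beta> / real l)"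
  proof -
    have "(\<Prod>l=1..n div b. 1 - \<alpha> / real l) < (\<Prod>l=1..n div b. 1 - \<beta> / real l)"
    proof (rule prod_mono_strict)
      have lt: "0 < 1 - \<alpha> / real l \<and> 1 - \<alpha> / real l < 1 - \<beta> / real l" if "l \<in> {1..n div b}" for l
      proof -
        have "\<beta> / real l < \<alpha> / real l" using ab that by (intro divide_strict_right_mono) auto
        then show ?thesis using pos(1)[of l] that by simp
      qed
      show "1 - \<alpha> / real 1 < 1 - \<beta> / real 1" using ab by simp
      fix l assume "l \<in> {1..n div b}"
      from lt[OF this] show "0 \<le> 1 - \<alpha> / real l \<and> 1 - \<alpha> / real l \<le> 1 - \<beta> / real l" "0 < 1 - \<beta> / real l"
        by auto
    qed (use b1 in auto)
    then show ?thesis by simp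
  qed
  finally show ?thesis using assms by (simp add: limit_proportion_closed \<alpha>_def \<beta>_def binomial_partial_def)
qed

text \<open>By monotonicity only \<open>a = n\<close> remains, where the product has a single
  factor.\<close>

lemma limit_proportion_less_1:
  assumes "0 < a" "a \<le> n" "M \<ge> 2"
  shows "limit_proportion n M a < 1"
proof -
  have "limit_proportion n M a \<le> limit_proportion n M n"
    using assms limit_proportion_strict_mono[of a n n M] by (cases "a = n") auto
  also have "\<dots> < 1" using assms
    by (subst limit_proportion_closed) (auto simp: binomial_partial_def)
  finally show ?thesis .
qed

section \<open>Cyclic pairs of a matrix and a vector\<close>

lemma (in cring) finsum_lessThan_delta:
  assumes "i < (n::nat)" "f i \<in> carrier R"
  shows "(\<Oplus>k\<in>{..<n}. if k = i then f k else \<zero>) = f i"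
proof -
  have "(\<Oplus>k\<in>{..<n}. if k = i then f k else \<zero>) = (\<Oplus>k\<in>{..<n}. if i = k then f i else \<zero>)"
    using assms by (intro finsum_cong') auto
  then show ?thesis using assms finsum_singleton[of i "{..<n}" "\<lambda>_. f i"] by auto
qed

locale finite_field = field R for R :: "'a ring" (structure) +
  assumes finite_carrier: "finite (carrier R)"
begin

abbreviation "q \<equiv> card (carrier R)"

end

section \<open>Square matrices acting on vectors\<close>

locale matrix_space = finite_field R for R :: "'a ring" (structure) +
  fixes n :: nat
begin

abbreviation "MM \<equiv> mat_monoid n R"

text \<open>Extensional functions, so that the set is finite and vectors are equal as soon as they
  agree below \<open>n\<close>.\<close>

definition vecs :: "(nat \<Rightarrow> 'a) set" where
  "vecs = ({..<n} \<rightarrow>\<^sub>E carrier R)"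

definition app :: "'a mat \<Rightarrow> (nat \<Rightarrow> 'a) \<Rightarrow> nat \<Rightarrow> 'a" where
  "app A v = (\<lambda>i\<in>{..<n}. \<Oplus>k\<in>{..<n}. A $$ (i, k) \<otimes> v k)"

definition unit_vec :: "nat \<Rightarrow> nat \<Rightarrow> 'a" where
  "unit_vec j = (\<lambda>i\<in>{..<n}. if i = j then \<one> else \<zero>)"

definition zero_vec :: "nat \<Rightarrow> 'a" where
  "zero_vec = (\<lambda>i\<in>{..<n}. \<zero>)"

definition of_columns :: "(nat \<Rightarrow> nat \<Rightarrow> 'a) \<Rightarrow> 'a mat" where
  "of_columns b = mat n n (\<lambda>(i, j). b j i)"

lemma q_pos: "q > 0"
  using finite_carrier zero_closed card_gt_0_iff by blast

lemma finite_vecs: "finite vecs"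
  unfolding vecs_def by (intro finite_PiE) (auto simp: finite_carrier)

lemma card_vecs: "card vecs = q ^ n"
  by (simp add: vecs_def card_PiE)

lemma vecs_closed [simp]: "v \<in> vecs \<Longrightarrow> i < n \<Longrightarrow> v i \<in> carrier R"
  by (auto simp: vecs_def)

lemma vecs_eqI: "v \<in> vecs \<Longrightarrow> w \<in> vecs \<Longrightarrow> (\<And>i. i < n \<Longrightarrow> v i = w i) \<Longrightarrow> v = w"
  unfolding vecs_def by (rule PiE_ext) auto

lemma restrict_vecs: "(\<And>i. i < n \<Longrightarrow> f i \<in> carrier R) \<Longrightarrow> (\<lambda>i\<in>{..<n}. f i) \<in> vecs"
  by (simp add: vecs_def restrict_PiE_iff)

lemma unit_vec_closed [simp]: "unit_vec j \<in> vecs"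
  by (auto simp: unit_vec_def vecs_def)

lemma zero_vec_closed [simp]: "zero_vec \<in> vecs"
  by (auto simp: zero_vec_def vecs_def)

lemma MM_iff: "A \<in> carrier MM \<longleftrightarrow> A \<in> carrier_mat n n \<and> (\<forall>i<n. \<forall>j<n. A $$ (i, j) \<in> carrier R)"
  by (auto simp: mat_monoid_def)

lemma mult_index: "i < n \<Longrightarrow> j < n \<Longrightarrow>
    (A \<otimes>\<^bsub>MM\<^esub> B) $$ (i, j) = (\<Oplus>k\<in>{..<n}. A $$ (i, k) \<otimes> B $$ (k, j))"
  by (simp add: mat_monoid_def)

lemma one_index: "i < n \<Longrightarrow> j < n \<Longrightarrow> \<one>\<^bsub>MM\<^esub> $$ (i, j) = (if i = j then \<one> else \<zero>)"
  by (simp add: mat_monoid_def)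

lemma mult_closed: "A \<in> carrier MM \<Longrightarrow> B \<in> carrier MM \<Longrightarrow> A \<otimes>\<^bsub>MM\<^esub> B \<in> carrier MM"
  by (simp add: MM_iff mult_index) (auto simp: mat_monoid_def intro!: finsum_closed)

lemma mat_one_closed: "\<one>\<^bsub>MM\<^esub> \<in> carrier MM"
  by (simp add: MM_iff one_index) (auto simp: mat_monoid_def)

lemma MM_entry [simp]: "A \<in> carrier MM \<Longrightarrow> i < n \<Longrightarrow> j < n \<Longrightarrow> A $$ (i, j) \<in> carrier R"
  by (auto simp: MM_iff)

lemma MM_dims: "A \<in> carrier MM \<Longrightarrow> dim_row A = n" "A \<in> carrier MM \<Longrightarrow> dim_col A = n"
  by (auto simp: MM_iff simp del: MM_entry)

lemma MM_eqI:
  assumes "A \<in> carrier MM" "B \<in> carrier MM" "\<And>i j. i < n \<Longrightarrow> j < n \<Longrightarrow> A $$ (i, j) = B $$ (i, j)"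
  shows "A = B"
proof (rule eq_matI)
  have dim: "dim_row A = n" "dim_col A = n" "dim_row B = n" "dim_col B = n"
    using assms(1,2) MM_dims by auto
  then show "dim_row A = dim_row B" "dim_col A = dim_col B" by simp_all
  fix i j assume "i < dim_row B" "j < dim_col B"
  then show "A $$ (i, j) = B $$ (i, j)" using dim by (intro assms(3)) simp_all
qed

lemma app_closed [simp]: "A \<in> carrier MM \<Longrightarrow> v \<in> vecs \<Longrightarrow> app A v \<in> vecs"
  by (auto simp: app_def vecs_def intro!: finsum_closed PiE_mem)

lemma of_columns_closed [simp]: "(\<And>j. j < n \<Longrightarrow> b j \<in> vecs) \<Longrightarrow> of_columns b \<in> carrier MM"
  by (simp add: MM_iff of_columns_def del: MM_entry)

lemma app_unit_vec:
  assumes "A \<in> carrier MM" "i < n" "j < n" shows "app A (unit_vec j) i = A $$ (i, j)"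
proof -
  have "app A (unit_vec j) i = (\<Oplus>k\<in>{..<n}. if k = j then A $$ (i, k) else \<zero>)"
    using assms unfolding app_def by (auto simp: unit_vec_def intro!: finsum_cong')
  also have "\<dots> = A $$ (i, j)" using assms by (intro finsum_lessThan_delta) auto
  finally show ?thesis .
qed

text \<open>With this, matrix identities can be checked on unit vectors instead of entry by entry;
  the monoid laws below are obtained in this way from composition of maps.\<close>

lemma MM_eq_app:
  assumes "A \<in> carrier MM" "B \<in> carrier MM" "\<And>j. j < n \<Longrightarrow> app A (unit_vec j) = app B (unit_vec j)"
  shows "A = B"
  using assms by (intro MM_eqI) (auto simp: app_unit_vec[symmetric])

lemma app_of_columns: "(\<And>j. j < n \<Longrightarrow> b j \<in> vecs) \<Longrightarrow> j < n \<Longrightarrow> app (of_columns b) (unit_vec j) = b j"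
  by (rule vecs_eqI) (auto simp: app_unit_vec, auto simp: of_columns_def)

lemma app_zero: "A \<in> carrier MM \<Longrightarrow> app A zero_vec = zero_vec"
  by (auto simp: app_def zero_vec_def intro!: finsum_zero' restrict_ext)

lemma app_diff:
  assumes "A \<in> carrier MM" "v \<in> vecs" "w \<in> vecs"
  shows "app A (\<lambda>i\<in>{..<n}. v i \<ominus> w i) = (\<lambda>i\<in>{..<n}. app A v i \<ominus> app A w i)"
proof (rule vecs_eqI)
  fix i assume i: "i < n"
  have "(\<Oplus>k\<in>{..<n}. A $$ (i, k) \<otimes> (v k \<ominus> w k)) \<oplus> (\<Oplus>k\<in>{..<n}. A $$ (i, k) \<otimes> w k) =
     (\<Oplus>k\<in>{..<n}. A $$ (i, k) \<otimes> (v k \<ominus> w k) \<oplus> A $$ (i, k) \<otimes> w k)"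
    using assms i by (intro finsum_addf[symmetric]) auto
  also have "\<dots> = (\<Oplus>k\<in>{..<n}. A $$ (i, k) \<otimes> v k)"
  proof (intro finsum_cong')
    fix k assume k: "k \<in> {..<n}"
    then have "A $$ (i, k) \<in> carrier R" "v k \<in> carrier R" "w k \<in> carrier R" using assms i by auto
    then show "A $$ (i, k) \<otimes> (v k \<ominus> w k) \<oplus> A $$ (i, k) \<otimes> w k = A $$ (i, k) \<otimes> v k" by algebra
  qed (use assms i in auto)
  finally have eq: "(\<Oplus>k\<in>{..<n}. A $$ (i, k) \<otimes> (v k \<ominus> w k)) \<oplus> (\<Oplus>k\<in>{..<n}. A $$ (i, k) \<otimes> w k) =
     (\<Oplus>k\<in>{..<n}. A $$ (i, k) \<otimes> v k)" .
  have c: "(\<Oplus>k\<in>{..<n}. A $$ (i, k) \<otimes> (v k \<ominus> w k)) \<in> carrier R" "(\<Oplus>k\<in>{..<n}. A $$ (i, k) \<otimes> w k) \<in> carrier R"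
    using assms i by (auto intro!: finsum_closed)
  have "a = a \<oplus> b \<ominus> b" if "a \<in> carrier R" "b \<in> carrier R" for a b
    using that by algebra
  from this[OF c] have "(\<Oplus>k\<in>{..<n}. A $$ (i, k) \<otimes> (v k \<ominus> w k)) =
     (\<Oplus>k\<in>{..<n}. A $$ (i, k) \<otimes> (v k \<ominus> w k)) \<oplus> (\<Oplus>k\<in>{..<n}. A $$ (i, k) \<otimes> w k) \<ominus> (\<Oplus>k\<in>{..<n}. A $$ (i, k) \<otimes> w k)" .
  then have eq2: "(\<Oplus>k\<in>{..<n}. A $$ (i, k) \<otimes> (v k \<ominus> w k)) =
    (\<Oplus>k\<in>{..<n}. A $$ (i, k) \<otimes> v k) \<ominus> (\<Oplus>k\<in>{..<n}. A $$ (i, k) \<otimes> w k)" unfolding eq .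
  have "(\<Oplus>k\<in>{..<n}. A $$ (i, k) \<otimes> (\<lambda>i\<in>{..<n}. v i \<ominus> w i) k) = (\<Oplus>k\<in>{..<n}. A $$ (i, k) \<otimes> (v k \<ominus> w k))"
    using assms i by (intro finsum_cong') auto
  then show "app A (\<lambda>i\<in>{..<n}. v i \<ominus> w i) i = (\<lambda>i\<in>{..<n}. app A v i \<ominus> app A w i) i"
    using i eq2 by (simp add: app_def)
qed (use assms in \<open>auto intro!: app_closed restrict_vecs\<close>)

declare mult_closed [simp] mat_one_closed [simp]

lemma app_mult:
  assumes "A \<in> carrier MM" "B \<in> carrier MM" "v \<in> vecs"
  shows "app (A \<otimes>\<^bsub>MM\<^esub> B) v = app A (app B v)"
proof (rule vecs_eqI)
  fix i assume i: "i < n"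
  have "app (A \<otimes>\<^bsub>MM\<^esub> B) v i = (\<Oplus>j\<in>{..<n}. (\<Oplus>k\<in>{..<n}. A $$ (i, k) \<otimes> B $$ (k, j)) \<otimes> v j)"
    using i assms unfolding app_def by (auto simp: mult_index intro!: finsum_cong' finsum_closed)
  also have "\<dots> = (\<Oplus>j\<in>{..<n}. \<Oplus>k\<in>{..<n}. A $$ (i, k) \<otimes> (B $$ (k, j) \<otimes> v j))"
  proof (intro finsum_cong' refl)
    fix j assume "j \<in> {..<n}"
    then show "(\<Oplus>k\<in>{..<n}. A $$ (i, k) \<otimes> B $$ (k, j)) \<otimes> v j = (\<Oplus>k\<in>{..<n}. A $$ (i, k) \<otimes> (B $$ (k, j) \<otimes> v j))"
      using i assms by (subst finsum_ldistr) (auto simp: m_assoc intro!: finsum_cong')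
  qed (use i assms in \<open>auto intro!: finsum_closed\<close>)
  also have "\<dots> = (\<Oplus>k\<in>{..<n}. \<Oplus>j\<in>{..<n}. A $$ (i, k) \<otimes> (B $$ (k, j) \<otimes> v j))"
    using i assms by (intro finsum_finsum_swap) auto
  also have "\<dots> = (\<Oplus>k\<in>{..<n}. A $$ (i, k) \<otimes> (\<Oplus>j\<in>{..<n}. B $$ (k, j) \<otimes> v j))"
    using i assms by (intro finsum_cong' refl finsum_rdistr[symmetric]) (auto intro!: finsum_closed)
  also have "\<dots> = app A (app B v) i"
    using i assms unfolding app_def by (auto intro!: finsum_cong' finsum_closed)
  finally show "app (A \<otimes>\<^bsub>MM\<^esub> B) v i = app A (app B v) i" .
qed (use assms in auto)

lemma app_one: "v \<in> vecs \<Longrightarrow> app \<one>\<^bsub>MM\<^esub> v = v"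
proof (rule vecs_eqI)
  fix i assume v: "v \<in> vecs" and i: "i < n"
  have "app \<one>\<^bsub>MM\<^esub> v i = (\<Oplus>k\<in>{..<n}. if k = i then v k else \<zero>)"
    using i v unfolding app_def by (auto simp: one_index intro!: finsum_cong')
  then show "app \<one>\<^bsub>MM\<^esub> v i = v i" using i v by (simp add: finsum_lessThan_delta)
qed auto

sublocale MM: monoid MM
  by (rule monoidI) (auto intro!: MM_eq_app simp: app_mult app_one)

lemma finite_MM: "finite (carrier MM)" and card_MM: "card (carrier MM) = q ^ (n * n)"
proof -
  let ?F = "({..<n} \<times> {..<n}) \<rightarrow>\<^sub>E carrier R"
  have "bij_betw (\<lambda>f. mat n n f) ?F (carrier MM)"
  proof (rule bij_betw_byWitness[of _ "\<lambda>A. \<lambda>x\<in>{..<n} \<times> {..<n}. A $$ x"])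
    show "\<forall>f\<in>?F. (\<lambda>x\<in>{..<n} \<times> {..<n}. mat n n f $$ x) = f"
      by (auto simp: fun_eq_iff PiE_def extensional_def restrict_def)
    show "\<forall>A\<in>carrier MM. mat n n (\<lambda>x\<in>{..<n} \<times> {..<n}. A $$ x) = A"
      by (auto simp: MM_dims intro!: eq_matI)
  qed (auto simp: MM_iff image_subset_iff restrict_PiE_iff simp del: MM_entry)
  moreover have "card ?F = q ^ (n * n)" by (simp add: card_PiE card_cartesian_product)
  moreover have "finite ?F" by (intro finite_PiE) (auto simp: finite_carrier)
  ultimately show "finite (carrier MM)" "card (carrier MM) = q ^ (n * n)"
    using bij_betw_finite bij_betw_same_card by metis+
qed

section \<open>Invertible matrices and the number of singular ones\<close>

definition trivial_kernel :: "'a mat \<Rightarrow> bool" where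
  "trivial_kernel A \<longleftrightarrow> (\<forall>v\<in>vecs. app A v = zero_vec \<longrightarrow> v = zero_vec)"

text \<open>An injective linear map of the finite set \<open>vecs\<close> into itself is onto, and
  preimages of the unit vectors are the columns of the inverse. Finiteness takes the place of rank
  and determinant.\<close>

lemma right_inverse:
  assumes A: "A \<in> carrier MM" and ker: "trivial_kernel A"
  obtains B where "B \<in> carrier MM" "A \<otimes>\<^bsub>MM\<^esub> B = \<one>\<^bsub>MM\<^esub>"
proof -
  have "inj_on (app A) vecs"
  proof (rule inj_onI)
    fix v w assume vw: "v \<in> vecs" "w \<in> vecs" "app A v = app A w"
    let ?d = "\<lambda>i\<in>{..<n}. v i \<ominus> w i"
    have "app A ?d = zero_vec"
      unfolding app_diff[OF A vw(1,2)] vw(3) zero_vec_def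
      using A vw by (intro restrict_ext) (auto simp: a_minus_def r_neg)
    moreover have "?d \<in> vecs" using vw by (intro restrict_vecs) auto
    ultimately have "?d = zero_vec" using ker by (auto simp: trivial_kernel_def)
    then have "v i \<ominus> w i = \<zero>" if "i < n" for i
      using that by (auto simp: zero_vec_def fun_eq_iff restrict_def split: if_splits)
    then show "v = w" using vw by (intro vecs_eqI) auto
  qed
  then have surj: "app A ` vecs = vecs"
    using A by (intro endo_inj_surj finite_vecs) auto
  have "\<exists>b\<in>vecs. app A b = unit_vec j" for j
    using surj unit_vec_closed[of j] by (metis imageE)
  then obtain b where b: "\<And>j. b j \<in> vecs" "\<And>j. app A (b j) = unit_vec j" by metis
  have "A \<otimes>\<^bsub>MM\<^esub> of_columns b = \<one>\<^bsub>MM\<^esub>"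
    using A b by (intro MM_eq_app) (auto simp: app_mult app_one app_of_columns)
  then show ?thesis using b(1) by (intro that[of "of_columns b"]) auto
qed

text \<open>A right inverse \<open>B\<close> of \<open>A\<close> has trivial kernel in its turn,
  hence a right inverse \<open>C\<close>; then \<open>A = A B C = C\<close>, so \<open>B\<close> is
  a two-sided inverse.\<close>

lemma Units_iff:
  assumes A: "A \<in> carrier MM"
  shows "A \<in> Units MM \<longleftrightarrow> trivial_kernel A"
proof
  assume "A \<in> Units MM"
  then obtain B where B: "B \<in> carrier MM" "B \<otimes>\<^bsub>MM\<^esub> A = \<one>\<^bsub>MM\<^esub>" by (auto simp: Units_def)
  show "trivial_kernel A" unfolding trivial_kernel_def
    using A B by (metis app_mult app_one app_zero)
next
  assume "trivial_kernel A"
  with A obtain B where B: "B \<in> carrier MM" "A \<otimes>\<^bsub>MM\<^esub> B = \<one>\<^bsub>MM\<^esub>" by (rule right_inverse)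
  have "trivial_kernel B" unfolding trivial_kernel_def
    using A B by (metis app_mult app_one app_zero)
  with B(1) obtain C where C: "C \<in> carrier MM" "B \<otimes>\<^bsub>MM\<^esub> C = \<one>\<^bsub>MM\<^esub>" by (rule right_inverse)
  have "A = C" using A B C by (metis MM.m_assoc MM.l_one MM.r_one)
  then show "A \<in> Units MM" using A B C by (auto simp: Units_def)
qed

text \<open>Since \<open>v i = \<one>\<close>, column \<open>i\<close> of a matrix that kills
  \<open>v\<close> is determined by the other \<open>n - 1\<close> columns.\<close>

lemma card_kernel_le:
  assumes v: "v \<in> vecs" and i: "i < n" "v i = \<one>"
  shows "card {A \<in> carrier MM. app A v = zero_vec} \<le> q ^ (n * (n - 1))"
proof -
  let ?K = "{A \<in> carrier MM. app A v = zero_vec}"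
  let ?I = "{..<n} \<times> ({..<n} - {i})"
  let ?F = "?I \<rightarrow>\<^sub>E carrier R"
  have "inj_on (\<lambda>A. \<lambda>x\<in>?I. A $$ x) ?K"
  proof (rule inj_onI)
    fix A B assume A: "A \<in> ?K" and B: "B \<in> ?K" and eq: "(\<lambda>x\<in>?I. A $$ x) = (\<lambda>x\<in>?I. B $$ x)"
    have off: "A $$ (r, k) = B $$ (r, k)" if "r < n" "k < n" "k \<noteq> i" for r k
      using fun_cong[OF eq, of "(r, k)"] that by simp
    have split: "C $$ (r, i) \<oplus> (\<Oplus>k\<in>{..<n} - {i}. C $$ (r, k) \<otimes> v k) = \<zero>" if C: "C \<in> ?K" and r: "r < n" for C r
    proof -
      have "\<zero> = (\<Oplus>k\<in>{..<n}. C $$ (r, k) \<otimes> v k)"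
        using C r by (auto simp: app_def zero_vec_def fun_eq_iff restrict_def split: if_splits)
      also have "{..<n} = insert i ({..<n} - {i})" using i by auto
      also have "(\<Oplus>k\<in>insert i ({..<n} - {i}). C $$ (r, k) \<otimes> v k) =
         C $$ (r, i) \<otimes> v i \<oplus> (\<Oplus>k\<in>{..<n} - {i}. C $$ (r, k) \<otimes> v k)"
        using C r i v by (intro finsum_insert) auto
      finally show ?thesis using C r i by simp
    qed
    have "A $$ (r, i) = B $$ (r, i)" if r: "r < n" for r
    proof -
      have "(\<Oplus>k\<in>{..<n} - {i}. A $$ (r, k) \<otimes> v k) = (\<Oplus>k\<in>{..<n} - {i}. B $$ (r, k) \<otimes> v k)"
        using off r A B v by (intro finsum_cong') auto
      moreover have "(\<Oplus>k\<in>{..<n} - {i}. B $$ (r, k) \<otimes> v k) \<in> carrier R"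
        using B r v by (intro finsum_closed) auto
      ultimately show ?thesis
        using split[OF A r] split[OF B r] A B r i
        by (metis (no_types, lifting) MM_entry mem_Collect_eq add.right_cancel)
    qed
    note on = this
    show "A = B"
    proof (rule MM_eqI)
      fix r k assume "r < n" "k < n"
      then show "A $$ (r, k) = B $$ (r, k)" using on off by (cases "k = i") auto
    qed (use A B in auto)
  qed
  moreover have "(\<lambda>A. \<lambda>x\<in>?I. A $$ x) ` ?K \<subseteq> ?F"
    by (auto simp: image_subset_iff restrict_PiE_iff)
  moreover have "finite ?F" by (intro finite_PiE) (auto simp: finite_carrier)
  ultimately have "card ?K \<le> card ?F" by (rule card_inj_on_le)
  also have "\<dots> = q ^ (n * (n - 1))" using i by (simp add: card_PiE card_cartesian_product)
  finally show ?thesis .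
qed

lemma card_vecs_with_one:
  assumes "i < n" shows "card {v \<in> vecs. v i = \<one>} \<le> q ^ (n - 1)"
proof -
  let ?F = "({..<n} - {i}) \<rightarrow>\<^sub>E carrier R"
  have "inj_on (\<lambda>v. restrict v ({..<n} - {i})) {v \<in> vecs. v i = \<one>}"
  proof (rule inj_onI)
    fix v w assume *: "v \<in> {v \<in> vecs. v i = \<one>}" "w \<in> {v \<in> vecs. v i = \<one>}"
      and eq: "restrict v ({..<n} - {i}) = restrict w ({..<n} - {i})"
    have "v k = w k" if "k < n" for k
      using fun_cong[OF eq, of k] that * by (cases "k = i") auto
    then show "v = w" using * by (intro vecs_eqI) auto
  qed
  moreover have "(\<lambda>v. restrict v ({..<n} - {i})) ` {v \<in> vecs. v i = \<one>} \<subseteq> ?F"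
    by (auto simp: image_subset_iff restrict_PiE_iff)
  moreover have "finite ?F" by (intro finite_PiE) (auto simp: finite_carrier)
  ultimately have "card {v \<in> vecs. v i = \<one>} \<le> card ?F" by (rule card_inj_on_le)
  also have "\<dots> = q ^ (n - 1)" using assms by (simp add: card_PiE)
  finally show ?thesis .
qed

lemma singular_normalized:
  assumes "A \<in> carrier MM" "A \<notin> Units MM"
  obtains i v where "i < n" "v \<in> vecs" "v i = \<one>" "app A v = zero_vec"
proof -
  from assms obtain w where w: "w \<in> vecs" "app A w = zero_vec" "w \<noteq> zero_vec"
    by (auto simp: Units_iff trivial_kernel_def)
  then obtain i where i: "i < n" "w i \<noteq> \<zero>"
    using vecs_eqI[OF w(1) zero_vec_closed] by (auto simp: zero_vec_def)
  then have u: "inv (w i) \<in> carrier R" "inv (w i) \<otimes> w i = \<one>"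
    using w field_Units by auto
  let ?v = "\<lambda>k\<in>{..<n}. inv (w i) \<otimes> w k"
  have v: "?v \<in> vecs" using u w by (intro restrict_vecs) auto
  have "app A ?v = zero_vec"
  proof (rule vecs_eqI)
    fix r assume r: "r < n"
    have "app A ?v r = (\<Oplus>k\<in>{..<n}. inv (w i) \<otimes> (A $$ (r, k) \<otimes> w k))"
      using r u w assms unfolding app_def by (auto simp: m_lcomm intro!: finsum_cong')
    also have "\<dots> = inv (w i) \<otimes> (\<Oplus>k\<in>{..<n}. A $$ (r, k) \<otimes> w k)"
      using r u w assms by (intro finsum_rdistr[symmetric]) auto
    also have "(\<Oplus>k\<in>{..<n}. A $$ (r, k) \<otimes> w k) = \<zero>"
      using fun_cong[OF w(2), of r] r by (simp add: app_def zero_vec_def)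
    finally have eq: "app A ?v r = inv (w i) \<otimes> \<zero>" .
    show "app A ?v r = zero_vec r" unfolding eq using u r by (simp add: zero_vec_def)
  qed (use v assms in auto)
  then show ?thesis using that[of i ?v] v i u by simp
qed

text \<open>A union bound over a position \<open>i\<close> and the kernel vectors normalized to 1
  there. The normalization leaves at most \<open>q ^ (n - 1)\<close> vectors for each
  \<open>i\<close>, and this saves a factor \<open>q\<close> against the number of all
  matrices.\<close>

lemma card_singular_le:
  "card (carrier MM - Units MM) \<le> n * q ^ (n * n - 1)"
proof (cases "n = 0")
  case True
  then have "trivial_kernel A" for A
    unfolding trivial_kernel_def using vecs_eqI[OF _ zero_vec_closed] by (metis less_nat_zero_code)
  then show ?thesis by (simp add: Units_iff subset_iff Diff_eq_empty_iff[THEN iffD2] card_eq_0_iff)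
next
  case False
  let ?S = "\<lambda>i. {v \<in> vecs. v i = \<one>}"
  let ?K = "\<lambda>v. {A \<in> carrier MM. app A v = zero_vec}"
  have sub: "carrier MM - Units MM \<subseteq> (\<Union>i\<in>{..<n}. \<Union>v\<in>?S i. ?K v)"
  proof
    fix A assume A: "A \<in> carrier MM - Units MM"
    then obtain i v where "i < n" "v \<in> vecs" "v i = \<one>" "app A v = zero_vec"
      using singular_normalized by blast
    then show "A \<in> (\<Union>i\<in>{..<n}. \<Union>v\<in>?S i. ?K v)" using A by auto
  qed
  have fin: "finite (?K v)" "finite (?S i)" for v i using finite_MM finite_vecs by auto
  have "card (carrier MM - Units MM) \<le> card (\<Union>i\<in>{..<n}. \<Union>v\<in>?S i. ?K v)"
    using sub fin by (intro card_mono) auto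
  also have "\<dots> \<le> (\<Sum>i<n. card (\<Union>v\<in>?S i. ?K v))" by (intro card_UN_le) simp
  also have "\<dots> \<le> (\<Sum>i<n. q ^ (n - 1) * q ^ (n * (n - 1)))"
  proof (intro sum_mono)
    fix i assume i: "i \<in> {..<n}"
    have "card (\<Union>v\<in>?S i. ?K v) \<le> (\<Sum>v\<in>?S i. card (?K v))" by (intro card_UN_le fin)
    also have "\<dots> \<le> of_nat (card (?S i)) * q ^ (n * (n - 1))"
      using i by (intro sum_bounded_above card_kernel_le[of _ i]) auto
    also have "\<dots> \<le> q ^ (n - 1) * q ^ (n * (n - 1))"
      using card_vecs_with_one[of i] i by (intro mult_right_mono) auto
    finally show "card (\<Union>v\<in>?S i. ?K v) \<le> q ^ (n - 1) * q ^ (n * (n - 1))" .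
  qed
  also have "\<dots> = n * q ^ (n * n - 1)"
  proof -
    have "n - 1 + n * (n - 1) = n * n - 1" using False by (cases n) auto
    then show ?thesis by (simp add: power_add[symmetric])
  qed
  finally show ?thesis .
qed

declare MM.Units_closed [simp]

section \<open>Powers and conjugation in the general linear group\<close>

lemma GL_carrier: "carrier (GL n R) = Units MM"
  by (simp add: GL_def units_of_carrier)

lemma GL_pow: "x [^]\<^bsub>GL n R\<^esub> (k::nat) = x [^]\<^bsub>MM\<^esub> k"
  by (induction k) (simp_all add: GL_def units_of_mult units_of_one nat_pow_def)

lemma GL_powers_eq: "GL_powers n R M = (\<lambda>x. x [^]\<^bsub>MM\<^esub> M) ` Units MM"
  by (simp add: GL_powers_def GL_carrier GL_pow)

lemma GL_powers_subset: "GL_powers n R M \<subseteq> Units MM"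
  by (auto simp: GL_powers_eq MM.Units_pow_closed)

lemma conj_pow:
  assumes "B \<in> Units MM" "Y \<in> carrier MM"
  shows "(B \<otimes>\<^bsub>MM\<^esub> Y \<otimes>\<^bsub>MM\<^esub> inv\<^bsub>MM\<^esub> B) [^]\<^bsub>MM\<^esub> (k::nat) = B \<otimes>\<^bsub>MM\<^esub> Y [^]\<^bsub>MM\<^esub> k \<otimes>\<^bsub>MM\<^esub> inv\<^bsub>MM\<^esub> B"
proof (induction k)
  case (Suc k)
  have c: "B \<in> carrier MM" "inv\<^bsub>MM\<^esub> B \<in> carrier MM" "Y [^]\<^bsub>MM\<^esub> k \<in> carrier MM" using assms by auto
  have "B \<otimes>\<^bsub>MM\<^esub> Y [^]\<^bsub>MM\<^esub> k \<otimes>\<^bsub>MM\<^esub> inv\<^bsub>MM\<^esub> B \<otimes>\<^bsub>MM\<^esub> (B \<otimes>\<^bsub>MM\<^esub> Y \<otimes>\<^bsub>MM\<^esub> inv\<^bsub>MM\<^esub> B) =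
     B \<otimes>\<^bsub>MM\<^esub> Y [^]\<^bsub>MM\<^esub> k \<otimes>\<^bsub>MM\<^esub> (inv\<^bsub>MM\<^esub> B \<otimes>\<^bsub>MM\<^esub> B) \<otimes>\<^bsub>MM\<^esub> Y \<otimes>\<^bsub>MM\<^esub> inv\<^bsub>MM\<^esub> B"
    using c assms by (simp add: MM.m_assoc del: MM.Units_l_inv)
  then show ?case using Suc c assms by (simp add: MM.m_assoc)
qed (use assms in auto)

lemma GL_powers_conj_iff:
  assumes B: "B \<in> Units MM" and Y: "Y \<in> carrier MM"
  shows "B \<otimes>\<^bsub>MM\<^esub> Y \<otimes>\<^bsub>MM\<^esub> inv\<^bsub>MM\<^esub> B \<in> GL_powers n R M \<longleftrightarrow> Y \<in> GL_powers n R M"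
proof -
  have fwd: "B \<otimes>\<^bsub>MM\<^esub> Y \<otimes>\<^bsub>MM\<^esub> inv\<^bsub>MM\<^esub> B \<in> GL_powers n R M"
    if "B \<in> Units MM" "Y \<in> GL_powers n R M" for B Y
  proof -
    from that obtain x where x: "x \<in> Units MM" "Y = x [^]\<^bsub>MM\<^esub> M" by (auto simp: GL_powers_eq)
    then have "B \<otimes>\<^bsub>MM\<^esub> Y \<otimes>\<^bsub>MM\<^esub> inv\<^bsub>MM\<^esub> B = (B \<otimes>\<^bsub>MM\<^esub> x \<otimes>\<^bsub>MM\<^esub> inv\<^bsub>MM\<^esub> B) [^]\<^bsub>MM\<^esub> M"
      using that by (simp add: conj_pow)
    then show ?thesis using that x by (auto simp: GL_powers_eq intro!: imageI)
  qed
  have "inv\<^bsub>MM\<^esub> B \<otimes>\<^bsub>MM\<^esub> (B \<otimes>\<^bsub>MM\<^esub> Y \<otimes>\<^bsub>MM\<^esub> inv\<^bsub>MM\<^esub> B) \<otimes>\<^bsub>MM\<^esub> inv\<^bsub>MM\<^esub> (inv\<^bsub>MM\<^esub> B) =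
     (inv\<^bsub>MM\<^esub> B \<otimes>\<^bsub>MM\<^esub> B) \<otimes>\<^bsub>MM\<^esub> Y \<otimes>\<^bsub>MM\<^esub> (inv\<^bsub>MM\<^esub> B \<otimes>\<^bsub>MM\<^esub> B)"
    using B Y by (simp add: MM.m_assoc MM.Units_inv_inv del: MM.Units_l_inv)
  also have "\<dots> = Y" using B Y by simp
  finally have "inv\<^bsub>MM\<^esub> B \<otimes>\<^bsub>MM\<^esub> (B \<otimes>\<^bsub>MM\<^esub> Y \<otimes>\<^bsub>MM\<^esub> inv\<^bsub>MM\<^esub> B) \<otimes>\<^bsub>MM\<^esub> inv\<^bsub>MM\<^esub> (inv\<^bsub>MM\<^esub> B) = Y" .
  then show ?thesis using fwd[OF B, of Y] fwd[of "inv\<^bsub>MM\<^esub> B" "B \<otimes>\<^bsub>MM\<^esub> Y \<otimes>\<^bsub>MM\<^esub> inv\<^bsub>MM\<^esub> B"] B by auto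
qed

text \<open>The companion matrix of the polynomial \<open>X^n - (\<Sum>j<n. c j * X^j)\<close>, so
  \<open>c\<close> holds the negated lower coefficients.\<close>

definition companion :: "(nat \<Rightarrow> 'a) \<Rightarrow> 'a mat" where
  "companion c = of_columns (\<lambda>j. if j = n - 1 then c else unit_vec (Suc j))"

lemma companion_closed [simp]: "c \<in> vecs \<Longrightarrow> companion c \<in> carrier MM"
  unfolding companion_def by (intro of_columns_closed) auto

lemma app_companion:
  "c \<in> vecs \<Longrightarrow> j < n \<Longrightarrow> app (companion c) (unit_vec j) = (if j = n - 1 then c else unit_vec (Suc j))"
  unfolding companion_def by (subst app_of_columns) auto

text \<open>The columns of \<open>B\<close> are \<open>v, xv, x\<^sup>2v, \<dots>\<close> when \<open>(x, v)\<close> is the image of \<open>(B, c)\<close>.\<close>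

definition cyclic_pair :: "'a mat \<times> (nat \<Rightarrow> 'a) \<Rightarrow> 'a mat \<times> (nat \<Rightarrow> 'a)" where
  "cyclic_pair = (\<lambda>(B, c). (B \<otimes>\<^bsub>MM\<^esub> companion c \<otimes>\<^bsub>MM\<^esub> inv\<^bsub>MM\<^esub> B, app B (unit_vec 0)))"

lemma cyclic_pair_app:
  assumes B: "B \<in> Units MM" and c: "c \<in> vecs" and "v \<in> vecs"
  shows "app (B \<otimes>\<^bsub>MM\<^esub> companion c \<otimes>\<^bsub>MM\<^esub> inv\<^bsub>MM\<^esub> B) (app B v) = app B (app (companion c) v)"
proof -
  have "app (B \<otimes>\<^bsub>MM\<^esub> companion c \<otimes>\<^bsub>MM\<^esub> inv\<^bsub>MM\<^esub> B) (app B v) = app (B \<otimes>\<^bsub>MM\<^esub> companion c \<otimes>\<^bsub>MM\<^esub> (inv\<^bsub>MM\<^esub> B \<otimes>\<^bsub>MM\<^esub> B)) v"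
    using assms by (simp add: app_mult MM.m_assoc del: MM.Units_l_inv)
  then show ?thesis using assms by (simp add: app_mult)
qed

lemma cyclic_pair_iterate:
  assumes B: "B \<in> Units MM" and c: "c \<in> vecs" and "i < n"
  shows "(app (B \<otimes>\<^bsub>MM\<^esub> companion c \<otimes>\<^bsub>MM\<^esub> inv\<^bsub>MM\<^esub> B) ^^ i) (app B (unit_vec 0)) = app B (unit_vec i)"
  using \<open>i < n\<close>
proof (induction i)
  case (Suc i)
  then have "i \<noteq> n - 1" by simp
  then show ?case using Suc B c by (simp add: cyclic_pair_app app_companion)
qed simp

text \<open>The columns of \<open>B\<close> are the iterates of \<open>x\<close> on
  \<open>v\<close>, hence determined by the pair. Then \<open>x\<close> applied to the last column
  is \<open>B c\<close>, which gives \<open>c\<close>.\<close>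

lemma inj_cyclic_pair: "n \<ge> 1 \<Longrightarrow> inj_on cyclic_pair (Units MM \<times> vecs)"
proof (rule inj_onI)
  fix x y assume n: "n \<ge> 1" and x: "x \<in> Units MM \<times> vecs" and y: "y \<in> Units MM \<times> vecs" and eq: "cyclic_pair x = cyclic_pair y"
  obtain B c where xB: "x = (B, c)" "B \<in> Units MM" "c \<in> vecs" using x by auto
  obtain B' c' where yB: "y = (B', c')" "B' \<in> Units MM" "c' \<in> vecs" using y by auto
  have e1: "B \<otimes>\<^bsub>MM\<^esub> companion c \<otimes>\<^bsub>MM\<^esub> inv\<^bsub>MM\<^esub> B = B' \<otimes>\<^bsub>MM\<^esub> companion c' \<otimes>\<^bsub>MM\<^esub> inv\<^bsub>MM\<^esub> B'"
    and e2: "app B (unit_vec 0) = app B' (unit_vec 0)"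
    using eq by (auto simp: cyclic_pair_def xB yB)
  have "app B (unit_vec i) = app B' (unit_vec i)" if "i < n" for i
    using cyclic_pair_iterate[OF xB(2,3) that] cyclic_pair_iterate[OF yB(2,3) that] e1 e2 by simp
  then have BB: "B = B'" using xB yB by (intro MM_eq_app) auto
  have "app B (app (companion c) (unit_vec (n - 1))) = app B (app (companion c') (unit_vec (n - 1)))"
    using cyclic_pair_app[OF xB(2,3), of "unit_vec (n - 1)"] cyclic_pair_app[OF yB(2,3), of "unit_vec (n - 1)"] e1 BB
    by simp
  then have "app B c = app B c'" using n xB yB by (simp add: app_companion)
  then have "app (inv\<^bsub>MM\<^esub> B \<otimes>\<^bsub>MM\<^esub> B) c = app (inv\<^bsub>MM\<^esub> B \<otimes>\<^bsub>MM\<^esub> B) c'"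
    using xB yB by (simp add: app_mult del: MM.Units_l_inv)
  then have "c = c'" using xB yB by (simp add: app_one)
  then show "x = y" using BB xB yB by simp
qed

definition power_companions :: "nat \<Rightarrow> (nat \<Rightarrow> 'a) set" where
  "power_companions M = {c \<in> vecs. companion c \<in> GL_powers n R M}"

text \<open>Inside the image of \<open>cyclic_pair\<close>, the pairs whose matrix is a power come
  from \<open>power_companions\<close>, because powers are stable under conjugation. The second
  bound admits in addition all pairs outside the image, of which there are
  \<open>q ^ (n * n) * q ^ n - U * q ^ n\<close>; it is arranged to avoid subtraction.\<close>

lemma card_GL_powers_bounds:
  fixes M :: nat
  assumes n: "n \<ge> 1"
  defines "U \<equiv> card (Units MM)" and "G \<equiv> card (power_companions M)"
  shows "U * G \<le> card (GL_powers n R M) * q ^ n"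
    and "card (GL_powers n R M) * q ^ n + U * q ^ n \<le> U * G + q ^ (n * n) * q ^ n"
proof -
  let ?P = "GL_powers n R M"
  have fin: "finite (Units MM)" "finite ?P"
    using finite_MM GL_powers_subset[of M] by (auto intro: finite_subset[OF _ finite_MM] finite_subset[OF MM.Units_closed[THEN subsetI]] dest: MM.Units_closed)
  have img: "cyclic_pair ` (Units MM \<times> vecs) \<inter> (?P \<times> vecs) = cyclic_pair ` (Units MM \<times> power_companions M)"
  proof -
    have "fst (cyclic_pair (B, c)) \<in> ?P \<longleftrightarrow> companion c \<in> ?P" if "B \<in> Units MM" "c \<in> vecs" for B c
      using that by (simp add: cyclic_pair_def GL_powers_conj_iff)
    moreover have "snd (cyclic_pair (B, c)) \<in> vecs" if "B \<in> Units MM" "c \<in> vecs" for B c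
      using that by (simp add: cyclic_pair_def)
    ultimately have iff: "cyclic_pair x \<in> ?P \<times> vecs \<longleftrightarrow> x \<in> Units MM \<times> power_companions M"
      if "x \<in> Units MM \<times> vecs" for x
      using that by (cases x) (auto simp: power_companions_def mem_Times_iff)
    have sub: "Units MM \<times> power_companions M \<subseteq> Units MM \<times> vecs"
      by (auto simp: power_companions_def)
    show ?thesis
    proof (intro equalityI subsetI)
      fix z assume z: "z \<in> cyclic_pair ` (Units MM \<times> vecs) \<inter> (?P \<times> vecs)"
      then obtain x where "x \<in> Units MM \<times> vecs" "z = cyclic_pair x" by (metis IntD1 imageE)
      then show "z \<in> cyclic_pair ` (Units MM \<times> power_companions M)" using iff z by simp
    next
      fix z assume "z \<in> cyclic_pair ` (Units MM \<times> power_companions M)"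
      then obtain x where x: "x \<in> Units MM \<times> power_companions M" "z = cyclic_pair x" by (rule imageE)
      then have "x \<in> Units MM \<times> vecs" using sub by (rule_tac subsetD)
      then show "z \<in> cyclic_pair ` (Units MM \<times> vecs) \<inter> (?P \<times> vecs)" using x iff by simp
    qed
  qed
  have sub: "Units MM \<times> power_companions M \<subseteq> Units MM \<times> vecs" by (auto simp: power_companions_def)
  have c1: "card (cyclic_pair ` (Units MM \<times> power_companions M)) = U * G"
    using inj_on_subset[OF inj_cyclic_pair[OF n] sub]
    by (simp add: card_image U_def G_def card_cartesian_product)
  have c2: "card (cyclic_pair ` (Units MM \<times> vecs)) = U * q ^ n"
    using inj_cyclic_pair[OF n] by (simp add: card_image U_def card_cartesian_product card_vecs)
  have c3: "card (?P \<times> vecs) = card ?P * q ^ n" by (simp add: card_cartesian_product card_vecs)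
  have c4: "card (carrier MM \<times> vecs) = q ^ (n * n) * q ^ n" by (simp add: card_cartesian_product card_vecs card_MM)
  have finPV: "finite (?P \<times> vecs)" using fin finite_vecs by simp
  show "U * G \<le> card ?P * q ^ n"
    unfolding c1[symmetric] c3[symmetric] img[symmetric] using finPV by (intro card_mono) auto
  have "card (?P \<times> vecs) + card (cyclic_pair ` (Units MM \<times> vecs)) =
     card (cyclic_pair ` (Units MM \<times> vecs) \<inter> (?P \<times> vecs)) + card (cyclic_pair ` (Units MM \<times> vecs) \<union> (?P \<times> vecs))"
    using finPV fin finite_vecs by (subst add.commute, subst card_Un_Int) auto
  also have "card (cyclic_pair ` (Units MM \<times> vecs) \<union> (?P \<times> vecs)) \<le> card (carrier MM \<times> vecs)"
  proof (intro card_mono)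
    show "cyclic_pair ` (Units MM \<times> vecs) \<union> (?P \<times> vecs) \<subseteq> carrier MM \<times> vecs"
      using GL_powers_subset[of M] by (auto simp: cyclic_pair_def)
  qed (use finite_MM finite_vecs in simp)
  finally show "card ?P * q ^ n + U * q ^ n \<le> U * G + q ^ (n * n) * q ^ n"
    unfolding img c1 c2 c3 c4 by simp
qed

text \<open>Dividing both counting bounds by \<open>U * q ^ n\<close> leaves the error
  \<open>(W - U) / U\<close>. At most \<open>n / q * W\<close> matrices are singular, and
  \<open>q \<ge> 2 * n\<close> makes \<open>U\<close> at least \<open>W / 2\<close>, whence the
  constant 2.\<close>

lemma GL_power_proportion_approx:
  assumes n: "n \<ge> 1" and q: "q \<ge> 2 * n"
  shows "\<bar>GL_power_proportion n R M - real (card (power_companions M)) / real q ^ n\<bar> \<le> 2 * real n / real q"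
proof -
  define U where "U = real (card (Units MM))"
  define W where "W = real q ^ (n * n)"
  define Q where "Q = real q ^ n"
  define G where "G = real (card (power_companions M))"
  define P where "P = real (card (GL_powers n R M))"
  have q0: "real q > 0" using q_pos by simp
  have pos: "W > 0" "Q > 0" using q0 by (simp_all add: W_def Q_def)
  have sub: "Units MM \<subseteq> carrier MM" by auto
  then have "card (carrier MM) = card (Units MM) + card (carrier MM - Units MM)"
    using finite_MM card_Diff_subset[OF finite_subset[OF sub finite_MM] sub] card_mono[OF finite_MM sub]
    by linarith
  then have "q ^ (n * n) \<le> card (Units MM) + n * q ^ (n * n - 1)"
    using card_singular_le card_MM by simp
  then have "W \<le> U + real n * real q ^ (n * n - 1)"
    unfolding W_def U_def by (simp only: of_nat_power[symmetric] of_nat_mult[symmetric] of_nat_add[symmetric] of_nat_le_iff)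
  also have "real q ^ (n * n - 1) = W / real q"
    using n q0 by (simp add: W_def power_diff)
  finally have WU: "W \<le> U + real n / real q * W" by simp
  have "real n / real q \<le> 1 / 2" using q q0 by (simp add: field_simps)
  then have "real n / real q * W \<le> 1 / 2 * W" using pos by (intro mult_right_mono) auto
  then have U: "U \<ge> W / 2" using WU by linarith
  then have Upos: "U > 0" using pos by linarith
  have eqP: "GL_power_proportion n R M = P / U"
    by (simp add: GL_power_proportion_def P_def U_def order_def GL_carrier)
  have b1: "U * G \<le> P * Q"
    using card_GL_powers_bounds(1)[OF n, of M] unfolding U_def G_def P_def Q_def
    by (simp only: of_nat_power[symmetric] of_nat_mult[symmetric] of_nat_le_iff)
  have b2: "P * Q + U * Q \<le> U * G + W * Q"
    using card_GL_powers_bounds(2)[OF n, of M] unfolding U_def G_def P_def Q_def W_def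
    by (simp only: of_nat_power[symmetric] of_nat_mult[symmetric] of_nat_add[symmetric] of_nat_le_iff)
  have "P / U - G / Q = (P * Q - U * G) / (U * Q)"
    using pos Upos by (simp add: field_simps)
  moreover have "0 \<le> (P * Q - U * G) / (U * Q)" using b1 pos Upos by simp
  moreover have "(P * Q - U * G) / (U * Q) \<le> (W - U) * Q / (U * Q)"
    using b2 pos Upos by (intro divide_right_mono) (auto simp: algebra_simps)
  moreover have "(W - U) * Q / (U * Q) = (W - U) / U" using pos by simp
  moreover have "(W - U) / U \<le> (real n / real q * W) / (W / 2)"
    using WU U pos by (intro frac_le) auto
  moreover have "(real n / real q * W) / (W / 2) = 2 * real n / real q" using pos by simp
  ultimately show ?thesis unfolding eqP G_def[symmetric] Q_def[symmetric] by linarith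
qed

section \<open>Companion matrices that are powers\<close>

lemma app_companion_index:
  assumes c: "c \<in> vecs" and v: "v \<in> vecs" and n: "n \<ge> 1"
  shows "app (companion c) v 0 = c 0 \<otimes> v (n - 1)"
    and "v (n - 1) = \<zero> \<Longrightarrow> Suc i < n \<Longrightarrow> app (companion c) v (Suc i) = v i"
proof -
  have entry: "companion c $$ (i, k) = (if k = n - 1 then c i else if i = Suc k then \<one> else \<zero>)"
    if "i < n" "k < n" for i k
    using that c by (simp add: companion_def of_columns_def unit_vec_def)
  have "app (companion c) v 0 = (\<Oplus>k\<in>{..<n}. if k = n - 1 then c 0 \<otimes> v k else \<zero>)"
    using c v n unfolding app_def by (auto simp: entry intro!: finsum_cong')
  then show "app (companion c) v 0 = c 0 \<otimes> v (n - 1)"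
    using c v n by (simp add: finsum_lessThan_delta)
  assume v0: "v (n - 1) = \<zero>" and i: "Suc i < n"
  have "app (companion c) v (Suc i) = (\<Oplus>k\<in>{..<n}. companion c $$ (Suc i, k) \<otimes> v k)"
    using i by (simp add: app_def)
  also have "\<dots> = (\<Oplus>k\<in>{..<n}. if k = i then v k else \<zero>)"
  proof (intro finsum_cong' refl)
    fix k assume k: "k \<in> {..<n}"
    then show "companion c $$ (Suc i, k) \<otimes> v k = (if k = i then v k else \<zero>)"
      using i v v0 c by (cases "k = n - 1") (auto simp: entry)
  qed (use v in auto)
  also have "\<dots> = v i" using v i by (intro finsum_lessThan_delta) auto
  finally show "app (companion c) v (Suc i) = v i" .
qed

text \<open>Up to sign, \<open>c 0\<close> is the determinant. One direction reads off coordinate 0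
  of a preimage of \<open>unit_vec 0\<close>. In the other, a kernel vector has last entry 0, and on
  such vectors the matrix shifts the remaining entries.\<close>

lemma companion_Units_iff:
  assumes c: "c \<in> vecs" and n: "n \<ge> 1"
  shows "companion c \<in> Units MM \<longleftrightarrow> c 0 \<noteq> \<zero>"
proof
  assume U: "companion c \<in> Units MM"
  let ?v = "app (inv\<^bsub>MM\<^esub> companion c) (unit_vec 0)"
  have v: "?v \<in> vecs" using U by simp
  have "app (companion c) ?v = unit_vec 0"
    using U c by (simp add: app_mult[symmetric] app_one)
  then have "c 0 \<otimes> ?v (n - 1) = \<one>"
    using app_companion_index(1)[OF c v n] n by (simp add: unit_vec_def)
  moreover have "?v (n - 1) \<in> carrier R" using v n by (intro vecs_closed) auto
  ultimately show "c 0 \<noteq> \<zero>" by auto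
next
  assume c0: "c 0 \<noteq> \<zero>"
  show "companion c \<in> Units MM"
    unfolding Units_iff[OF companion_closed[OF c]] trivial_kernel_def
  proof (intro ballI impI)
    fix v assume v: "v \<in> vecs" and ker: "app (companion c) v = zero_vec"
    have "c 0 \<otimes> v (n - 1) = \<zero>"
      using app_companion_index(1)[OF c v n] ker n by (simp add: zero_vec_def)
    moreover have "c 0 \<in> carrier R" "v (n - 1) \<in> carrier R" using c v n by (auto intro!: vecs_closed)
    ultimately have v0: "v (n - 1) = \<zero>" using c0 integral by blast
    show "v = zero_vec"
    proof (rule vecs_eqI[OF v zero_vec_closed])
      fix i assume i: "i < n"
      show "v i = zero_vec i"
      proof (cases "i = n - 1")
        case False
        then have "Suc i < n" using i by simp
        then show ?thesis
          using app_companion_index(2)[OF c v n v0, of i] ker by (simp add: zero_vec_def)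
      qed (use v0 i in \<open>simp add: zero_vec_def\<close>)
    qed
  qed
qed

text \<open>\<open>Q\<close> will be the quotient by a monic polynomial, \<open>x\<close> the class
  of \<open>X\<close>, and \<open>\<psi>\<close> the passage from coordinates to elements in the
  basis of powers of \<open>x\<close>. An \<open>M\<close>-th root \<open>Y\<close> of the companion
  matrix commutes with it and is therefore multiplication by the image \<open>g\<close> of
  \<open>unit_vec 0\<close>. Conversely, the coordinates of \<open>g\<close> times the powers of
  \<open>x\<close> are the columns of a root.\<close>

lemma companion_power_iff:
  fixes Q (structure)
  assumes n: "n \<ge> 1" and M: "M \<ge> 1" and Q: "cring Q" and \<kappa>: "\<kappa> \<in> Ring.ring_hom R Q" and x: "x \<in> carrier Q"
    and c: "c \<in> vecs"
  defines "\<psi> \<equiv> (\<lambda>v. \<Oplus>\<^bsub>Q\<^esub>j\<in>{..<n}. \<kappa> (v j) \<otimes>\<^bsub>Q\<^esub> x [^]\<^bsub>Q\<^esub> j)"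
  assumes bij: "bij_betw \<psi> vecs (carrier Q)" and xn: "\<psi> c = x [^]\<^bsub>Q\<^esub> n"
  shows "companion c \<in> GL_powers n R M \<longleftrightarrow> c 0 \<noteq> \<zero>\<^bsub>R\<^esub> \<and> (\<exists>g\<in>carrier Q. g [^]\<^bsub>Q\<^esub> M = x)"
proof -
  interpret Q: cring Q by fact
  interpret h: ring_hom_ring R Q \<kappa> by (intro ring_hom_ringI2 \<kappa> ring_axioms Q.ring_axioms)
  have \<psi>_closed: "\<psi> v \<in> carrier Q" if "v \<in> vecs" for v using bij_betwE[OF bij] that by blast
  have \<psi>_unit: "\<psi> (unit_vec j) = x [^]\<^bsub>Q\<^esub> j" if "j < n" for j
  proof -
    have "\<psi> (unit_vec j) = (\<Oplus>\<^bsub>Q\<^esub>k\<in>{..<n}. if k = j then x [^]\<^bsub>Q\<^esub> k else \<zero>\<^bsub>Q\<^esub>)"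
      using x unfolding \<psi>_def by (auto simp: unit_vec_def intro!: Q.finsum_cong')
    then show ?thesis using that x by (simp add: Q.finsum_lessThan_delta)
  qed
  \<comment> \<open>By linearity, a matrix acts as multiplication by \<open>g\<close> as soon as it
    does so on the unit vectors.\<close>
  have \<psi>_app: "\<psi> (app A v) = g \<otimes>\<^bsub>Q\<^esub> \<psi> v"
    if A: "A \<in> carrier MM" and g: "g \<in> carrier Q" and v: "v \<in> vecs"
      and col: "\<And>j. j < n \<Longrightarrow> \<psi> (app A (unit_vec j)) = g \<otimes>\<^bsub>Q\<^esub> x [^]\<^bsub>Q\<^esub> j" for A g v
  proof -
    have "\<psi> (app A v) = (\<Oplus>\<^bsub>Q\<^esub>i\<in>{..<n}. \<Oplus>\<^bsub>Q\<^esub>k\<in>{..<n}. \<kappa> (v k) \<otimes>\<^bsub>Q\<^esub> (\<kappa> (A $$ (i, k)) \<otimes>\<^bsub>Q\<^esub> x [^]\<^bsub>Q\<^esub> i))"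
      unfolding \<psi>_def
    proof (intro Q.finsum_cong' refl)
      fix i assume i: "i \<in> {..<n}"
      have "\<kappa> (app A v i) = (\<Oplus>\<^bsub>Q\<^esub>k\<in>{..<n}. \<kappa> (A $$ (i, k) \<otimes>\<^bsub>R\<^esub> v k))"
        using i A v unfolding app_def by (auto intro!: Q.finsum_cong' simp: comp_def)
      also have "\<dots> \<otimes>\<^bsub>Q\<^esub> x [^]\<^bsub>Q\<^esub> i = (\<Oplus>\<^bsub>Q\<^esub>k\<in>{..<n}. \<kappa> (A $$ (i, k) \<otimes>\<^bsub>R\<^esub> v k) \<otimes>\<^bsub>Q\<^esub> x [^]\<^bsub>Q\<^esub> i)"
        using i A v x by (intro Q.finsum_ldistr) auto
      also have "\<dots> = (\<Oplus>\<^bsub>Q\<^esub>k\<in>{..<n}. \<kappa> (v k) \<otimes>\<^bsub>Q\<^esub> (\<kappa> (A $$ (i, k)) \<otimes>\<^bsub>Q\<^esub> x [^]\<^bsub>Q\<^esub> i))"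
        using i A v x by (intro Q.finsum_cong' refl) (auto simp: Q.m_assoc Q.m_lcomm)
      finally show "\<kappa> (app A v i) \<otimes>\<^bsub>Q\<^esub> x [^]\<^bsub>Q\<^esub> i =
         (\<Oplus>\<^bsub>Q\<^esub>k\<in>{..<n}. \<kappa> (v k) \<otimes>\<^bsub>Q\<^esub> (\<kappa> (A $$ (i, k)) \<otimes>\<^bsub>Q\<^esub> x [^]\<^bsub>Q\<^esub> i))" .
    qed (use A v x in \<open>auto intro!: Q.finsum_closed\<close>)
    also have "\<dots> = (\<Oplus>\<^bsub>Q\<^esub>k\<in>{..<n}. \<Oplus>\<^bsub>Q\<^esub>i\<in>{..<n}. \<kappa> (v k) \<otimes>\<^bsub>Q\<^esub> (\<kappa> (A $$ (i, k)) \<otimes>\<^bsub>Q\<^esub> x [^]\<^bsub>Q\<^esub> i))"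
      using A v x by (intro Q.finsum_finsum_swap) auto
    also have "\<dots> = (\<Oplus>\<^bsub>Q\<^esub>k\<in>{..<n}. g \<otimes>\<^bsub>Q\<^esub> (\<kappa> (v k) \<otimes>\<^bsub>Q\<^esub> x [^]\<^bsub>Q\<^esub> k))"
    proof (intro Q.finsum_cong' refl)
      fix k assume k: "k \<in> {..<n}"
      have "(\<Oplus>\<^bsub>Q\<^esub>i\<in>{..<n}. \<kappa> (v k) \<otimes>\<^bsub>Q\<^esub> (\<kappa> (A $$ (i, k)) \<otimes>\<^bsub>Q\<^esub> x [^]\<^bsub>Q\<^esub> i)) =
         \<kappa> (v k) \<otimes>\<^bsub>Q\<^esub> (\<Oplus>\<^bsub>Q\<^esub>i\<in>{..<n}. \<kappa> (A $$ (i, k)) \<otimes>\<^bsub>Q\<^esub> x [^]\<^bsub>Q\<^esub> i)"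
        using k A v x by (intro Q.finsum_rdistr[symmetric]) auto
      also have "(\<Oplus>\<^bsub>Q\<^esub>i\<in>{..<n}. \<kappa> (A $$ (i, k)) \<otimes>\<^bsub>Q\<^esub> x [^]\<^bsub>Q\<^esub> i) = \<psi> (app A (unit_vec k))"
        unfolding \<psi>_def using k A x by (intro Q.finsum_cong' refl) (auto simp: app_unit_vec)
      finally show "(\<Oplus>\<^bsub>Q\<^esub>i\<in>{..<n}. \<kappa> (v k) \<otimes>\<^bsub>Q\<^esub> (\<kappa> (A $$ (i, k)) \<otimes>\<^bsub>Q\<^esub> x [^]\<^bsub>Q\<^esub> i)) =
         g \<otimes>\<^bsub>Q\<^esub> (\<kappa> (v k) \<otimes>\<^bsub>Q\<^esub> x [^]\<^bsub>Q\<^esub> k)"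
        using k col[of k] g v x by (simp add: Q.m_lcomm)
    qed (use v x g in auto)
    also have "\<dots> = g \<otimes>\<^bsub>Q\<^esub> \<psi> v"
      unfolding \<psi>_def using v x g by (intro Q.finsum_rdistr[symmetric]) auto
    finally show ?thesis .
  qed
  have \<psi>_pow: "\<psi> (app (Y [^]\<^bsub>MM\<^esub> (k::nat)) v) = g [^]\<^bsub>Q\<^esub> k \<otimes>\<^bsub>Q\<^esub> \<psi> v"
    if Y: "Y \<in> carrier MM" and g: "g \<in> carrier Q" and v: "v \<in> vecs"
      and col: "\<And>j. j < n \<Longrightarrow> \<psi> (app Y (unit_vec j)) = g \<otimes>\<^bsub>Q\<^esub> x [^]\<^bsub>Q\<^esub> j" for Y g v k
    using v
  proof (induction k arbitrary: v)
    case 0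
    then show ?case by (simp add: app_one \<psi>_closed)
  next
    case (Suc k)
    then have "\<psi> (app (Y [^]\<^bsub>MM\<^esub> Suc k) v) = g [^]\<^bsub>Q\<^esub> k \<otimes>\<^bsub>Q\<^esub> \<psi> (app Y v)"
      using Y by (simp add: app_mult)
    also have "\<dots> = g [^]\<^bsub>Q\<^esub> k \<otimes>\<^bsub>Q\<^esub> (g \<otimes>\<^bsub>Q\<^esub> \<psi> v)" using \<psi>_app[OF Y g Suc.prems col] by simp
    finally show ?case using g Suc.prems by (simp add: Q.m_assoc \<psi>_closed)
  qed
  have \<psi>_comp: "\<psi> (app (companion c) v) = x \<otimes>\<^bsub>Q\<^esub> \<psi> v" if "v \<in> vecs" for v
  proof (rule \<psi>_app[OF companion_closed[OF c] x that])
    fix j assume j: "j < n"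
    have "\<psi> (app (companion c) (unit_vec j)) = x [^]\<^bsub>Q\<^esub> Suc j"
    proof (cases "j = n - 1")
      case True
      then have "app (companion c) (unit_vec j) = c" "n = Suc j" using j c by (simp_all add: app_companion)
      then show ?thesis using xn by metis
    next
      case False
      then show ?thesis using j c \<psi>_unit[of "Suc j"] by (simp add: app_companion)
    qed
    then show "\<psi> (app (companion c) (unit_vec j)) = x \<otimes>\<^bsub>Q\<^esub> x [^]\<^bsub>Q\<^esub> j"
      using x by (simp add: Q.m_comm)
  qed
  show ?thesis
  proof
    assume "companion c \<in> GL_powers n R M"
    then obtain Y where Y: "Y \<in> Units MM" "companion c = Y [^]\<^bsub>MM\<^esub> M" by (auto simp: GL_powers_eq)
    then have YC: "Y \<in> carrier MM" by simp
    define g where "g = \<psi> (app Y (unit_vec 0))"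
    have g: "g \<in> carrier Q" unfolding g_def using YC by (intro \<psi>_closed) auto
    have comm: "Y \<otimes>\<^bsub>MM\<^esub> companion c = companion c \<otimes>\<^bsub>MM\<^esub> Y"
      unfolding Y(2) using YC by (metis MM.nat_pow_Suc MM.nat_pow_Suc2)
    have "\<psi> (app Y (unit_vec j)) = g \<otimes>\<^bsub>Q\<^esub> x [^]\<^bsub>Q\<^esub> j" if "j < n" for j
      using that
    proof (induction j)
      case 0
      then show ?case using g by (simp add: g_def)
    next
      case (Suc j)
      then have "j \<noteq> n - 1" by simp
      then have "app Y (unit_vec (Suc j)) = app (companion c) (app Y (unit_vec j))"
        using Suc.prems c YC comm app_companion[OF c, of j] by (metis Suc_lessD app_mult companion_closed unit_vec_closed)
      then have "\<psi> (app Y (unit_vec (Suc j))) = x \<otimes>\<^bsub>Q\<^esub> (g \<otimes>\<^bsub>Q\<^esub> x [^]\<^bsub>Q\<^esub> j)"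
        using Suc YC \<psi>_comp by simp
      then show ?case using g x by (simp add: Q.m_ac)
    qed
    from \<psi>_pow[OF YC g unit_vec_closed this, of M 0] have "x = g [^]\<^bsub>Q\<^esub> M"
      using n g x \<psi>_comp[of "unit_vec 0"] \<psi>_unit[of 0] Y(2) by simp
    moreover have "c 0 \<noteq> \<zero>\<^bsub>R\<^esub>"
      using companion_Units_iff[OF c n] Y by (simp add: MM.Units_pow_closed)
    ultimately show "c 0 \<noteq> \<zero>\<^bsub>R\<^esub> \<and> (\<exists>g\<in>carrier Q. g [^]\<^bsub>Q\<^esub> M = x)" using g by auto
  next
    assume "c 0 \<noteq> \<zero>\<^bsub>R\<^esub> \<and> (\<exists>g\<in>carrier Q. g [^]\<^bsub>Q\<^esub> M = x)"
    then obtain g where g: "g \<in> carrier Q" "g [^]\<^bsub>Q\<^esub> M = x" and c0: "c 0 \<noteq> \<zero>\<^bsub>R\<^esub>" by auto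
    have "\<exists>y\<in>vecs. \<psi> y = g \<otimes>\<^bsub>Q\<^esub> x [^]\<^bsub>Q\<^esub> (j::nat)" for j
      using bij_betw_imp_surj_on[OF bij] g x by (metis Q.m_closed Q.nat_pow_closed imageE)
    then obtain y where y: "\<And>j::nat. y j \<in> vecs" "\<And>j. \<psi> (y j) = g \<otimes>\<^bsub>Q\<^esub> x [^]\<^bsub>Q\<^esub> j" by metis
    define Y where "Y = of_columns y"
    have Y: "Y \<in> carrier MM" using y by (simp add: Y_def)
    have col: "\<And>j. j < n \<Longrightarrow> \<psi> (app Y (unit_vec j)) = g \<otimes>\<^bsub>Q\<^esub> x [^]\<^bsub>Q\<^esub> j"
      unfolding Y_def using y by (simp add: app_of_columns)
    have "Y [^]\<^bsub>MM\<^esub> M = companion c"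
    proof (rule MM_eq_app)
      fix j
      have "\<psi> (app (Y [^]\<^bsub>MM\<^esub> M) (unit_vec j)) = \<psi> (app (companion c) (unit_vec j))"
        using \<psi>_pow[OF Y g(1) unit_vec_closed col, of M j] \<psi>_comp[of "unit_vec j"] g by simp
      then show "app (Y [^]\<^bsub>MM\<^esub> M) (unit_vec j) = app (companion c) (unit_vec j)"
        using bij_betw_imp_inj_on[OF bij] Y c by (auto dest: inj_onD)
    qed (use Y c in auto)
    moreover have "Y \<in> Units MM"
    proof -
      have U: "companion c \<in> Units MM" using companion_Units_iff[OF c n] c0 by simp
      \<comment> \<open>As \<open>M \<ge> 1\<close>, the kernel of \<open>Y\<close> lies in the
        kernel of its power \<open>companion c\<close>.\<close>
      obtain m where "M = Suc m" using M by (cases M) auto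
      then have eq: "companion c = Y [^]\<^bsub>MM\<^esub> m \<otimes>\<^bsub>MM\<^esub> Y" using \<open>Y [^]\<^bsub>MM\<^esub> M = companion c\<close> by simp
      show ?thesis unfolding Units_iff[OF Y] trivial_kernel_def
      proof (intro ballI impI)
        fix v assume "v \<in> vecs" "app Y v = zero_vec"
        then have "app (companion c) v = zero_vec" unfolding eq using Y by (simp add: app_mult app_zero)
        then show "v = zero_vec"
          using U \<open>v \<in> vecs\<close> Units_iff[OF companion_closed[OF c]] unfolding trivial_kernel_def by blast
      qed
    qed
    ultimately show "companion c \<in> GL_powers n R M" unfolding GL_powers_eq by (metis imageI)
  qed
qed

end

section \<open>Polynomials over a finite field\<close>

lemma (in ring_hom_cring) hom_nat_power: "x \<in> carrier R \<Longrightarrow> h (x [^] (k::nat)) = h x [^]\<^bsub>S\<^esub> k"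
  by (induction k) simp_all

context finite_field
begin

abbreviation "P \<equiv> poly_ring R"

sublocale UP: principal_domain P
  by (rule univ_poly_is_principal[OF carrier_is_subfield])

lemma poly_set: "p \<in> carrier P \<Longrightarrow> set p \<subseteq> carrier R"
  using polynomial_incl univ_poly_carrier by blast

lemma poly_eqI:
  assumes "p \<in> carrier P" "r \<in> carrier P" "\<And>i. coeff p i = coeff r i"
  shows "p = r"
  using assms coeff_iff_polynomial_cond[of "carrier R" p r] univ_poly_carrier by blast

lemma coeff_closed [simp]: "p \<in> carrier P \<Longrightarrow> coeff p i \<in> carrier R"
  using poly_set by simp

lemma coeff_add:
  "p \<in> carrier P \<Longrightarrow> r \<in> carrier P \<Longrightarrow> coeff (p \<oplus>\<^bsub>P\<^esub> r) i = coeff p i \<oplus> coeff r i"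
  by (simp add: univ_poly_add poly_add_coeff poly_set del: poly_add.simps)

lemma coeff_finsum:
  fixes n :: nat
  assumes "\<And>j. j < n \<Longrightarrow> t j \<in> carrier P"
  shows "coeff (\<Oplus>\<^bsub>P\<^esub>j\<in>{..<n}. t j) i = (\<Oplus>j\<in>{..<n}. coeff (t j) i)"
  using assms
proof (induction n)
  case 0
  then show ?case by (simp add: univ_poly_zero)
next
  case (Suc n)
  have "(\<Oplus>\<^bsub>P\<^esub>j\<in>{..<Suc n}. t j) = t n \<oplus>\<^bsub>P\<^esub> (\<Oplus>\<^bsub>P\<^esub>j\<in>{..<n}. t j)"
    unfolding lessThan_Suc using Suc by (intro UP.finsum_insert) auto
  moreover have "(\<Oplus>j\<in>{..<Suc n}. coeff (t j) i) = coeff (t n) i \<oplus> (\<Oplus>j\<in>{..<n}. coeff (t j) i)"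
    unfolding lessThan_Suc using Suc by (intro finsum_insert) auto
  ultimately show ?case using Suc by (simp add: coeff_add UP.finsum_closed)
qed

lemma X_closed [simp]: "X \<in> carrier P"
  by (rule var_closed(1)[OF carrier_is_subring])

lemma const_closed [simp]: "a \<in> carrier R \<Longrightarrow> poly_of_const a \<in> carrier P"
  using ring_hom_memE(1)[OF canonical_embedding_is_hom[OF carrier_is_subring]] by simp

lemma coeff_const_X_pow:
  assumes "a \<in> carrier R"
  shows "coeff (poly_of_const a \<otimes>\<^bsub>P\<^esub> X [^]\<^bsub>P\<^esub> (j::nat)) i = (if i = j then a else \<zero>)"
proof (cases "a = \<zero>")
  case True
  then have "poly_of_const a = \<zero>\<^bsub>P\<^esub>" by (simp add: poly_of_const_def univ_poly_zero)
  then have "poly_of_const a \<otimes>\<^bsub>P\<^esub> X [^]\<^bsub>P\<^esub> j = \<zero>\<^bsub>P\<^esub>" by simp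
  then show ?thesis using True by (simp add: univ_poly_zero)
next
  case False
  then have "poly_of_const a \<otimes>\<^bsub>P\<^esub> X [^]\<^bsub>P\<^esub> j = monom a j"
    using assms monom_eq_var_pow[OF carrier_is_subring, of a j] by (simp add: poly_of_const_def)
  then show ?thesis by (simp add: monom_coeff)
qed

text \<open>Built from ring operations instead of as a list: a list in \<open>carrier P\<close> must
  not start with zero, and homomorphisms pass through a sum.\<close>

definition of_coeffs :: "nat \<Rightarrow> (nat \<Rightarrow> 'a) \<Rightarrow> 'a list" where
  "of_coeffs n v = (\<Oplus>\<^bsub>P\<^esub>j\<in>{..<n}. poly_of_const (v j) \<otimes>\<^bsub>P\<^esub> X [^]\<^bsub>P\<^esub> j)"

lemma of_coeffs_closed [simp]: "(\<And>j. j < n \<Longrightarrow> v j \<in> carrier R) \<Longrightarrow> of_coeffs n v \<in> carrier P"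
  unfolding of_coeffs_def by (intro UP.finsum_closed) auto

lemma coeff_of_coeffs:
  assumes "\<And>j. j < n \<Longrightarrow> v j \<in> carrier R"
  shows "coeff (of_coeffs n v) i = (if i < n then v i else \<zero>)"
proof -
  have "coeff (of_coeffs n v) i = (\<Oplus>j\<in>{..<n}. coeff (poly_of_const (v j) \<otimes>\<^bsub>P\<^esub> X [^]\<^bsub>P\<^esub> j) i)"
    unfolding of_coeffs_def using assms by (intro coeff_finsum) auto
  also have "\<dots> = (\<Oplus>j\<in>{..<n}. if i = j then v j else \<zero>)"
    using assms by (intro finsum_cong') (auto simp: coeff_const_X_pow)
  also have "\<dots> = (if i < n then v i else \<zero>)"
  proof (cases "i < n")
    case True
    then show ?thesis using assms finsum_singleton[of i "{..<n}" v] by auto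
  next
    case False
    then have "(\<Oplus>j\<in>{..<n}. if i = j then v j else \<zero>) = (\<Oplus>j\<in>{..<n}. \<zero>)"
      by (intro finsum_cong') auto
    then show ?thesis using False by simp
  qed
  finally show ?thesis .
qed

lemma of_coeffs_coeff:
  assumes "p \<in> carrier P" "length p \<le> n" shows "of_coeffs n (coeff p) = p"
  using assms by (intro poly_eqI) (auto simp: coeff_of_coeffs coeff_length)

lemma length_le_iff_coeff:
  assumes "p \<in> carrier P" shows "length p \<le> n \<longleftrightarrow> (\<forall>i\<ge>n. coeff p i = \<zero>)"
proof
  assume "\<forall>i\<ge>n. coeff p i = \<zero>"
  show "length p \<le> n"
  proof (rule ccontr)
    assume "\<not> length p \<le> n"
    then have "p \<noteq> []" "degree p \<ge> n" by auto
    then have "coeff p (degree p) = lead_coeff p" by (intro lead_coeff_simp)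
    moreover have "lead_coeff p \<noteq> \<zero>"
      using assms \<open>p \<noteq> []\<close> unfolding univ_poly_carrier[symmetric] polynomial_def by auto
    ultimately show False using \<open>\<forall>i\<ge>n. _\<close> \<open>degree p \<ge> n\<close> by simp
  qed
qed (auto simp: coeff_length)

lemma card_poly_length_le: "card {r \<in> carrier P. length r \<le> n} = q ^ n"
  and finite_poly_length_le: "finite {r \<in> carrier P. length r \<le> n}"
proof -
  have bij: "bij_betw (of_coeffs n) ({..<n} \<rightarrow>\<^sub>E carrier R) {r \<in> carrier P. length r \<le> n}"
  proof (rule bij_betw_byWitness[of _ "\<lambda>r. \<lambda>i\<in>{..<n}. coeff r i"])
    show "\<forall>v\<in>{..<n} \<rightarrow>\<^sub>E carrier R. (\<lambda>i\<in>{..<n}. coeff (of_coeffs n v) i) = v"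
    proof
      fix v assume v: "v \<in> {..<n} \<rightarrow>\<^sub>E carrier R"
      then have "\<And>j. j < n \<Longrightarrow> v j \<in> carrier R" by auto
      then show "(\<lambda>i\<in>{..<n}. coeff (of_coeffs n v) i) = v"
        using v by (intro PiE_ext[of _ "{..<n}" "\<lambda>_. carrier R"]) (auto simp: coeff_of_coeffs restrict_PiE_iff)
    qed
    show "\<forall>r\<in>{r \<in> carrier P. length r \<le> n}. of_coeffs n (\<lambda>i\<in>{..<n}. coeff r i) = r"
    proof
      fix r assume r: "r \<in> {r \<in> carrier P. length r \<le> n}"
      have "of_coeffs n (\<lambda>i\<in>{..<n}. coeff r i) = of_coeffs n (coeff r)"
        unfolding of_coeffs_def using r by (intro UP.finsum_cong') auto
      then show "of_coeffs n (\<lambda>i\<in>{..<n}. coeff r i) = r" using r of_coeffs_coeff by simp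
    qed
    show "of_coeffs n ` ({..<n} \<rightarrow>\<^sub>E carrier R) \<subseteq> {r \<in> carrier P. length r \<le> n}"
    proof (rule image_subsetI)
      fix v assume "v \<in> {..<n} \<rightarrow>\<^sub>E carrier R"
      then have v: "\<And>j. j < n \<Longrightarrow> v j \<in> carrier R" by auto
      then show "of_coeffs n v \<in> {r \<in> carrier P. length r \<le> n}"
        by (simp add: length_le_iff_coeff coeff_of_coeffs)
    qed
    show "(\<lambda>r. \<lambda>i\<in>{..<n}. coeff r i) ` {r \<in> carrier P. length r \<le> n} \<subseteq> {..<n} \<rightarrow>\<^sub>E carrier R"
      by (auto simp: image_subset_iff restrict_PiE_iff)
  qed
  show "card {r \<in> carrier P. length r \<le> n} = q ^ n"
    using bij_betw_same_card[OF bij] by (simp add: card_PiE)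
  show "finite {r \<in> carrier P. length r \<le> n}"
    using bij_betw_finite[OF bij] finite_carrier by (simp add: finite_PiE)
qed

definition monics :: "nat \<Rightarrow> 'a list set" where
  "monics n = {f \<in> carrier P. length f = Suc n \<and> lead_coeff f = \<one>}"

lemma monics_closed: "f \<in> monics n \<Longrightarrow> f \<in> carrier P"
  by (simp add: monics_def)

lemma monics_degree: "f \<in> monics n \<Longrightarrow> length f = Suc n"
  by (simp add: monics_def)

lemma monics_not_Nil: "f \<in> monics n \<Longrightarrow> f \<noteq> []"
  by (auto simp: monics_def)

lemma monics_eq: "monics n = (#) \<one> ` {xs. set xs \<subseteq> carrier R \<and> length xs = n}"
  unfolding monics_def
  by (auto simp: univ_poly_carrier[symmetric] polynomial_def length_Suc_conv)

lemma card_monics: "card (monics n) = q ^ n" and finite_monics: "finite (monics n)"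
  using card_lists_length_eq[OF finite_carrier, of n] finite_lists_length_eq[OF finite_carrier, of n]
  unfolding monics_eq by (simp_all add: card_image)

lemma monics_coeff: "f \<in> monics n \<Longrightarrow> coeff f n = \<one>"
  using lead_coeff_simp[of f] monics_not_Nil[of f n] by (auto simp: monics_def)

declare monics_closed [simp]

section \<open>The quotient ring of a polynomial\<close>

lemma rupture_eq_iff:
  assumes "f \<in> carrier P" "a \<in> carrier P" "b \<in> carrier P"
  shows "rupture_surj (carrier R) f a = rupture_surj (carrier R) f b \<longleftrightarrow> f pdivides (a \<ominus>\<^bsub>P\<^esub> b)"
proof -
  note sf = carrier_is_subfield
  have "rupture_surj (carrier R) f a = rupture_surj (carrier R) f b \<longleftrightarrow> a pmod f = b pmod f"
    using rupture_surj_composed_with_pmod[OF sf assms(1)] rupture_surj_inj_on[OF sf assms(1)] assms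
    by (metis (no_types, lifting) imageI inj_onD)
  then show ?thesis using same_pmod_iff_pdivides[OF sf assms(2,3,1)] by simp
qed

lemma rupture_hom:
  assumes "f \<in> carrier P"
  shows "ring_hom_cring P (Rupt (carrier R) f) (rupture_surj (carrier R) f)"
    and "cring (Rupt (carrier R) f)"
proof -
  have h: "ring_hom_ring P (Rupt (carrier R) f) (rupture_surj (carrier R) f)"
    using rupture_surj_hom(2)[OF carrier_is_subring assms] .
  show "cring (Rupt (carrier R) f)"
    unfolding rupture_def using UP.cgenideal_ideal[OF assms] UP.is_cring by (rule ideal.quotient_is_cring)
  with h show "ring_hom_cring P (Rupt (carrier R) f) (rupture_surj (carrier R) f)"
    unfolding ring_hom_ring_def ring_hom_cring_def ring_hom_cring_axioms_def ring_hom_ring_axioms_def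
    using UP.is_cring by simp
qed

lemma rupture_surj: "f \<in> carrier P \<Longrightarrow> y \<in> carrier (Rupt (carrier R) f) \<Longrightarrow>
    \<exists>a\<in>carrier P. y = rupture_surj (carrier R) f a"
  using rupture_carrier_as_pmod_image[OF carrier_is_subfield, of f]
    long_division_closed(2)[OF carrier_is_subfield _ , of _ f] by blast

lemma card_rupture:
  assumes "f \<in> carrier P" "length f = Suc n"
  shows "card (carrier (Rupt (carrier R) f)) = q ^ n" "finite (carrier (Rupt (carrier R) f))"
proof -
  note sf = carrier_is_subfield
  have ne: "f \<noteq> []" using assms by auto
  have im: "carrier (Rupt (carrier R) f) = rupture_surj (carrier R) f ` {r \<in> carrier P. length r \<le> n}"
    using rupture_carrier_as_pmod_image[OF sf assms(1)] pmod_image_characterization[OF sf assms(1) ne] assms(2)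
    by simp
  have inj: "inj_on (rupture_surj (carrier R) f) {r \<in> carrier P. length r \<le> n}"
    using rupture_surj_inj_on[OF sf assms(1)] pmod_image_characterization[OF sf assms(1) ne] assms(2)
    by simp
  show "card (carrier (Rupt (carrier R) f)) = q ^ n" "finite (carrier (Rupt (carrier R) f))"
    unfolding im using inj by (simp_all add: card_image card_poly_length_le finite_poly_length_le)
qed

definition power_poly :: "nat \<Rightarrow> 'a list \<Rightarrow> bool" where
  "power_poly M f \<longleftrightarrow> coeff f 0 \<noteq> \<zero> \<and> (\<exists>g\<in>carrier P. f pdivides (g [^]\<^bsub>P\<^esub> M \<ominus>\<^bsub>P\<^esub> X))"

lemma power_poly_rupture:
  assumes f: "f \<in> carrier P"
  shows "(\<exists>g\<in>carrier P. f pdivides (g [^]\<^bsub>P\<^esub> M \<ominus>\<^bsub>P\<^esub> X)) \<longleftrightarrow>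
    (\<exists>g\<in>carrier (Rupt (carrier R) f). g [^]\<^bsub>Rupt (carrier R) f\<^esub> (M::nat) = rupture_surj (carrier R) f X)"
proof -
  interpret h: ring_hom_cring P "Rupt (carrier R) f" "rupture_surj (carrier R) f" by (rule rupture_hom[OF f])
  have "f pdivides (g [^]\<^bsub>P\<^esub> M \<ominus>\<^bsub>P\<^esub> X) \<longleftrightarrow>
     (rupture_surj (carrier R) f g) [^]\<^bsub>Rupt (carrier R) f\<^esub> M = rupture_surj (carrier R) f X"
    if "g \<in> carrier P" for g
    using rupture_eq_iff[OF f, of "g [^]\<^bsub>P\<^esub> M" X] that h.hom_nat_power[of g M] by simp
  then show ?thesis using rupture_surj[OF f] h.hom_closed by metis
qed

end

context matrix_space
begin

text \<open>Modulo \<open>f\<close>, the power \<open>X^n\<close> is minus the lower part of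
  \<open>f\<close>, and this is the last column. The map \<open>\<psi>\<close> is onto by division
  with remainder, hence bijective because both sides have \<open>q ^ n\<close> elements.\<close>

lemma companion_power_poly:
  assumes n: "n \<ge> 1" and M: "M \<ge> 1" and f: "f \<in> monics n"
  shows "companion (\<lambda>i\<in>{..<n}. \<ominus> coeff f i) \<in> GL_powers n R M \<longleftrightarrow> power_poly M f"
proof -
  let ?Q = "Rupt (carrier R) f" and ?\<pi> = "rupture_surj (carrier R) f"
  let ?c = "\<lambda>i\<in>{..<n}. \<ominus> coeff f i"
  have fP: "f \<in> carrier P" using f by simp
  interpret h: ring_hom_cring P ?Q ?\<pi> by (rule rupture_hom[OF fP])
  have const_hom: "poly_of_const \<in> Ring.ring_hom R P"
    using canonical_embedding_is_hom[OF carrier_is_subring] by simp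
  have hom: "?\<pi> \<circ> poly_of_const \<in> Ring.ring_hom R ?Q"
    using ring_hom_trans[OF const_hom h.homh] .
  interpret C: ring_hom_ring R P poly_of_const
    by (intro ring_hom_ringI2 const_hom ring_axioms UP.ring_axioms)
  define \<psi> where "\<psi> = (\<lambda>v. \<Oplus>\<^bsub>?Q\<^esub>j\<in>{..<n}. (?\<pi> \<circ> poly_of_const) (v j) \<otimes>\<^bsub>?Q\<^esub> ?\<pi> X [^]\<^bsub>?Q\<^esub> j)"
  have \<psi>: "\<psi> v = ?\<pi> (of_coeffs n v)" if "\<And>j. j < n \<Longrightarrow> v j \<in> carrier R" for v
  proof -
    have "?\<pi> (of_coeffs n v) = (\<Oplus>\<^bsub>?Q\<^esub>j\<in>{..<n}. (?\<pi> \<circ> (\<lambda>j. poly_of_const (v j) \<otimes>\<^bsub>P\<^esub> X [^]\<^bsub>P\<^esub> j)) j)"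
      unfolding of_coeffs_def using that by (subst h.hom_finsum) (auto simp: comp_def)
    also have "\<dots> = \<psi> v" unfolding \<psi>_def
      using that by (intro h.S.finsum_cong' refl) auto
    finally show ?thesis ..
  qed
  have surj: "\<psi> ` vecs = carrier ?Q"
  proof (intro equalityI subsetI)
    fix y assume "y \<in> \<psi> ` vecs"
    then show "y \<in> carrier ?Q" using \<psi> by auto
  next
    fix y assume "y \<in> carrier ?Q"
    then obtain a where a: "a \<in> carrier P" "y = ?\<pi> a" using rupture_surj[OF fP] by blast
    let ?r = "a pmod f"
    have r: "?r \<in> carrier P" "length ?r \<le> n"
      using long_division_closed(2)[OF carrier_is_subfield a(1) fP]
        pmod_degree[OF carrier_is_subfield a(1) fP monics_not_Nil[OF f]] monics_degree[OF f] by auto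
    have "y = ?\<pi> ?r" using a rupture_surj_composed_with_pmod[OF carrier_is_subfield fP] by simp
    also have "?r = of_coeffs n (\<lambda>i\<in>{..<n}. coeff ?r i)"
      using r by (intro poly_eqI) (auto simp: coeff_of_coeffs coeff_length)
    finally have "y = \<psi> (\<lambda>i\<in>{..<n}. coeff ?r i)" using r by (subst \<psi>) auto
    moreover have "(\<lambda>i\<in>{..<n}. coeff ?r i) \<in> vecs" using r by (intro restrict_vecs) auto
    ultimately show "y \<in> \<psi> ` vecs" by blast
  qed
  have bij: "bij_betw \<psi> vecs (carrier ?Q)"
    unfolding bij_betw_def using surj card_rupture[OF fP monics_degree[OF f]] finite_vecs card_vecs
    by (auto intro: eq_card_imp_inj_on)
  have c: "?c \<in> vecs" using f by (intro restrict_vecs) auto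
  have "f \<oplus>\<^bsub>P\<^esub> of_coeffs n ?c = X [^]\<^bsub>P\<^esub> n"
  proof (rule poly_eqI)
    fix i
    have "X [^]\<^bsub>P\<^esub> n = poly_of_const \<one> \<otimes>\<^bsub>P\<^esub> X [^]\<^bsub>P\<^esub> n"
      by simp
    then have "coeff (X [^]\<^bsub>P\<^esub> n) i = (if i = n then \<one> else \<zero>)"
      using coeff_const_X_pow[OF one_closed] by simp
    moreover have "coeff f i = \<zero>" if "i > n" using that monics_degree[OF f] by (intro coeff_length) simp
    ultimately show "coeff (f \<oplus>\<^bsub>P\<^esub> of_coeffs n ?c) i = coeff (X [^]\<^bsub>P\<^esub> n) i"
      using f monics_coeff[OF f] by (cases i n rule: linorder_cases) (auto simp: coeff_add coeff_of_coeffs r_neg)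
  qed (use f in auto)
  then have "?\<pi> f \<oplus>\<^bsub>?Q\<^esub> \<psi> ?c = ?\<pi> X [^]\<^bsub>?Q\<^esub> n"
    using f h.hom_add[OF fP, of "of_coeffs n ?c"] h.hom_nat_power[OF X_closed, of n] by (subst \<psi>) auto
  moreover have "?\<pi> f = \<zero>\<^bsub>?Q\<^esub>"
  proof -
    have "f pdivides (f \<ominus>\<^bsub>P\<^esub> \<zero>\<^bsub>P\<^esub>)" using fP by (simp add: pdivides_def UP.minus_eq)
    then show ?thesis using rupture_eq_iff[OF fP fP UP.zero_closed] h.hom_zero by simp
  qed
  moreover have "\<psi> ?c \<in> carrier ?Q" using surj c by blast
  ultimately have xn: "\<psi> ?c = ?\<pi> X [^]\<^bsub>?Q\<^esub> n" by simp
  have "companion ?c \<in> GL_powers n R M \<longleftrightarrow> ?c 0 \<noteq> \<zero> \<and> (\<exists>g\<in>carrier ?Q. g [^]\<^bsub>?Q\<^esub> M = ?\<pi> X)"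
    using bij xn unfolding \<psi>_def
    by (intro companion_power_iff[OF n M rupture_hom(2)[OF fP] hom h.hom_closed[OF X_closed] c])
  moreover have "?c 0 \<noteq> \<zero> \<longleftrightarrow> coeff f 0 \<noteq> \<zero>"
    using n f by simp
  ultimately show ?thesis using power_poly_rupture[OF fP, of M] by (simp add: power_poly_def)
qed

lemma card_power_companions:
  assumes n: "n \<ge> 1" and M: "M \<ge> 1"
  shows "card (power_companions M) = card {f \<in> monics n. power_poly M f}"
proof -
  let ?c = "\<lambda>f. \<lambda>i\<in>{..<n}. \<ominus> coeff f i"
  have inj: "inj_on ?c (monics n)"
  proof (rule inj_onI)
    fix f g assume fg: "f \<in> monics n" "g \<in> monics n" and eq: "?c f = ?c g"
    show "f = g"
    proof (rule poly_eqI)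
      fix i
      show "coeff f i = coeff g i"
      proof (cases i n rule: linorder_cases)
        case less
        then have "\<ominus> coeff f i = \<ominus> coeff g i" using fun_cong[OF eq, of i] by simp
        then show ?thesis using fg by (metis minus_minus coeff_closed monics_closed)
      next
        case equal
        then show ?thesis using fg monics_coeff by metis
      next
        case greater
        then show ?thesis using fg monics_degree by (metis Suc_leI coeff_length)
      qed
    qed (use fg in auto)
  qed
  have sub: "?c ` monics n \<subseteq> vecs" by (auto intro!: restrict_vecs)
  have im: "?c ` monics n = vecs"
    using sub by (intro card_subset_eq finite_vecs) (simp_all add: card_image[OF inj] card_monics card_vecs)
  have "power_companions M = {c \<in> ?c ` monics n. companion c \<in> GL_powers n R M}"
    unfolding power_companions_def im ..
  also have "\<dots> = ?c ` {f \<in> monics n. companion (?c f) \<in> GL_powers n R M}" by blast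
  also have "{f \<in> monics n. companion (?c f) \<in> GL_powers n R M} = {f \<in> monics n. power_poly M f}"
    using companion_power_poly[OF n M] by blast
  finally have "power_companions M = ?c ` {f \<in> monics n. power_poly M f}" .
  moreover have "inj_on ?c {f \<in> monics n. power_poly M f}"
    using inj by (rule inj_on_subset) auto
  ultimately show ?thesis by (simp only: card_image)
qed

end

section \<open>Irreducible factors and squarefree polynomials\<close>

context finite_field
begin

lemma pdivides_refl: "f \<in> carrier P \<Longrightarrow> f pdivides f"
  by (simp add: pdivides_def)

lemma pdividesI: "c \<in> carrier P \<Longrightarrow> f = p \<otimes>\<^bsub>P\<^esub> c \<Longrightarrow> p pdivides f"
  unfolding pdivides_def by (rule dividesI)

lemma pdividesE:
  assumes "p pdivides f" obtains c where "c \<in> carrier P" "f = p \<otimes>\<^bsub>P\<^esub> c"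
  using assms unfolding pdivides_def by (rule dividesE)

lemma pdivides_trans: "p pdivides f \<Longrightarrow> f pdivides g \<Longrightarrow> p \<in> carrier P \<Longrightarrow> p pdivides g"
  unfolding pdivides_def using UP.divides_trans by blast

lemma length_mult:
  assumes "f \<in> carrier P" "g \<in> carrier P" "f \<noteq> []" "g \<noteq> []"
  shows "f \<otimes>\<^bsub>P\<^esub> g \<noteq> []" "length (f \<otimes>\<^bsub>P\<^esub> g) + 1 = length f + length g"
    "lead_coeff (f \<otimes>\<^bsub>P\<^esub> g) = lead_coeff f \<otimes> lead_coeff g"
proof -
  have pf: "polynomial (carrier R) f" "polynomial (carrier R) g" using assms univ_poly_carrier by blast+
  have ne: "f \<otimes>\<^bsub>P\<^esub> g \<noteq> []"
    using UP.integral[OF _ assms(1,2)] assms(3,4) by (auto simp: univ_poly_zero)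
  then show "f \<otimes>\<^bsub>P\<^esub> g \<noteq> []" .
  have "length (f \<otimes>\<^bsub>P\<^esub> g) - 1 = (length f - 1) + (length g - 1)"
    using poly_mult_degree_eq[OF carrier_is_subring pf] assms by (simp add: univ_poly_mult)
  moreover have "length f \<ge> 1" "length g \<ge> 1" "length (f \<otimes>\<^bsub>P\<^esub> g) \<ge> 1"
    using assms ne by (simp_all add: Suc_leI)
  ultimately show "length (f \<otimes>\<^bsub>P\<^esub> g) + 1 = length f + length g" by linarith
  show "lead_coeff (f \<otimes>\<^bsub>P\<^esub> g) = lead_coeff f \<otimes> lead_coeff g"
    using poly_mult_lead_coeff[OF carrier_is_subring pf assms(3,4)] by (simp add: univ_poly_mult)
qed

lemma monicsI: "f \<in> carrier P \<Longrightarrow> length f = Suc n \<Longrightarrow> lead_coeff f = \<one> \<Longrightarrow> f \<in> monics n"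
  unfolding monics_def by blast

lemma monics_lead: "f \<in> monics n \<Longrightarrow> lead_coeff f = \<one>"
  unfolding monics_def by blast

lemma monics_mult:
  assumes "f \<in> monics m" "g \<in> monics k" shows "f \<otimes>\<^bsub>P\<^esub> g \<in> monics (m + k)"
proof (rule monicsI)
  note fg = monics_closed[OF assms(1)] monics_closed[OF assms(2)] monics_not_Nil[OF assms(1)] monics_not_Nil[OF assms(2)]
  show "f \<otimes>\<^bsub>P\<^esub> g \<in> carrier P" using fg by (intro UP.m_closed)
  show "length (f \<otimes>\<^bsub>P\<^esub> g) = Suc (m + k)"
    using length_mult(2)[OF fg] monics_degree[OF assms(1)] monics_degree[OF assms(2)] by simp
  show "lead_coeff (f \<otimes>\<^bsub>P\<^esub> g) = \<one>"
    using length_mult(3)[OF fg] monics_lead[OF assms(1)] monics_lead[OF assms(2)] by simp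
qed

lemma monics_cofactor:
  assumes "p \<in> monics d" "p \<otimes>\<^bsub>P\<^esub> h \<in> monics n" "h \<in> carrier P"
  shows "d \<le> n" "h \<in> monics (n - d)"
proof -
  have p: "p \<in> carrier P" "p \<noteq> []" using assms(1) monics_closed monics_not_Nil by blast+
  have h: "h \<noteq> []"
  proof
    assume "h = []"
    then have "p \<otimes>\<^bsub>P\<^esub> h = []" using UP.r_null[OF p(1)] by (simp add: univ_poly_zero)
    then show False using assms(2) monics_not_Nil by blast
  qed
  note l = length_mult[OF p(1) assms(3) p(2) h]
  have len: "length h + d = Suc n" using l(2) monics_degree[OF assms(1)] monics_degree[OF assms(2)] by simp
  moreover have "length h \<ge> 1" using h by (simp add: Suc_leI)
  ultimately show "d \<le> n" by linarith
  have "lead_coeff h \<in> carrier R" using h poly_set[OF assms(3)] by (cases h) auto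
  then have "lead_coeff h = \<one>" using l(3) monics_lead[OF assms(1)] monics_lead[OF assms(2)] by simp
  then show "h \<in> monics (n - d)" using len \<open>d \<le> n\<close> assms(3) by (intro monicsI) auto
qed

lemma monics_0: "f \<in> monics 0 \<Longrightarrow> f = \<one>\<^bsub>P\<^esub>"
  unfolding monics_eq by (auto simp: univ_poly_one)

lemma one_monic: "\<one>\<^bsub>P\<^esub> \<in> monics 0"
  by (intro monicsI UP.one_closed) (auto simp: univ_poly_one)

definition irr :: "nat \<Rightarrow> 'a list set" where
  "irr d = {p \<in> monics d. pirreducible (carrier R) p}"

lemma irr_monic: "p \<in> irr d \<Longrightarrow> p \<in> monics d"
  by (auto simp: irr_def)

lemma irr_closed: "p \<in> irr d \<Longrightarrow> p \<in> carrier P"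
  using irr_monic monics_closed by blast

lemma irr_pirreducible: "p \<in> irr d \<Longrightarrow> pirreducible (carrier R) p"
  by (auto simp: irr_def)

lemma irr_degree_pos: "p \<in> irr d \<Longrightarrow> d \<ge> 1"
  using pirreducible_degree[OF carrier_is_subfield irr_closed irr_pirreducible, of p d d]
    monics_degree[OF irr_monic, of p d] by auto

lemma irr_length: "p \<in> irr d \<Longrightarrow> length p - 1 = d"
  using monics_degree[OF irr_monic, of p d] by simp

lemma irr_prime:
  assumes "p \<in> irr d" "a \<in> carrier P" "b \<in> carrier P" "p pdivides (a \<otimes>\<^bsub>P\<^esub> b)"
  shows "p pdivides a \<or> p pdivides b"
  using assms pprimeE(3)[OF carrier_is_subfield irr_closed[OF assms(1)]]
    pprime_iff_pirreducible[OF carrier_is_subfield irr_closed[OF assms(1)]] irr_pirreducible[OF assms(1)]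
  by blast

lemma unit_length: "u \<in> Units P \<longleftrightarrow> u \<in> carrier P \<and> length u = 1"
  unfolding univ_poly_units'[OF carrier_is_subfield] by (cases u) auto

lemma irr_not_unit: "p \<in> irr d \<Longrightarrow> p \<notin> Units P"
  using irr_length[of p d] irr_degree_pos[of p d] by (auto simp: unit_length)

lemma irr_divides_monic_unit: "p \<in> irr d \<Longrightarrow> \<not> p pdivides \<one>\<^bsub>P\<^esub>"
  using monics_cofactor(1)[OF irr_monic, of p d _ 0] one_monic irr_degree_pos[of p d]
  by (auto elim!: pdividesE)

lemma irr_divides_irr:
  assumes p: "p \<in> irr d" and r: "r \<in> irr e" and "p pdivides r" shows "p = r"
proof -
  obtain h where h: "h \<in> carrier P" "r = p \<otimes>\<^bsub>P\<^esub> h" using \<open>p pdivides r\<close> by (rule pdividesE)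
  have "p \<in> Units P \<or> h \<in> Units P"
    using pirreducibleE(3)[OF carrier_is_subring irr_closed[OF r] irr_pirreducible[OF r] irr_closed[OF p] h(1) h(2)] .
  then have "length h = 1" using irr_not_unit[OF p] unit_length by blast
  moreover have "h \<in> monics (e - d)"
    using monics_cofactor(2)[OF irr_monic[OF p] _ h(1)] irr_monic[OF r] h(2) by simp
  ultimately have "e - d = 0" using monics_degree by fastforce
  then have "h = \<one>\<^bsub>P\<^esub>" using \<open>h \<in> monics (e - d)\<close> monics_0 by simp
  then show ?thesis using h irr_closed[OF p] by simp
qed

lemma monic_associate:
  assumes "a \<in> carrier P" "a \<noteq> []"
  obtains a' where "a' \<in> monics (length a - 1)" "a' pdivides a"
proof -
  let ?l = "lead_coeff a"
  have l: "?l \<in> carrier R" "?l \<noteq> \<zero>"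
    using assms univ_poly_carrier[of R "carrier R" a] by (auto simp: polynomial_def)
  then have il: "inv ?l \<in> carrier R" "inv ?l \<otimes> ?l = \<one>" "inv ?l \<noteq> \<zero>"
    using field_Units by auto
  have c: "[inv ?l] \<in> Units P" using il univ_poly_carrier_units by auto
  let ?a = "[inv ?l] \<otimes>\<^bsub>P\<^esub> a"
  have cl: "[inv ?l] \<in> carrier P" using c by (rule UP.Units_closed)
  note lm = length_mult[OF cl assms(1) _ assms(2)]
  have "?a \<in> monics (length a - 1)"
  proof (rule monicsI)
    show "length ?a = Suc (length a - 1)" using lm(2) assms(2) by simp
    show "lead_coeff ?a = \<one>" using lm(3) il by simp
  qed (use cl assms in simp)
  moreover have "a = ?a \<otimes>\<^bsub>P\<^esub> inv\<^bsub>P\<^esub> [inv ?l]"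
  proof -
    have "?a \<otimes>\<^bsub>P\<^esub> inv\<^bsub>P\<^esub> [inv ?l] = a \<otimes>\<^bsub>P\<^esub> ([inv ?l] \<otimes>\<^bsub>P\<^esub> inv\<^bsub>P\<^esub> [inv ?l])"
      using cl c assms(1) by (simp add: UP.m_ac del: UP.Units_r_inv)
    then show ?thesis using c assms(1) by simp
  qed
  then have "?a pdivides a" using c by (intro pdividesI) auto
  ultimately show ?thesis using that by blast
qed

text \<open>A monic divisor of least positive degree is irreducible. A proper factor of it need not
  be monic, hence the detour through \<open>monic_associate\<close>.\<close>

lemma exists_irr_divisor:
  assumes f: "f \<in> monics n" and n: "n \<ge> 1"
  obtains d p where "p \<in> irr d" "p pdivides f"
proof -
  let ?D = "\<lambda>d. d \<ge> 1 \<and> (\<exists>p\<in>monics d. p pdivides f)"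
  define d where "d = (LEAST d. ?D d)"
  have "?D n" using f n pdivides_refl[OF monics_closed[OF f]] by blast
  then have Dd: "?D d" unfolding d_def by (rule LeastI)
  then obtain p where p: "p \<in> monics d" "p pdivides f" and d: "d \<ge> 1" by blast
  have min: "d \<le> e" if "?D e" for e unfolding d_def using that by (rule Least_le)
  have pc: "p \<in> carrier P" "p \<noteq> []" using p monics_closed monics_not_Nil by blast+
  have "pirreducible (carrier R) p"
  proof (rule pirreducibleI[OF carrier_is_subring pc])
    show "p \<notin> Units P" using monics_degree[OF p(1)] d by (simp add: unit_length)
    fix a b assume ab: "a \<in> carrier P" "b \<in> carrier P" "p = a \<otimes>\<^bsub>P\<^esub> b"
    have ne: "a \<noteq> []" "b \<noteq> []"
      using ab pc(2) UP.l_null[OF ab(2)] UP.r_null[OF ab(1)] by (auto simp: univ_poly_zero)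
    show "a \<in> Units P \<or> b \<in> Units P"
    proof (rule ccontr)
      assume "\<not> ?thesis"
      then have la: "length a \<noteq> 1" "length b \<noteq> 1" using ab by (auto simp: unit_length)
      have len: "length a + length b = Suc d + 1"
        using length_mult(2)[OF ab(1,2) ne] monics_degree[OF p(1)] ab(3) by simp
      have pos: "length a \<ge> 1" "length b \<ge> 1" using ne by (simp_all add: Suc_leI)
      obtain a' where a': "a' \<in> monics (length a - 1)" "a' pdivides a" using monic_associate[OF ab(1) ne(1)] .
      have "a pdivides p" using ab(2,3) by (rule pdividesI)
      then have "a' pdivides f"
        using a' p pdivides_trans monics_closed by blast
      then have "d \<le> length a - 1" using a' la pos by (intro min) auto
      then show False using len la pos by linarith
    qed
  qed
  then show ?thesis using that p by (auto simp: irr_def)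
qed

definition sqf :: "'a list \<Rightarrow> bool" where
  "sqf f \<longleftrightarrow> (\<forall>d. \<forall>p\<in>irr d. \<not> (p \<otimes>\<^bsub>P\<^esub> p) pdivides f)"

definition irr_divs :: "'a list \<Rightarrow> 'a list set" where
  "irr_divs f = {p. (\<exists>d. p \<in> irr d) \<and> p pdivides f}"

lemma irr_divsE:
  assumes "p \<in> irr_divs f" obtains "p \<in> irr (length p - 1)" "p pdivides f" "length p - 1 \<ge> 1"
proof -
  obtain d where "p \<in> irr d" "p pdivides f" using assms by (auto simp: irr_divs_def)
  then show ?thesis using that irr_length[of p d] irr_degree_pos[of p d] by simp
qed

lemma finite_irr_divs:
  assumes "f \<in> monics n" shows "finite (irr_divs f)"
proof (rule finite_subset)
  show "irr_divs f \<subseteq> (\<Union>d\<in>{..n}. monics d)"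
  proof
    fix p assume "p \<in> irr_divs f"
    then obtain d where p: "p \<in> irr d" "p pdivides f" by (auto simp: irr_divs_def)
    then obtain c where c: "c \<in> carrier P" "f = p \<otimes>\<^bsub>P\<^esub> c" by (blast elim: pdividesE)
    then have "d \<le> n" using monics_cofactor(1)[OF irr_monic[OF p(1)] _ c(1)] assms by simp
    then show "p \<in> (\<Union>d\<in>{..n}. monics d)" using irr_monic[OF p(1)] by blast
  qed
qed (simp add: finite_monics)

lemma sqf_mult_iff:
  assumes p: "p \<in> irr d" and h: "h \<in> monics e"
  shows "sqf (p \<otimes>\<^bsub>P\<^esub> h) \<longleftrightarrow> sqf h \<and> \<not> p pdivides h"
proof -
  have pc: "p \<in> carrier P" "h \<in> carrier P" using irr_closed[OF p] monics_closed[OF h] .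
  have pz: "p \<noteq> \<zero>\<^bsub>P\<^esub>" using monics_not_Nil[OF irr_monic[OF p]] by (simp add: univ_poly_zero)
  have canc: "(p \<otimes>\<^bsub>P\<^esub> p) pdivides (p \<otimes>\<^bsub>P\<^esub> h) \<longleftrightarrow> p pdivides h"
  proof
    assume "(p \<otimes>\<^bsub>P\<^esub> p) pdivides (p \<otimes>\<^bsub>P\<^esub> h)"
    then obtain c where c: "c \<in> carrier P" "p \<otimes>\<^bsub>P\<^esub> h = p \<otimes>\<^bsub>P\<^esub> p \<otimes>\<^bsub>P\<^esub> c" by (rule pdividesE)
    then have "p \<otimes>\<^bsub>P\<^esub> h = p \<otimes>\<^bsub>P\<^esub> (p \<otimes>\<^bsub>P\<^esub> c)" using pc by (simp add: UP.m_assoc)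
    then have "h = p \<otimes>\<^bsub>P\<^esub> c" using UP.m_lcancel[OF pz pc(1) pc(2) UP.m_closed[OF pc(1) c(1)]] by blast
    then show "p pdivides h" using c by (intro pdividesI)
  next
    assume "p pdivides h"
    then obtain c where c: "c \<in> carrier P" "h = p \<otimes>\<^bsub>P\<^esub> c" by (rule pdividesE)
    then show "(p \<otimes>\<^bsub>P\<^esub> p) pdivides (p \<otimes>\<^bsub>P\<^esub> h)" using pc by (intro pdividesI[of c]) (auto simp: UP.m_assoc)
  qed
  have h_div: "h pdivides (p \<otimes>\<^bsub>P\<^esub> h)" using pc by (intro pdividesI[of p]) (auto simp: UP.m_comm)
  show ?thesis
  proof
    assume s: "sqf (p \<otimes>\<^bsub>P\<^esub> h)"
    have "\<not> p pdivides h" using s p canc unfolding sqf_def by blast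
    moreover have "sqf h" unfolding sqf_def
    proof (intro allI ballI notI)
      fix k r assume r: "r \<in> irr k" "(r \<otimes>\<^bsub>P\<^esub> r) pdivides h"
      then have "(r \<otimes>\<^bsub>P\<^esub> r) pdivides (p \<otimes>\<^bsub>P\<^esub> h)"
        using pdivides_trans[OF _ h_div] irr_closed[OF r(1)] by blast
      then show False using s r unfolding sqf_def by blast
    qed
    ultimately show "sqf h \<and> \<not> p pdivides h" by blast
  next
    assume s: "sqf h \<and> \<not> p pdivides h"
    show "sqf (p \<otimes>\<^bsub>P\<^esub> h)" unfolding sqf_def
    proof (intro allI ballI notI)
      fix k r assume r: "r \<in> irr k" "(r \<otimes>\<^bsub>P\<^esub> r) pdivides (p \<otimes>\<^bsub>P\<^esub> h)"
      have rc: "r \<in> carrier P" using irr_closed[OF r(1)] .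
      show False
      proof (cases "r pdivides p")
        case True
        then have "r = p" using irr_divides_irr[OF r(1) p] by simp
        then show False using r canc s by simp
      next
        case False
        have sq: "r [^]\<^bsub>P\<^esub> (2::nat) = r \<otimes>\<^bsub>P\<^esub> r" using rc by (simp add: numeral_2_eq_2)
        \<comment> \<open>\<open>r\<close> is prime to \<open>p\<close>, so a power of
          \<open>r\<close> that divides the product divides \<open>h\<close>.\<close>
        have "(r [^]\<^bsub>P\<^esub> (2::nat)) pdivides h"
          using pirreducible_pow_pdivides_iff[OF carrier_is_subfield rc pc irr_pirreducible[OF r(1)] False, of 2] r(2)
          unfolding sq by blast
        then show False using s r(1) unfolding sqf_def sq by blast
      qed
    qed
  qed
qed

lemma irr_divs_mult:
  assumes p: "p \<in> irr d" and h: "h \<in> carrier P"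
  shows "irr_divs (p \<otimes>\<^bsub>P\<^esub> h) = insert p (irr_divs h)"
proof -
  have pc: "p \<in> carrier P" using irr_closed[OF p] .
  have 1: "p pdivides (p \<otimes>\<^bsub>P\<^esub> h)" using h by (intro pdividesI[of h]) auto
  have 2: "h pdivides (p \<otimes>\<^bsub>P\<^esub> h)" using pc h by (intro pdividesI[of p]) (auto simp: UP.m_comm)
  show ?thesis
  proof (intro equalityI subsetI)
    fix r assume "r \<in> irr_divs (p \<otimes>\<^bsub>P\<^esub> h)"
    then obtain e where r: "r \<in> irr e" "r pdivides (p \<otimes>\<^bsub>P\<^esub> h)" unfolding irr_divs_def by blast
    then have "r pdivides p \<or> r pdivides h" using irr_prime[OF r(1) pc h] by blast
    then show "r \<in> insert p (irr_divs h)" using irr_divides_irr[OF r(1) p] r unfolding irr_divs_def by blast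
  next
    fix r assume r: "r \<in> insert p (irr_divs h)"
    show "r \<in> irr_divs (p \<otimes>\<^bsub>P\<^esub> h)"
    proof (cases "r = p")
      case False
      then obtain e where "r \<in> irr e" "r pdivides h" using r unfolding irr_divs_def by blast
      then show ?thesis using pdivides_trans[OF _ 2] irr_closed unfolding irr_divs_def by blast
    qed (use p 1 in \<open>auto simp: irr_divs_def\<close>)
  qed
qed

text \<open>Irreducible factors are split off one at a time. By squarefreeness a factor does not
  occur again in the cofactor, so every element of \<open>irr_divs f\<close> is counted
  once.\<close>

lemma sum_irr_divs:
  assumes "f \<in> monics n" "sqf f"
  shows "(\<Sum>p\<in>irr_divs f. length p - 1) = n"
  using assms
proof (induction n arbitrary: f rule: less_induct)
  case (less n)
  show ?case
  proof (cases "n = 0")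
    case True
    then have "f = \<one>\<^bsub>P\<^esub>" using less.prems monics_0 by simp
    then have "irr_divs f = {}" using irr_divides_monic_unit unfolding irr_divs_def by blast
    then show ?thesis using True by simp
  next
    case False
    then have "n \<ge> 1" by simp
    with less.prems(1) obtain d p where p: "p \<in> irr d" "p pdivides f" by (rule exists_irr_divisor)
    from p(2) obtain h where h: "h \<in> carrier P" "f = p \<otimes>\<^bsub>P\<^esub> h" by (rule pdividesE)
    have dn: "d \<le> n" and hm: "h \<in> monics (n - d)"
      using monics_cofactor[OF irr_monic[OF p(1)] _ h(1)] less.prems(1) h(2) by simp_all
    have sq: "sqf h" "\<not> p pdivides h" using less.prems(2) sqf_mult_iff[OF p(1) hm] h(2) by simp_all
    have d: "d \<ge> 1" using irr_degree_pos[OF p(1)] .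
    have "p \<notin> irr_divs h" using sq unfolding irr_divs_def by blast
    then have "(\<Sum>p\<in>irr_divs f. length p - 1) = (length p - 1) + (\<Sum>p\<in>irr_divs h. length p - 1)"
      unfolding h(2) irr_divs_mult[OF p(1) h(1)] using finite_irr_divs[OF hm] by simp
    also have "\<dots> = d + (n - d)"
      using less.IH[OF _ hm sq(1)] d dn irr_length[OF p(1)] by simp
    finally show ?thesis using dn by simp
  qed
qed

lemma rupture_field: "p \<in> irr d \<Longrightarrow> field (Rupt (carrier R) p)"
  using rupture_is_field_iff_pirreducible[OF carrier_is_subfield irr_closed] irr_pirreducible by blast

lemma rupture_zero_iff:
  assumes "f \<in> carrier P" "a \<in> carrier P"
  shows "rupture_surj (carrier R) f a = \<zero>\<^bsub>Rupt (carrier R) f\<^esub> \<longleftrightarrow> f pdivides a"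
proof -
  interpret h: ring_hom_cring P "Rupt (carrier R) f" "rupture_surj (carrier R) f" by (rule rupture_hom[OF assms(1)])
  show ?thesis using rupture_eq_iff[OF assms UP.zero_closed] assms(2) h.hom_zero by (simp add: UP.minus_eq)
qed

text \<open>The inverse of the class of \<open>h\<close> in the field
  \<open>Rupt (carrier R) p\<close> supplies \<open>b\<close>.\<close>

lemma irr_bezout:
  assumes p: "p \<in> irr d" and h: "h \<in> carrier P" "\<not> p pdivides h"
  obtains b where "b \<in> carrier P" "p pdivides (b \<otimes>\<^bsub>P\<^esub> h \<ominus>\<^bsub>P\<^esub> \<one>\<^bsub>P\<^esub>)"
proof -
  have pc: "p \<in> carrier P" using irr_closed[OF p] .
  let ?Q = "Rupt (carrier R) p" and ?\<pi> = "rupture_surj (carrier R) p"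
  interpret h: ring_hom_cring P ?Q ?\<pi> by (rule rupture_hom[OF pc])
  interpret Q: field ?Q by (rule rupture_field[OF p])
  have "?\<pi> h \<in> Units ?Q" using h rupture_zero_iff[OF pc h(1)] Q.field_Units by simp
  then obtain y where y: "y \<in> carrier ?Q" "y \<otimes>\<^bsub>?Q\<^esub> ?\<pi> h = \<one>\<^bsub>?Q\<^esub>" unfolding Units_def by blast
  obtain b where b: "b \<in> carrier P" "y = ?\<pi> b" using rupture_surj[OF pc y(1)] by blast
  have "?\<pi> (b \<otimes>\<^bsub>P\<^esub> h) = ?\<pi> \<one>\<^bsub>P\<^esub>" using y b h(1) by simp
  then show ?thesis using that b h(1) rupture_eq_iff[OF pc, of "b \<otimes>\<^bsub>P\<^esub> h" "\<one>\<^bsub>P\<^esub>"] by simp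
qed

lemma coeff_0_mult:
  assumes "f \<in> carrier P" "g \<in> carrier P"
  shows "coeff (f \<otimes>\<^bsub>P\<^esub> g) 0 = coeff f 0 \<otimes> coeff g 0"
  using poly_mult_coeff[OF poly_set[OF assms(1)] poly_set[OF assms(2)]] assms
  by (simp add: univ_poly_mult del: poly_mult.simps)

lemma power_poly_divisor:
  assumes "f \<in> carrier P" "g \<in> carrier P" "power_poly M (f \<otimes>\<^bsub>P\<^esub> g)"
  shows "power_poly M f"
proof -
  have "f pdivides (f \<otimes>\<^bsub>P\<^esub> g)" using assms by (intro pdividesI[of g]) auto
  moreover have "coeff f 0 \<noteq> \<zero>"
    using assms coeff_0_mult[OF assms(1,2)] by (auto simp: power_poly_def)
  ultimately show ?thesis using assms pdivides_trans unfolding power_poly_def by blast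
qed

text \<open>Chinese remainder theorem: \<open>e\<close> is 1 modulo \<open>p\<close> and 0 modulo
  \<open>h\<close>, and \<open>e'\<close> is the other way round, so \<open>g1\<close> and
  \<open>g2\<close> glue to a root modulo both.\<close>

lemma power_poly_mult_iff:
  assumes p: "p \<in> irr d" and h: "h \<in> carrier P" "\<not> p pdivides h"
  shows "power_poly M (p \<otimes>\<^bsub>P\<^esub> h) \<longleftrightarrow> power_poly M p \<and> power_poly M h"
proof
  have pc: "p \<in> carrier P" using irr_closed[OF p] .
  show "power_poly M p \<and> power_poly M h" if *: "power_poly M (p \<otimes>\<^bsub>P\<^esub> h)"
    using power_poly_divisor[OF pc h(1) *] power_poly_divisor[OF h(1) pc, of M] * UP.m_comm[OF pc h(1)] by simp
  assume *: "power_poly M p \<and> power_poly M h"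
  then obtain g1 g2 where g1: "g1 \<in> carrier P" "p pdivides (g1 [^]\<^bsub>P\<^esub> M \<ominus>\<^bsub>P\<^esub> X)"
    and g2: "g2 \<in> carrier P" "h pdivides (g2 [^]\<^bsub>P\<^esub> M \<ominus>\<^bsub>P\<^esub> X)" unfolding power_poly_def by blast
  obtain b where b: "b \<in> carrier P" "p pdivides (b \<otimes>\<^bsub>P\<^esub> h \<ominus>\<^bsub>P\<^esub> \<one>\<^bsub>P\<^esub>)" using irr_bezout[OF p h] .
  define e where "e = b \<otimes>\<^bsub>P\<^esub> h"
  define e' where "e' = \<one>\<^bsub>P\<^esub> \<ominus>\<^bsub>P\<^esub> e"
  have e: "e \<in> carrier P" "e' \<in> carrier P" unfolding e_def e'_def using b h by simp_all
  define g where "g = g1 \<otimes>\<^bsub>P\<^esub> e \<oplus>\<^bsub>P\<^esub> g2 \<otimes>\<^bsub>P\<^esub> e'"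
  have g: "g \<in> carrier P" unfolding g_def using g1 g2 e by simp
  define z where "z = g [^]\<^bsub>P\<^esub> M \<ominus>\<^bsub>P\<^esub> X"
  have z: "z \<in> carrier P" unfolding z_def using g by simp
  have "p pdivides z"
  proof -
    let ?Q = "Rupt (carrier R) p" and ?\<pi> = "rupture_surj (carrier R) p"
    interpret h: ring_hom_cring P ?Q ?\<pi> by (rule rupture_hom[OF pc])
    have e1: "?\<pi> e = \<one>\<^bsub>?Q\<^esub>"
      using rupture_eq_iff[OF pc e(1) UP.one_closed] b h.hom_one by (simp add: e_def[symmetric])
    have e0: "?\<pi> e' = \<zero>\<^bsub>?Q\<^esub>"
      unfolding e'_def UP.minus_eq using e e1 by (simp add: h.S.r_neg)
    have "?\<pi> g = ?\<pi> g1" unfolding g_def using g1 g2 e e0 e1 by simp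
    then have "?\<pi> (g [^]\<^bsub>P\<^esub> M) = ?\<pi> (g1 [^]\<^bsub>P\<^esub> M)" using g g1 by (simp add: h.hom_nat_power)
    also have "\<dots> = ?\<pi> X" using rupture_eq_iff[OF pc, of "g1 [^]\<^bsub>P\<^esub> M" X] g1 by simp
    finally show ?thesis unfolding z_def using rupture_eq_iff[OF pc, of "g [^]\<^bsub>P\<^esub> M" X] g by simp
  qed
  moreover have "h pdivides z"
  proof -
    let ?Q = "Rupt (carrier R) h" and ?\<pi> = "rupture_surj (carrier R) h"
    interpret h: ring_hom_cring P ?Q ?\<pi> by (rule rupture_hom[OF h(1)])
    have "?\<pi> h = \<zero>\<^bsub>?Q\<^esub>" using rupture_zero_iff[OF h(1) h(1)] pdivides_refl[OF h(1)] by simp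
    then have e0: "?\<pi> e = \<zero>\<^bsub>?Q\<^esub>" unfolding e_def using b h(1) by simp
    have e1: "?\<pi> e' = \<one>\<^bsub>?Q\<^esub>"
      unfolding e'_def UP.minus_eq using e e0 by simp
    have "?\<pi> g = ?\<pi> g2" unfolding g_def using g1 g2 e e0 e1 by simp
    then have "?\<pi> (g [^]\<^bsub>P\<^esub> M) = ?\<pi> (g2 [^]\<^bsub>P\<^esub> M)" using g g2 by (simp add: h.hom_nat_power)
    also have "\<dots> = ?\<pi> X" using rupture_eq_iff[OF h(1), of "g2 [^]\<^bsub>P\<^esub> M" X] g2 by simp
    finally show ?thesis unfolding z_def using rupture_eq_iff[OF h(1), of "g [^]\<^bsub>P\<^esub> M" X] g by simp
  qed
  then obtain w where w: "w \<in> carrier P" "z = h \<otimes>\<^bsub>P\<^esub> w" by (rule pdividesE)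
  \<comment> \<open>\<open>p\<close> is irreducible and does not divide \<open>h\<close>, so it
    divides the cofactor; thus the product \<open>p h\<close> divides \<open>z\<close>.\<close>
  ultimately have "p pdivides w" using irr_prime[OF p h(1) w(1)] h(2) by blast
  then obtain u where u: "u \<in> carrier P" "w = p \<otimes>\<^bsub>P\<^esub> u" by (rule pdividesE)
  have "z = p \<otimes>\<^bsub>P\<^esub> h \<otimes>\<^bsub>P\<^esub> u" unfolding w u using pc h(1) u(1) by (simp add: UP.m_ac)
  then have "(p \<otimes>\<^bsub>P\<^esub> h) pdivides z" using u by (intro pdividesI)
  moreover have "coeff (p \<otimes>\<^bsub>P\<^esub> h) 0 \<noteq> \<zero>"
    using * coeff_0_mult[OF pc h(1)] integral[of "coeff p 0" "coeff h 0"] pc h(1) by (auto simp: power_poly_def)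
  ultimately show "power_poly M (p \<otimes>\<^bsub>P\<^esub> h)" unfolding power_poly_def z_def using g by blast
qed

definition sqf_powers :: "nat \<Rightarrow> nat \<Rightarrow> 'a list set" where
  "sqf_powers M n = {f \<in> monics n. sqf f \<and> power_poly M f}"

definition irr_powers :: "nat \<Rightarrow> nat \<Rightarrow> 'a list set" where
  "irr_powers M d = {p \<in> irr d. power_poly M p}"

lemma finite_sqf_powers: "finite (sqf_powers M n)"
  unfolding sqf_powers_def using finite_monics[of n] by simp

lemma finite_irr_powers: "finite (irr_powers M n)"
  unfolding irr_powers_def irr_def using finite_monics[of n] by simp

text \<open>Pairs of a polynomial and one of its irreducible factors are counted twice, with the
  degree of the factor as weight, since these degrees add up to \<open>n\<close>. The cofactor must
  avoid \<open>p\<close> for the product to be squarefree.\<close>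

lemma sqf_powers_recursion:
  "n * card (sqf_powers M n) =
    (\<Sum>i=1..n. \<Sum>p\<in>irr_powers M i. i * card {h \<in> sqf_powers M (n - i). \<not> p pdivides h})"
proof -
  let ?H = "\<lambda>i p. {h \<in> sqf_powers M (n - i). \<not> p pdivides h}"
  define quo where "quo = (\<lambda>f p. SOME h. h \<in> carrier P \<and> f = p \<otimes>\<^bsub>P\<^esub> h)"
  have quo: "quo f p \<in> carrier P \<and> f = p \<otimes>\<^bsub>P\<^esub> quo f p" if "p pdivides f" for f p
    using that unfolding quo_def by (rule pdividesE) (rule someI_ex, blast)
  have "n * card (sqf_powers M n) = (\<Sum>f\<in>sqf_powers M n. n)" by simp
  also have "\<dots> = (\<Sum>f\<in>sqf_powers M n. \<Sum>p\<in>irr_divs f. length p - 1)"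
    by (rule sum.cong[OF refl], rule sum_irr_divs[symmetric]) (auto simp: sqf_powers_def)
  also have "\<dots> = (\<Sum>(f,p)\<in>(SIGMA f:sqf_powers M n. irr_divs f). length p - 1)"
    using finite_irr_divs finite_sqf_powers[of M n] by (intro sum.Sigma) (auto simp: sqf_powers_def)
  also have "\<dots> = (\<Sum>(i,p,h)\<in>(SIGMA i:{1..n}. SIGMA p:irr_powers M i. ?H i p). i)"
  proof (rule sum.reindex_bij_witness[of _ "\<lambda>(i,p,h). (p \<otimes>\<^bsub>P\<^esub> h, p)" "\<lambda>(f,p). (length p - 1, p, quo f p)"])
    fix x assume "x \<in> (SIGMA f:sqf_powers M n. irr_divs f)"
    then obtain f p where x: "x = (f, p)" and f: "f \<in> monics n" "sqf f" "power_poly M f" and p: "p \<in> irr_divs f"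
      unfolding sqf_powers_def by blast
    obtain pi: "p \<in> irr (length p - 1)" "p pdivides f" and d: "length p - 1 \<ge> 1" using p by (rule irr_divsE)
    let ?h = "quo f p"
    have h: "?h \<in> carrier P" "f = p \<otimes>\<^bsub>P\<^esub> ?h" using quo[OF pi(2)] by blast+
    have m: "length p - 1 \<le> n" "?h \<in> monics (n - (length p - 1))"
      using monics_cofactor[OF irr_monic[OF pi(1)] _ h(1)] f(1) h(2) by simp_all
    have s: "sqf ?h" "\<not> p pdivides ?h" using sqf_mult_iff[OF pi(1) m(2)] f(2) h(2) by simp_all
    have g: "power_poly M p" "power_poly M ?h" using power_poly_mult_iff[OF pi(1) h(1) s(2), of M] f(3) h(2) by simp_all
    show "(case case x of (f, p) \<Rightarrow> (length p - 1, p, quo f p) of (i, p, h) \<Rightarrow> (p \<otimes>\<^bsub>P\<^esub> h, p)) = x"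
      using x h(2) by simp
    show "(case x of (f, p) \<Rightarrow> (length p - 1, p, quo f p)) \<in> (SIGMA i:{1..n}. SIGMA p:irr_powers M i. ?H i p)"
      unfolding x irr_powers_def sqf_powers_def using pi(1) d m s g by simp
    show "(case case x of (f, p) \<Rightarrow> (length p - 1, p, quo f p) of (i, p, h) \<Rightarrow> i) = (case x of (f, p) \<Rightarrow> length p - 1)"
      unfolding x by simp
  next
    fix y assume "y \<in> (SIGMA i:{1..n}. SIGMA p:irr_powers M i. ?H i p)"
    then obtain i p h where y: "y = (i, p, h)" and i: "1 \<le> i" "i \<le> n" and p: "p \<in> irr i" "power_poly M p"
      and h: "h \<in> monics (n - i)" "sqf h" "power_poly M h" "\<not> p pdivides h"
      unfolding irr_powers_def sqf_powers_def by auto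
    have hc: "h \<in> carrier P" and pc: "p \<in> carrier P" using monics_closed[OF h(1)] irr_closed[OF p(1)] .
    have pdiv: "p pdivides (p \<otimes>\<^bsub>P\<^esub> h)" using hc by (intro pdividesI[of h]) auto
    have pz: "p \<noteq> \<zero>\<^bsub>P\<^esub>" using monics_not_Nil[OF irr_monic[OF p(1)]] by (simp add: univ_poly_zero)
    have "quo (p \<otimes>\<^bsub>P\<^esub> h) p = h" using quo[OF pdiv] UP.m_lcancel[OF pz pc hc] by metis
    then show "(case case y of (i, p, h) \<Rightarrow> (p \<otimes>\<^bsub>P\<^esub> h, p) of (f, p) \<Rightarrow> (length p - 1, p, quo f p)) = y"
      using y irr_length[OF p(1)] by simp
    have "p \<otimes>\<^bsub>P\<^esub> h \<in> monics n" using monics_mult[OF irr_monic[OF p(1)] h(1)] i by simp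
    moreover have "sqf (p \<otimes>\<^bsub>P\<^esub> h)" using sqf_mult_iff[OF p(1) h(1)] h by simp
    moreover have "power_poly M (p \<otimes>\<^bsub>P\<^esub> h)" using power_poly_mult_iff[OF p(1) hc h(4)] p h by simp
    moreover have "p \<in> irr_divs (p \<otimes>\<^bsub>P\<^esub> h)" unfolding irr_divs_def using p(1) pdiv by blast
    ultimately show "(case y of (i, p, h) \<Rightarrow> (p \<otimes>\<^bsub>P\<^esub> h, p)) \<in> (SIGMA f:sqf_powers M n. irr_divs f)"
      unfolding y sqf_powers_def by simp
  qed
  also have "\<dots> = (\<Sum>i=1..n. \<Sum>(p,h)\<in>(SIGMA p:irr_powers M i. ?H i p). i)"
    using finite_irr_powers finite_sqf_powers by (subst sum.Sigma[symmetric]) auto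
  also have "\<dots> = (\<Sum>i=1..n. \<Sum>p\<in>irr_powers M i. \<Sum>h\<in>?H i p. i)"
    using finite_irr_powers finite_sqf_powers by (intro sum.cong refl sum.Sigma[symmetric]) auto
  finally show ?thesis by (simp add: mult.commute)
qed

text \<open>Bounds the error made by dropping from the recursion the condition that \<open>p\<close>
  does not divide \<open>h\<close>.\<close>

lemma card_multiples_le:
  assumes p: "p \<in> monics i"
  shows "card {h \<in> sqf_powers M k. p pdivides h} \<le> (if i \<le> k then q ^ (k - i) else 0)"
proof -
  have sub: "{h \<in> sqf_powers M k. p pdivides h} \<subseteq> (if i \<le> k then (\<lambda>c. p \<otimes>\<^bsub>P\<^esub> c) ` monics (k - i) else {})"
  proof
    fix h assume h: "h \<in> {h \<in> sqf_powers M k. p pdivides h}"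
    then have hm: "h \<in> monics k" and d: "p pdivides h" by (auto simp: sqf_powers_def)
    obtain c where c: "c \<in> carrier P" "h = p \<otimes>\<^bsub>P\<^esub> c" using d by (rule pdividesE)
    then show "h \<in> (if i \<le> k then (\<lambda>c. p \<otimes>\<^bsub>P\<^esub> c) ` monics (k - i) else {})"
      using monics_cofactor[OF p _ c(1), of k] hm by auto
  qed
  show ?thesis
  proof (cases "i \<le> k")
    case True
    then have "card {h \<in> sqf_powers M k. p pdivides h} \<le> card ((\<lambda>c. p \<otimes>\<^bsub>P\<^esub> c) ` monics (k - i))"
      using sub finite_monics by (intro card_mono) auto
    also have "\<dots> \<le> card (monics (k - i))" by (intro card_image_le finite_monics)
    finally show ?thesis using True by (simp add: card_monics)
  next
    case False
    then have "{h \<in> sqf_powers M k. p pdivides h} = {}" using sub by simp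
    then show ?thesis by (metis card.empty le0)
  qed
qed

end

section \<open>Frobenius maps and power residues in finite fields\<close>

lemma (in cring) binomial_ring:
  assumes a: "a \<in> carrier R" and b: "b \<in> carrier R"
  shows "(a \<oplus> b) [^] (n::nat) = (\<Oplus>k\<in>{..n}. add_pow R (n choose k) (a [^] k \<otimes> b [^] (n - k)))"
proof (induction n)
  case 0
  then show ?case by simp
next
  case (Suc n)
  define t where "t = (\<lambda>k. add_pow R (n choose k) (a [^] k \<otimes> b [^] (n - k)))"
  define u where "u = (\<lambda>k. add_pow R (n choose k) (a [^] k \<otimes> b [^] (Suc n - k)))"
  define s where "s = (\<lambda>k. add_pow R (Suc n choose k) (a [^] k \<otimes> b [^] (Suc n - k)))"
  have cl: "t k \<in> carrier R" "u k \<in> carrier R" "s k \<in> carrier R" for k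
    using a b by (simp_all add: t_def u_def s_def)
  have at: "t k \<otimes> a = add_pow R (n choose k) (a [^] Suc k \<otimes> b [^] (n - k))" if "k \<le> n" for k
  proof -
    have "a [^] k \<otimes> b [^] (n - k) \<otimes> a = a [^] Suc k \<otimes> b [^] (n - k)"
      using a b by (simp add: m_ac)
    then show ?thesis using a b by (simp add: t_def add_pow_ldistr del: nat_pow_Suc)
  qed
  have bt: "t k \<otimes> b = u k" if "k \<le> n" for k
    using a b that by (simp add: t_def u_def add_pow_ldistr m_assoc Suc_diff_le)
  have s_Suc: "s (Suc k) = t k \<otimes> a \<oplus> u (Suc k)" if "k \<le> n" for k
    using a b at[OF that] by (simp add: s_def u_def add.nat_pow_mult[symmetric])
  have "(a \<oplus> b) [^] Suc n = (\<Oplus>k\<in>{..n}. t k) \<otimes> (a \<oplus> b)"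
    using Suc by (simp add: t_def)
  also have "\<dots> = (\<Oplus>k\<in>{..n}. t k \<otimes> a) \<oplus> (\<Oplus>k\<in>{..n}. t k \<otimes> b)"
    using a b cl by (simp add: r_distr finsum_ldistr)
  also have "(\<Oplus>k\<in>{..n}. t k \<otimes> b) = (\<Oplus>k\<in>{..n}. u k)"
    using cl bt by (intro finsum_cong') auto
  also have "\<dots> = (\<Oplus>k\<in>{..Suc n}. u k)"
  proof -
    have "u (Suc n) = \<zero>" by (simp add: u_def binomial_eq_0)
    then show ?thesis using cl by (simp add: finsum_Suc)
  qed
  also have "\<dots> = (\<Oplus>k\<in>{..n}. u (Suc k)) \<oplus> u 0"
    using cl by (intro finsum_Suc2) auto
  also have "u 0 = s 0" by (simp add: u_def s_def)
  finally have "(a \<oplus> b) [^] Suc n = (\<Oplus>k\<in>{..n}. t k \<otimes> a) \<oplus> ((\<Oplus>k\<in>{..n}. u (Suc k)) \<oplus> s 0)" .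
  also have "\<dots> = ((\<Oplus>k\<in>{..n}. t k \<otimes> a) \<oplus> (\<Oplus>k\<in>{..n}. u (Suc k))) \<oplus> s 0"
    using a cl by (intro a_assoc[symmetric] finsum_closed) auto
  also have "(\<Oplus>k\<in>{..n}. t k \<otimes> a) \<oplus> (\<Oplus>k\<in>{..n}. u (Suc k)) = (\<Oplus>k\<in>{..n}. t k \<otimes> a \<oplus> u (Suc k))"
    using a cl by (intro finsum_addf[symmetric]) auto
  also have "\<dots> = (\<Oplus>k\<in>{..n}. s (Suc k))"
    using cl s_Suc by (intro finsum_cong') auto
  also have "(\<Oplus>k\<in>{..n}. s (Suc k)) \<oplus> s 0 = (\<Oplus>k\<in>{..Suc n}. s k)"
    using cl by (intro finsum_Suc2[symmetric]) auto
  finally show ?case by (simp add: s_def)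
qed

text \<open>The inner binomial coefficients are multiples of \<open>p\<close>, and
  \<open>char\<close> makes every multiple of \<open>p\<close> vanish. The exponent
  \<open>p ^ k\<close> follows by iteration.\<close>

lemma (in cring) freshmans_dream:
  assumes p: "Factorial_Ring.prime (p::nat)" and char: "add_pow R p \<one> = \<zero>"
    and a: "a \<in> carrier R" and b: "b \<in> carrier R"
  shows "(a \<oplus> b) [^] (p ^ k) = a [^] (p ^ k) \<oplus> b [^] (p ^ k)"
proof (induction k)
  case 0
  then show ?case using a b by simp
next
  case (Suc k)
  have base: "(x \<oplus> y) [^] p = x [^] p \<oplus> y [^] p" if x: "x \<in> carrier R" and y: "y \<in> carrier R" for x y
  proof -
    define t where "t = (\<lambda>k. add_pow R (p choose k) (x [^] k \<otimes> y [^] (p - k)))"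
    have cl: "t k \<in> carrier R" for k using x y by (simp add: t_def)
    have char': "add_pow R (p * m) z = \<zero>" if "z \<in> carrier R" for z m
    proof -
      have "add_pow R p z = add_pow R p \<one> \<otimes> z" using that add_pow_ldistr[OF one_closed that, of p] by simp
      then have "add_pow R p z = \<zero>" using that char by simp
      then have "add_pow R m (add_pow R p z) = \<zero>" by simp
      then show ?thesis using add.nat_pow_pow[OF that, of m p] by simp
    qed
    have mid: "t k = \<zero>" if "k \<in> {0<..<p}" for k
    proof -
      have "p dvd (p choose k)" using that p by (intro dvd_choose_prime) auto
      then obtain m where "p choose k = p * m" by (rule dvdE)
      then show ?thesis using x y by (simp add: t_def char')
    qed
    obtain r where r: "p = Suc (Suc r)" using prime_ge_2_nat[OF p] by (metis add_2_eq_Suc le_Suc_ex)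
    have "(x \<oplus> y) [^] p = (\<Oplus>k\<in>{..p}. t k)" unfolding t_def using x y by (rule binomial_ring)
    also have "\<dots> = (\<Oplus>k\<in>{..Suc r}. t (Suc k)) \<oplus> t 0"
      unfolding r using cl by (intro finsum_Suc2) auto
    also have "(\<Oplus>k\<in>{..Suc r}. t (Suc k)) = t p \<oplus> (\<Oplus>k\<in>{..r}. t (Suc k))"
      unfolding r using cl by (intro finsum_Suc) auto
    also have "(\<Oplus>k\<in>{..r}. t (Suc k)) = (\<Oplus>k\<in>{..r}. \<zero>)"
      using mid r by (intro finsum_cong') auto
    finally show ?thesis using x y cl[of p] by (simp add: t_def)
  qed
  have "(a \<oplus> b) [^] (p ^ Suc k) = ((a \<oplus> b) [^] (p ^ k)) [^] p"
    using a b by (simp add: nat_pow_pow mult.commute)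
  also have "\<dots> = (a [^] (p ^ k)) [^] p \<oplus> (b [^] (p ^ k)) [^] p" using Suc a b by (simp add: base)
  also have "\<dots> = a [^] (p ^ Suc k) \<oplus> b [^] (p ^ Suc k)"
    using a b by (simp add: nat_pow_pow mult.commute)
  finally show ?case .
qed

lemma (in field) finite_field_generator:
  assumes fin: "finite (carrier R)"
  defines "N \<equiv> card (carrier R) - 1"
  shows "\<exists>w\<in>carrier R - {\<zero>}. (\<forall>x\<in>carrier R - {\<zero>}. \<exists>i::nat. x = w [^] i) \<and>
    (\<forall>i::nat. w [^] i = \<one> \<longleftrightarrow> N dvd i) \<and> N > 0"
proof -
  note mult_of_simps [simp]
  interpret G: group "Multiplicative_Group.mult_of R" rewrites "([^]\<^bsub>Multiplicative_Group.mult_of R\<^esub>) = (([^]) :: _ \<Rightarrow> nat \<Rightarrow> _)" and "\<one>\<^bsub>Multiplicative_Group.mult_of R\<^esub> = \<one>"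
    by (rule field_mult_group) simp_all
  have finG: "finite (carrier (Multiplicative_Group.mult_of R))" using fin by (rule finite_mult_of)
  obtain w where w: "w \<in> carrier (Multiplicative_Group.mult_of R)" "carrier (Multiplicative_Group.mult_of R) = {w [^] i | i::nat. i \<in> UNIV}"
    using finite_field_mult_group_has_gen[OF fin] by blast
  have "card (carrier (Multiplicative_Group.mult_of R)) = G.ord w"
  proof -
    have "carrier (Multiplicative_Group.mult_of R) = (\<lambda>i. w [^] i) ` {0..G.ord w - 1}"
      using G.ord_elems[OF finG w(1)] w(2) by auto
    moreover have "inj_on (\<lambda>i::nat. w [^] i) {0..G.ord w - 1}"
      using G.ord_inj[OF w(1)] by simp
    moreover have "G.ord w \<ge> 1" using G.ord_ge_1[OF finG w(1)] .
    ultimately show ?thesis by (simp add: card_image)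
  qed
  moreover have "card (carrier (Multiplicative_Group.mult_of R)) = N"
    using fin by (simp add: N_def card_Diff_singleton)
  ultimately have ord: "G.ord w = N" by simp
  show ?thesis
  proof (intro bexI[of _ w] conjI ballI allI)
    show "w \<in> carrier R - {\<zero>}" using w(1) by simp
    show "\<exists>i::nat. x = w [^] i" if "x \<in> carrier R - {\<zero>}" for x using that w(2) by auto
    show "w [^] i = \<one> \<longleftrightarrow> N dvd i" for i :: nat using G.pow_eq_id[OF w(1), of i] ord by simp
    show "N > 0" using G.ord_ge_1[OF finG w(1)] ord by simp
  qed
qed

text \<open>With a generator \<open>w\<close> and \<open>x = w [^] i\<close>, both sides say that
  \<open>gcd M N\<close> divides \<open>i\<close>; on the left this is solvability of the congruence
  \<open>M * j = i\<close> modulo \<open>N\<close>.\<close>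

lemma (in field) power_residue_iff:
  assumes fin: "finite (carrier R)" and x: "x \<in> carrier R" "x \<noteq> \<zero>" and M: "M \<ge> 1"
  defines "N \<equiv> card (carrier R) - 1"
  shows "(\<exists>g\<in>carrier R. g [^] (M::nat) = x) \<longleftrightarrow> x [^] (N div gcd M N) = \<one>"
proof -
  obtain w where w: "w \<in> carrier R - {\<zero>}" and gen: "\<forall>x\<in>carrier R - {\<zero>}. \<exists>i::nat. x = w [^] i"
    and ord: "\<forall>i::nat. w [^] i = \<one> \<longleftrightarrow> N dvd i" and N: "N > 0"
    using finite_field_generator[OF fin] unfolding N_def by (elim bexE conjE)
  have wc: "w \<in> carrier R" using w by simp
  obtain i where i: "x = w [^] (i::nat)" using gen x by blast
  let ?d = "gcd M N"
  have dN: "N = ?d * (N div ?d)" by simp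
  have d0: "N div ?d > 0" using N dN by (metis gr0I mult_0_right)
  have "x [^] (N div ?d) = \<one> \<longleftrightarrow> N dvd i * (N div ?d)"
    unfolding i using wc by (simp add: nat_pow_pow ord)
  also have "\<dots> \<longleftrightarrow> ?d * (N div ?d) dvd i * (N div ?d)" using dN by simp
  also have "\<dots> \<longleftrightarrow> ?d dvd i" using d0 dvd_times_right_cancel_iff[of "N div ?d" ?d i] by blast
  finally have R: "x [^] (N div ?d) = \<one> \<longleftrightarrow> ?d dvd i" .
  show ?thesis unfolding R
  proof
    assume "\<exists>g\<in>carrier R. g [^] M = x"
    then obtain g where g: "g \<in> carrier R" "g [^] M = x" by blast
    then have "g \<noteq> \<zero>" using x M by (auto simp: nat_pow_zero)
    then obtain j where j: "g = w [^] (j::nat)" using gen g by blast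
    have "x [^] (N div ?d) = w [^] (j * M * (N div ?d))"
      unfolding g(2)[symmetric] j using wc by (simp add: nat_pow_pow)
    moreover have "N dvd j * M * (N div ?d)"
    proof -
      have "?d * (N div ?d) dvd M * (N div ?d)" by (intro mult_dvd_mono) auto
      then show ?thesis using dN by (simp add: mult.assoc)
    qed
    ultimately show "?d dvd i" using ord R by simp
  next
    assume "?d dvd i"
    then obtain k where k: "i = ?d * k" by (rule dvdE)
    obtain y where y: "[M * y = ?d] (mod N)" using cong_solve_nat[of M N] M by auto
    have "[M * (y * k) = i] (mod N)" using cong_scalar_right[OF y, of k] k by (simp add: mult.assoc)
    have pow_cong: "w [^] a = w [^] b" if "[a = b] (mod N)" "a \<le> b" for a b :: nat
    proof -
      have "N dvd b - a" using mod_eq_dvd_iff_nat[OF that(2), of N] that(1) unfolding cong_def by metis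
      then have "w [^] (b - a) = \<one>" using ord by simp
      then have "w [^] a \<otimes> w [^] (b - a) = w [^] a" using wc by simp
      then show ?thesis using that wc by (simp add: nat_pow_mult)
    qed
    have "w [^] (M * (y * k)) = w [^] i"
      using \<open>[M * (y * k) = i] (mod N)\<close> pow_cong[of "M * (y * k)" i] pow_cong[of i "M * (y * k)"]
      by (metis cong_sym linear)
    then have "(w [^] (y * k)) [^] M = x" unfolding i using wc by (simp add: nat_pow_pow mult.commute)
    then show "\<exists>g\<in>carrier R. g [^] M = x" using wc by blast
  qed
qed

context finite_field
begin

lemma q_ge_2: "q \<ge> 2"
proof -
  have "card {\<zero>, \<one>} \<le> q" by (intro card_mono finite_carrier) auto
  then show ?thesis by simp
qed

lemma q_power:
  assumes "c \<in> carrier R" shows "c [^] (q ^ d) = c"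
proof (induction d)
  case (Suc d)
  have base: "c [^] q = c" if c: "c \<in> carrier R" for c
  proof (cases "c = \<zero>")
    case True
    then show ?thesis using q_ge_2 by (simp add: nat_pow_zero)
  next
    case False
    obtain w where w: "w \<in> carrier R - {\<zero>}" and gen: "\<forall>x\<in>carrier R - {\<zero>}. \<exists>i::nat. x = w [^] i"
      and ord: "\<forall>i::nat. w [^] i = \<one> \<longleftrightarrow> q - 1 dvd i"
      using finite_field_generator[OF finite_carrier] by (elim bexE conjE)
    obtain i where "c = w [^] (i::nat)" using bspec[OF gen, of c] False c by auto
    then have "c [^] (q - 1) = w [^] (i * (q - 1))" using w by (simp add: nat_pow_pow)
    then have "c [^] (q - 1) = \<one>" using ord by simp
    then have "c [^] Suc (q - 1) = c" using c by simp
    then show ?thesis using q_ge_2 by simp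
  qed
  have "c [^] (q ^ Suc d) = (c [^] (q ^ d)) [^] q" using assms by (simp add: nat_pow_pow mult.commute)
  then show ?case using Suc base assms by simp
qed (use assms in simp)

text \<open>The order of the additive group kills \<open>\<one>\<close>, and \<open>p ^ k\<close>
  times \<open>\<one>\<close> is the \<open>k\<close>-th power of \<open>p\<close> times
  \<open>\<one>\<close>; a field has no nonzero nilpotent elements.\<close>

lemma char_prime:
  assumes "primepow q"
  obtains p k where "Factorial_Ring.prime p" "q = p ^ k" "add_pow R p \<one> = \<zero>"
proof -
  obtain p k where p: "Factorial_Ring.prime p" "k > 0" "q = p ^ k" using assms by (auto simp: primepow_def)
  have "add_pow R q \<one> = \<zero>"
    using group.pow_order_eq_1[OF a_group, of \<one>] by (simp add: order_def add_pow_def)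
  moreover have "add_pow R (p ^ j) \<one> = add_pow R p \<one> [^] j" for j
  proof (induction j)
    case (Suc j)
    have "add_pow R (p ^ Suc j) \<one> = add_pow R (p ^ j) (add_pow R p \<one>)"
      using add.nat_pow_pow[OF one_closed, of "p ^ j" p] by (simp add: mult.commute)
    also have "\<dots> = add_pow R (p ^ j) \<one> \<otimes> add_pow R p \<one>"
      using add_pow_ldistr[of \<one> "add_pow R p \<one>" "p ^ j"] by simp
    finally show ?case using Suc by simp
  qed simp
  ultimately have pz: "add_pow R p \<one> [^] k = \<zero>" using p(3) by simp
  have "add_pow R p \<one> = \<zero>"
  proof (rule ccontr)
    assume ne: "add_pow R p \<one> \<noteq> \<zero>"
    have u: "add_pow R p \<one> \<in> carrier R" by simp
    have "add_pow R p \<one> [^] j \<noteq> \<zero>" for j :: nat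
    proof (induction j)
      case (Suc j)
      then show ?case using ne integral[OF _ nat_pow_closed[OF u] u] by auto
    qed simp
    then show False using pz by blast
  qed
  then show ?thesis using that p by blast
qed

lemma frobenius_poly_add:
  assumes q: "primepow q" and a: "a \<in> carrier P" and b: "b \<in> carrier P"
  shows "(a \<oplus>\<^bsub>P\<^esub> b) [^]\<^bsub>P\<^esub> (q ^ d) = a [^]\<^bsub>P\<^esub> (q ^ d) \<oplus>\<^bsub>P\<^esub> b [^]\<^bsub>P\<^esub> (q ^ d)"
proof -
  obtain p k where p: "Factorial_Ring.prime p" "q = p ^ k" "add_pow R p \<one> = \<zero>" using char_prime[OF q] .
  have const_hom: "poly_of_const \<in> Ring.ring_hom R P"
    using canonical_embedding_is_hom[OF carrier_is_subring] by simp
  interpret C: ring_hom_ring R P poly_of_const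
    by (intro ring_hom_ringI2 const_hom ring_axioms UP.ring_axioms)
  have "add_pow P m \<one>\<^bsub>P\<^esub> = poly_of_const (add_pow R m \<one>)" for m :: nat
    by (induction m) simp_all
  then have "add_pow P p \<one>\<^bsub>P\<^esub> = \<zero>\<^bsub>P\<^esub>" using p(3) by simp
  from UP.freshmans_dream[OF p(1) this a b, of "k * d"] show ?thesis
    using p(2) by (simp add: power_mult)
qed

text \<open>Modulo \<open>f\<close>, raising to the power \<open>q ^ d\<close> is additive and fixes
  the constants and, by assumption, \<open>X\<close>; so it fixes every polynomial. Here
  \<open>f\<close> may be reducible, because the squarefreeness argument takes the square of an
  irreducible polynomial for it.\<close>

lemma frobenius_fixed:
  assumes q: "primepow q" and f: "f \<in> carrier P" "f pdivides (X [^]\<^bsub>P\<^esub> (q ^ d) \<ominus>\<^bsub>P\<^esub> X)" and g: "g \<in> carrier P"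
  shows "f pdivides (g [^]\<^bsub>P\<^esub> (q ^ d) \<ominus>\<^bsub>P\<^esub> g)"
proof -
  let ?Q = "Rupt (carrier R) f" and ?\<pi> = "rupture_surj (carrier R) f" and ?N = "q ^ d"
  interpret h: ring_hom_cring P ?Q ?\<pi> by (rule rupture_hom[OF f(1)])
  have const_hom: "poly_of_const \<in> Ring.ring_hom R P"
    using canonical_embedding_is_hom[OF carrier_is_subring] by simp
  interpret C: ring_hom_cring R P poly_of_const
    by (intro ring_hom_cringI UP.is_cring is_cring ring_hom_ringI2 const_hom ring_axioms UP.ring_axioms)
  have X: "?\<pi> X [^]\<^bsub>?Q\<^esub> ?N = ?\<pi> X"
    using rupture_eq_iff[OF f(1), of "X [^]\<^bsub>P\<^esub> ?N" X] f(2) h.hom_nat_power[OF X_closed, of ?N] by simp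
  have mono: "?\<pi> (poly_of_const c \<otimes>\<^bsub>P\<^esub> X [^]\<^bsub>P\<^esub> (j::nat)) [^]\<^bsub>?Q\<^esub> ?N = ?\<pi> (poly_of_const c \<otimes>\<^bsub>P\<^esub> X [^]\<^bsub>P\<^esub> j)"
    if c: "c \<in> carrier R" for c j
  proof -
    have "?\<pi> (poly_of_const c) [^]\<^bsub>?Q\<^esub> ?N = ?\<pi> (poly_of_const (c [^] ?N))"
      using c by (simp add: h.hom_nat_power C.hom_nat_power)
    then have "?\<pi> (poly_of_const c) [^]\<^bsub>?Q\<^esub> ?N = ?\<pi> (poly_of_const c)" using q_power[OF c] by simp
    moreover have "(?\<pi> X [^]\<^bsub>?Q\<^esub> j) [^]\<^bsub>?Q\<^esub> ?N = (?\<pi> X [^]\<^bsub>?Q\<^esub> ?N) [^]\<^bsub>?Q\<^esub> j"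
      by (simp add: h.S.nat_pow_pow mult.commute)
    ultimately show ?thesis using c X by (simp add: h.hom_nat_power h.S.nat_pow_distrib)
  qed
  have "?\<pi> (of_coeffs n v) [^]\<^bsub>?Q\<^esub> ?N = ?\<pi> (of_coeffs n v)" if v: "\<And>j. v j \<in> carrier R" for n v
  proof (induction n)
    case 0
    have "?N \<noteq> 0" using q_ge_2 by simp
    then show ?case by (simp add: of_coeffs_def h.S.nat_pow_zero)
  next
    case (Suc n)
    let ?m = "poly_of_const (v n) \<otimes>\<^bsub>P\<^esub> X [^]\<^bsub>P\<^esub> n"
    have m: "?m \<in> carrier P" using v by simp
    have ocl: "of_coeffs n v \<in> carrier P" using v by simp
    have eq: "of_coeffs (Suc n) v = ?m \<oplus>\<^bsub>P\<^esub> of_coeffs n v"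
      unfolding of_coeffs_def lessThan_Suc using v by (intro UP.finsum_insert) auto
    have "?\<pi> (of_coeffs (Suc n) v) [^]\<^bsub>?Q\<^esub> ?N = ?\<pi> ((?m \<oplus>\<^bsub>P\<^esub> of_coeffs n v) [^]\<^bsub>P\<^esub> ?N)"
      unfolding eq using m ocl by (intro h.hom_nat_power[symmetric]) simp
    also have "\<dots> = ?\<pi> (?m [^]\<^bsub>P\<^esub> ?N) \<oplus>\<^bsub>?Q\<^esub> ?\<pi> (of_coeffs n v [^]\<^bsub>P\<^esub> ?N)"
      unfolding frobenius_poly_add[OF q m ocl] using m ocl by (intro h.hom_add) simp_all
    also have "\<dots> = ?\<pi> ?m \<oplus>\<^bsub>?Q\<^esub> ?\<pi> (of_coeffs n v)"
      using mono[OF v] Suc m ocl by (simp only: h.hom_nat_power)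
    also have "\<dots> = ?\<pi> (of_coeffs (Suc n) v)" unfolding eq using m ocl by (intro h.hom_add[symmetric])
    finally show ?case .
  qed
  from this[of "coeff g" "length g"] have "?\<pi> g [^]\<^bsub>?Q\<^esub> ?N = ?\<pi> g"
    using of_coeffs_coeff[OF g] g by simp
  then show ?thesis
    using rupture_eq_iff[OF f(1), of "g [^]\<^bsub>P\<^esub> ?N" g] g h.hom_nat_power[OF g, of ?N] by simp
qed

section \<open>Irreducible factors of X^m - 1\<close>

definition X_pow_minus_1 :: "nat \<Rightarrow> 'a list" where
  "X_pow_minus_1 m = X [^]\<^bsub>P\<^esub> m \<ominus>\<^bsub>P\<^esub> \<one>\<^bsub>P\<^esub>"

lemma X_pow_minus_1_monic:
  assumes "m \<ge> 1" shows "X_pow_minus_1 m \<in> monics m"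
proof -
  have c1: "coeff \<one>\<^bsub>P\<^esub> i = (if i = 0 then \<one> else \<zero>)" for i
    by (simp add: univ_poly_one)
  have cX: "coeff (X [^]\<^bsub>P\<^esub> m) i = (if i = m then \<one> else \<zero>)" for i
    using coeff_const_X_pow[OF one_closed, of m i]
    by (simp add: poly_of_const_def univ_poly_one[symmetric, of R "carrier R"])
  let ?v = "\<lambda>i. if i = m then \<one> else if i = 0 then \<ominus> \<one> else \<zero>"
  have cl: "X_pow_minus_1 m \<in> carrier P" by (simp add: X_pow_minus_1_def)
  have add: "X_pow_minus_1 m \<oplus>\<^bsub>P\<^esub> \<one>\<^bsub>P\<^esub> = X [^]\<^bsub>P\<^esub> m"
    unfolding X_pow_minus_1_def UP.minus_eq by (simp add: UP.a_assoc UP.l_neg)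
  have co: "coeff (X_pow_minus_1 m) i = ?v i" for i
  proof -
    have "coeff (X_pow_minus_1 m) i \<oplus> coeff \<one>\<^bsub>P\<^esub> i = coeff (X [^]\<^bsub>P\<^esub> m) i"
      unfolding add[symmetric] using cl by (simp only: coeff_add UP.one_closed)
    then have *: "coeff (X_pow_minus_1 m) i \<oplus> (if i = 0 then \<one> else \<zero>) = (if i = m then \<one> else \<zero>)"
      unfolding c1 cX .
    have cc: "coeff (X_pow_minus_1 m) i \<in> carrier R" using cl by simp
    show ?thesis
    proof (cases "i = 0")
      case True
      then have "coeff (X_pow_minus_1 m) i \<oplus> \<one> = \<zero>" using * assms by simp
      then show ?thesis using True assms cc minus_equality[of "coeff (X_pow_minus_1 m) i" \<one>] by simp
    qed (use * cc in auto)
  qed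
  have "length (X_pow_minus_1 m) \<le> Suc m" using length_le_iff_coeff[OF cl] co assms by simp
  moreover have "\<not> length (X_pow_minus_1 m) \<le> m" using length_le_iff_coeff[OF cl, of m] co[of m] by auto
  ultimately have len: "length (X_pow_minus_1 m) = Suc m" by linarith
  then have ne: "X_pow_minus_1 m \<noteq> []" by auto
  show ?thesis
    using lead_coeff_simp[OF ne] len co[of m] cl by (intro monicsI) simp_all
qed

lemma X_pow_minus_1_rupture:
  assumes "f \<in> carrier P"
  shows "f pdivides X_pow_minus_1 m \<longleftrightarrow>
    rupture_surj (carrier R) f X [^]\<^bsub>Rupt (carrier R) f\<^esub> m = \<one>\<^bsub>Rupt (carrier R) f\<^esub>"
proof -
  interpret h: ring_hom_cring P "Rupt (carrier R) f" "rupture_surj (carrier R) f" by (rule rupture_hom[OF assms])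
  show ?thesis unfolding X_pow_minus_1_def
    using rupture_eq_iff[OF assms, of "X [^]\<^bsub>P\<^esub> m" "\<one>\<^bsub>P\<^esub>"] h.hom_nat_power[OF X_closed, of m] by simp
qed

lemma X_pow_minus_1_divides_frobenius:
  assumes f: "f \<in> carrier P" "f pdivides X_pow_minus_1 m" and m: "m dvd q ^ d - 1"
  shows "f pdivides (X [^]\<^bsub>P\<^esub> (q ^ d) \<ominus>\<^bsub>P\<^esub> X)"
proof -
  let ?Q = "Rupt (carrier R) f" and ?x = "rupture_surj (carrier R) f X"
  interpret h: ring_hom_cring P ?Q "rupture_surj (carrier R) f" by (rule rupture_hom[OF f(1)])
  have x: "?x [^]\<^bsub>?Q\<^esub> m = \<one>\<^bsub>?Q\<^esub>" using f X_pow_minus_1_rupture by blast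
  obtain k where k: "q ^ d - 1 = m * k" using m by (rule dvdE)
  have "?x [^]\<^bsub>?Q\<^esub> (q ^ d - 1) = (?x [^]\<^bsub>?Q\<^esub> m) [^]\<^bsub>?Q\<^esub> k" unfolding k by (simp add: h.S.nat_pow_pow)
  then have "?x [^]\<^bsub>?Q\<^esub> Suc (q ^ d - 1) = ?x" using x by simp
  moreover have "Suc (q ^ d - 1) = q ^ d" using q_ge_2 by simp
  ultimately have "?x [^]\<^bsub>?Q\<^esub> (q ^ d) = ?x" by metis
  then show ?thesis using rupture_eq_iff[OF f(1), of "X [^]\<^bsub>P\<^esub> (q ^ d)" X] h.hom_nat_power[OF X_closed, of "q ^ d"] by simp
qed

text \<open>
  If \<open>p\<^sup>2\<close> divided the polynomial, every class modulo \<open>p\<^sup>2\<close> would be fixed by the Frobenius power,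
  but the class of \<open>p\<close> is nilpotent and nonzero.
\<close>

lemma X_pow_minus_1_sqf:
  assumes q: "primepow q" and m: "m dvd q ^ d - 1" and d: "d \<ge> 1"
  shows "sqf (X_pow_minus_1 m)"
  unfolding sqf_def
proof (intro allI ballI notI)
  fix e p assume p: "p \<in> irr e" and div: "(p \<otimes>\<^bsub>P\<^esub> p) pdivides X_pow_minus_1 m"
  have pc: "p \<in> carrier P" using irr_closed[OF p] .
  have pp: "p \<otimes>\<^bsub>P\<^esub> p \<in> carrier P" using pc by simp
  have "(p \<otimes>\<^bsub>P\<^esub> p) pdivides (p [^]\<^bsub>P\<^esub> (q ^ d) \<ominus>\<^bsub>P\<^esub> p)"
    by (intro frobenius_fixed[OF q pp _ pc] X_pow_minus_1_divides_frobenius[OF pp div m])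
  then have eq: "rupture_surj (carrier R) (p \<otimes>\<^bsub>P\<^esub> p) (p [^]\<^bsub>P\<^esub> (q ^ d)) = rupture_surj (carrier R) (p \<otimes>\<^bsub>P\<^esub> p) p"
    using rupture_eq_iff[OF pp, of "p [^]\<^bsub>P\<^esub> (q ^ d)" p] pc by simp
  have "q ^ 1 \<le> q ^ d" using d q_ge_2 by (intro power_increasing) auto
  then have "q ^ d = Suc (Suc (q ^ d - 2))" using q_ge_2 by simp
  then have "p [^]\<^bsub>P\<^esub> (q ^ d) = (p \<otimes>\<^bsub>P\<^esub> p) \<otimes>\<^bsub>P\<^esub> p [^]\<^bsub>P\<^esub> (q ^ d - 2)"
    using pc UP.nat_pow_Suc2[of p] by (metis UP.m_assoc UP.nat_pow_Suc2 UP.nat_pow_closed)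
  then have "(p \<otimes>\<^bsub>P\<^esub> p) pdivides (p [^]\<^bsub>P\<^esub> (q ^ d))" using pc by (intro pdividesI) auto
  then have "rupture_surj (carrier R) (p \<otimes>\<^bsub>P\<^esub> p) p = \<zero>\<^bsub>Rupt (carrier R) (p \<otimes>\<^bsub>P\<^esub> p)\<^esub>"
    using eq rupture_zero_iff[OF pp, of "p [^]\<^bsub>P\<^esub> (q ^ d)"] pc by simp
  then have "(p \<otimes>\<^bsub>P\<^esub> p) pdivides p" using rupture_zero_iff[OF pp pc] by simp
  then obtain c where c: "c \<in> carrier P" "p = p \<otimes>\<^bsub>P\<^esub> p \<otimes>\<^bsub>P\<^esub> c" by (rule pdividesE)
  have "p \<otimes>\<^bsub>P\<^esub> p \<otimes>\<^bsub>P\<^esub> c \<in> monics e" unfolding c(2)[symmetric] by (rule irr_monic[OF p])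
  from monics_cofactor(1)[OF monics_mult[OF irr_monic[OF p] irr_monic[OF p]] this c(1)]
  show False using irr_degree_pos[OF p] by simp
qed

text \<open>The quotient by \<open>p\<close> is a field with \<open>q ^ e\<close> elements on which
  raising to the power \<open>q ^ d\<close> is the identity. Applied to a generator of the
  multiplicative group, this says that \<open>q ^ e - 1\<close> divides
  \<open>q ^ d - 1\<close>.\<close>

lemma X_pow_minus_1_divisor_degree:
  assumes q: "primepow q" and m: "m dvd q ^ d - 1" and d: "d \<ge> 1"
    and p: "p \<in> irr e" "p pdivides X_pow_minus_1 m"
  shows "e \<le> d"
proof -
  have pc: "p \<in> carrier P" using irr_closed[OF p(1)] .
  let ?Q = "Rupt (carrier R) p" and ?\<pi> = "rupture_surj (carrier R) p"
  interpret h: ring_hom_cring P ?Q ?\<pi> by (rule rupture_hom[OF pc])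
  interpret Q: field ?Q by (rule rupture_field[OF p(1)])
  have card: "card (carrier ?Q) = q ^ e" "finite (carrier ?Q)"
    using card_rupture[OF pc monics_degree[OF irr_monic[OF p(1)]]] by blast+
  obtain w where w: "w \<in> carrier ?Q - {\<zero>\<^bsub>?Q\<^esub>}"
    and ord: "\<forall>i::nat. w [^]\<^bsub>?Q\<^esub> i = \<one>\<^bsub>?Q\<^esub> \<longleftrightarrow> card (carrier ?Q) - 1 dvd i"
    using Q.finite_field_generator[OF card(2)] by (elim bexE conjE)
  obtain g where g: "g \<in> carrier P" "w = ?\<pi> g" using rupture_surj[OF pc, of w] w by blast
  have "p pdivides (g [^]\<^bsub>P\<^esub> (q ^ d) \<ominus>\<^bsub>P\<^esub> g)"
    by (intro frobenius_fixed[OF q pc _ g(1)] X_pow_minus_1_divides_frobenius[OF pc p(2) m])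
  then have "w [^]\<^bsub>?Q\<^esub> (q ^ d) = w"
    using rupture_eq_iff[OF pc, of "g [^]\<^bsub>P\<^esub> (q ^ d)" g] g h.hom_nat_power[OF g(1)] by simp
  moreover have "q ^ d = Suc (q ^ d - 1)" using q_ge_2 by simp
  ultimately have "w [^]\<^bsub>?Q\<^esub> Suc (q ^ d - 1) = w" by metis
  then have "w [^]\<^bsub>?Q\<^esub> (q ^ d - 1) \<otimes>\<^bsub>?Q\<^esub> w = \<one>\<^bsub>?Q\<^esub> \<otimes>\<^bsub>?Q\<^esub> w" using w by simp
  then have "w [^]\<^bsub>?Q\<^esub> (q ^ d - 1) = \<one>\<^bsub>?Q\<^esub>"
    using w Q.m_rcancel[of w "w [^]\<^bsub>?Q\<^esub> (q ^ d - 1)" "\<one>\<^bsub>?Q\<^esub>"] by auto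
  then have "q ^ e - 1 dvd q ^ d - 1" using ord card by simp
  moreover have "q ^ 1 \<le> q ^ d" using d q_ge_2 by (intro power_increasing) auto
  then have "q ^ d - 1 > 0" using q_ge_2 by simp
  ultimately have "q ^ e - 1 \<le> q ^ d - 1" by (rule dvd_imp_le)
  then have "q ^ e \<le> q ^ d" using \<open>q ^ d - 1 > 0\<close> by linarith
  then show ?thesis using q_ge_2 by (simp add: power_increasing_iff)
qed

lemma X_irr: "X \<in> irr 1"
proof -
  have "X \<in> monics 1" by (intro monicsI X_closed) (simp_all add: var_def)
  moreover have "pirreducible (carrier R) X"
    by (rule degree_one_imp_pirreducible[OF carrier_is_subfield X_closed]) (simp add: var_def)
  ultimately show ?thesis by (simp add: irr_def)
qed

lemma coeff_0_eq_0_iff: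
  assumes f: "f \<in> monics n" shows "coeff f 0 = \<zero> \<longleftrightarrow> X pdivides f"
proof
  assume "X pdivides f"
  then obtain c where c: "c \<in> carrier P" "f = X \<otimes>\<^bsub>P\<^esub> c" by (rule pdividesE)
  have "coeff X 0 = \<zero>" by (simp add: var_def)
  then show "coeff f 0 = \<zero>" unfolding c using c(1) by (simp add: coeff_0_mult)
next
  assume z: "coeff f 0 = \<zero>"
  have fc: "f \<in> carrier P" and ne: "f \<noteq> []" using monics_closed[OF f] monics_not_Nil[OF f] .
  \<comment> \<open>Lists start with the leading coefficient, so the constant term is the last
    entry, and removing a zero there divides by \<open>X\<close>.\<close>
  have last: "last f = \<zero>"
    using z coeff_nth[of 0 f] ne by (simp add: last_conv_nth)
  then have f_eq: "f = butlast f @ [\<zero>]" using ne append_butlast_last_id by metis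
  have bne: "butlast f \<noteq> []"
  proof
    assume "butlast f = []"
    then have "f = [\<zero>]" using f_eq by simp
    then show False using monics_lead[OF f] by simp
  qed
  have "hd (butlast f) = \<one>" using f_eq bne monics_lead[OF f] by (metis hd_append2)
  then have b: "butlast f \<in> carrier P"
    using poly_set[OF fc] by (auto simp: univ_poly_carrier[symmetric] polynomial_def dest: in_set_butlastD)
  have "butlast f \<otimes>\<^bsub>P\<^esub> X = f" using poly_mult_var[OF carrier_is_subring b] bne f_eq by simp
  then show "X pdivides f" using b by (intro pdividesI[of "butlast f"]) (auto simp: UP.m_comm)
qed

text \<open>Euler's criterion for the class of \<open>X\<close> in the field with
  \<open>q ^ d\<close> elements. The criterion needs a nonzero class, so \<open>p = X\<close> is a
  separate case, in which both sides are false.\<close>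

lemma power_poly_irr_iff:
  assumes p: "p \<in> irr d" and M: "M \<ge> 1"
  shows "power_poly M p \<longleftrightarrow> p pdivides X_pow_minus_1 ((q ^ d - 1) div gcd M (q ^ d - 1))"
proof -
  have pc: "p \<in> carrier P" using irr_closed[OF p] .
  have d: "d \<ge> 1" using irr_degree_pos[OF p] .
  let ?Q = "Rupt (carrier R) p" and ?\<pi> = "rupture_surj (carrier R) p"
  let ?m = "(q ^ d - 1) div gcd M (q ^ d - 1)"
  interpret h: ring_hom_cring P ?Q ?\<pi> by (rule rupture_hom[OF pc])
  interpret Q: field ?Q by (rule rupture_field[OF p])
  have card: "card (carrier ?Q) = q ^ d" "finite (carrier ?Q)"
    using card_rupture[OF pc monics_degree[OF irr_monic[OF p]]] by blast+
  have "q ^ 1 \<le> q ^ d" using d q_ge_2 by (intro power_increasing) auto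
  then have "q ^ d - 1 > 0" using q_ge_2 by simp
  then have "gcd M (q ^ d - 1) \<le> q ^ d - 1" "gcd M (q ^ d - 1) > 0"
    by (intro gcd_le2_nat, simp, metis gcd_pos_nat less_irrefl)
  then have m: "?m > 0" unfolding div_greater_zero_iff by blast
  have div_iff: "p pdivides X \<longleftrightarrow> X pdivides p"
    using irr_divides_irr[OF p X_irr] irr_divides_irr[OF X_irr p] pdivides_refl by auto
  show ?thesis
  proof (cases "p pdivides X")
    case True
    then have "coeff p 0 = \<zero>" using div_iff coeff_0_eq_0_iff[OF irr_monic[OF p]] by blast
    moreover have "?\<pi> X = \<zero>\<^bsub>?Q\<^esub>" using True rupture_zero_iff[OF pc X_closed] by blast
    then have "\<not> p pdivides X_pow_minus_1 ?m"
      unfolding X_pow_minus_1_rupture[OF pc] using m by (simp add: h.S.nat_pow_zero)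
    ultimately show ?thesis by (simp add: power_poly_def)
  next
    case False
    then have "coeff p 0 \<noteq> \<zero>" using div_iff coeff_0_eq_0_iff[OF irr_monic[OF p]] by blast
    moreover have "?\<pi> X \<noteq> \<zero>\<^bsub>?Q\<^esub>" using False rupture_zero_iff[OF pc X_closed] by blast
    then have "(\<exists>g\<in>carrier ?Q. g [^]\<^bsub>?Q\<^esub> M = ?\<pi> X) \<longleftrightarrow> ?\<pi> X [^]\<^bsub>?Q\<^esub> ?m = \<one>\<^bsub>?Q\<^esub>"
      using Q.power_residue_iff[OF card(2) h.hom_closed[OF X_closed] _ M] card(1) by simp
    ultimately show ?thesis
      unfolding power_poly_def power_poly_rupture[OF pc] X_pow_minus_1_rupture[OF pc] by blast
  qed
qed

text \<open>The degrees of the irreducible factors of X^m - 1 add up to \<open>m\<close>. None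
  exceeds \<open>d\<close>, those of degree \<open>d\<close> are exactly
  \<open>irr_powers M d\<close>, and the smaller ones are bounded by counting all monic
  polynomials.\<close>

lemma card_irr_powers_bounds:
  assumes q: "primepow q" and M: "M \<ge> 1" and d: "d \<ge> 1"
  defines "m \<equiv> (q ^ d - 1) div gcd M (q ^ d - 1)"
  shows "d * card (irr_powers M d) \<le> m"
    and "m \<le> d * card (irr_powers M d) + (\<Sum>e<d. e * q ^ e)"
proof -
  let ?T = "X_pow_minus_1 m"
  have "q ^ 1 \<le> q ^ d" using d q_ge_2 by (intro power_increasing) auto
  then have pos: "q ^ d - 1 > 0" using q_ge_2 by simp
  have mdvd: "m dvd q ^ d - 1" unfolding m_def by (metis dvd_triv_right dvd_div_mult_self gcd_dvd2 dvd_triv_left)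
  then have m: "m \<ge> 1" using pos by (metis Suc_leI dvd_0_left_iff gr0I One_nat_def)
  have T: "?T \<in> monics m" using m by (rule X_pow_minus_1_monic)
  have sum: "(\<Sum>p\<in>irr_divs ?T. length p - 1) = m"
    by (intro sum_irr_divs T X_pow_minus_1_sqf[OF q mdvd d])
  have split: "irr_divs ?T = irr_powers M d \<union> (irr_divs ?T \<inter> (\<Union>e<d. irr e))"
  proof (intro equalityI subsetI)
    fix p assume p: "p \<in> irr_divs ?T"
    then obtain e where e: "p \<in> irr e" "p pdivides ?T" unfolding irr_divs_def by blast
    then have "e \<le> d" using X_pow_minus_1_divisor_degree[OF q mdvd d] by blast
    then show "p \<in> irr_powers M d \<union> (irr_divs ?T \<inter> (\<Union>e<d. irr e))"
    proof (cases "e = d")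
      case True
      then show ?thesis using e power_poly_irr_iff[of p d M] M unfolding irr_powers_def m_def by blast
    next
      case False
      then show ?thesis using e p \<open>e \<le> d\<close> by auto
    qed
  next
    fix p assume "p \<in> irr_powers M d \<union> (irr_divs ?T \<inter> (\<Union>e<d. irr e))"
    then show "p \<in> irr_divs ?T"
      using power_poly_irr_iff[of p d M] M unfolding irr_powers_def irr_divs_def m_def by blast
  qed
  have irr_inj: "e = e'" if "p \<in> irr e" "p \<in> irr e'" for p e e'
    using irr_length[OF that(1)] irr_length[OF that(2)] by simp
  have disj: "irr_powers M d \<inter> (irr_divs ?T \<inter> (\<Union>e<d. irr e)) = {}"
    unfolding irr_powers_def by (auto dest: irr_inj)
  have fin: "finite (irr_divs ?T)" using T by (rule finite_irr_divs)
  have "m = (\<Sum>p\<in>irr_powers M d. length p - 1) + (\<Sum>p\<in>irr_divs ?T \<inter> (\<Union>e<d. irr e). length p - 1)"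
    using sum split disj fin finite_irr_powers[of M d] sum.union_disjoint[of "irr_powers M d" "irr_divs ?T \<inter> (\<Union>e<d. irr e)" "\<lambda>p. length p - 1"]
    by simp
  also have "(\<Sum>p\<in>irr_powers M d. length p - 1) = (\<Sum>p\<in>irr_powers M d. d)"
    by (intro sum.cong refl irr_length[of _ d]) (simp add: irr_powers_def)
  finally have eq: "m = d * card (irr_powers M d) + (\<Sum>p\<in>irr_divs ?T \<inter> (\<Union>e<d. irr e). length p - 1)"
    by (simp add: mult.commute)
  then show "d * card (irr_powers M d) \<le> m" by linarith
  have fin_irr: "finite (irr e)" for e unfolding irr_def using finite_monics[of e] by simp
  have "(\<Sum>p\<in>irr_divs ?T \<inter> (\<Union>e<d. irr e). length p - 1) \<le> (\<Sum>p\<in>(\<Union>e<d. irr e). length p - 1)"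
    using fin_irr by (intro sum_mono2) auto
  also have "\<dots> \<le> (\<Sum>e<d. \<Sum>p\<in>irr e. length p - 1)"
  proof -
    have "irr e \<inter> irr e' = {}" if "e \<noteq> e'" for e e' using that by (auto dest: irr_inj)
    then show ?thesis using fin_irr by (subst sum.UNION_disjoint) auto
  qed
  also have "\<dots> = (\<Sum>e<d. \<Sum>p\<in>irr e. e)" by (intro sum.cong refl irr_length)
  also have "\<dots> = (\<Sum>e<d. e * card (irr e))" by (simp add: mult.commute)
  also have "\<dots> \<le> (\<Sum>e<d. e * q ^ e)"
  proof (intro sum_mono mult_left_mono)
    fix e
    have "card (irr e) \<le> card (monics e)" unfolding irr_def by (intro card_mono finite_monics) auto
    then show "card (irr e) \<le> q ^ e" by (simp add: card_monics)
  qed simp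
  finally show "m \<le> d * card (irr_powers M d) + (\<Sum>e<d. e * q ^ e)" using eq by linarith
qed

end

section \<open>The limit\<close>

context finite_field
begin

definition sqf_density :: "nat \<Rightarrow> nat \<Rightarrow> real" where
  "sqf_density M n = real (card (sqf_powers M n)) / real q ^ n"

lemma sqf_density_bounds: "0 \<le> sqf_density M n" "sqf_density M n \<le> 1"
proof -
  have "card (sqf_powers M n) \<le> card (monics n)"
    unfolding sqf_powers_def by (intro card_mono finite_monics) auto
  then have "real (card (sqf_powers M n)) \<le> real q ^ n"
    by (simp only: card_monics of_nat_power[symmetric] of_nat_le_iff)
  moreover have "real q ^ n > 0" using q_ge_2 by simp
  ultimately show "0 \<le> sqf_density M n" "sqf_density M n \<le> 1"
    by (simp_all add: sqf_density_def)
qed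

text \<open>The degree \<open>m\<close> of X^m - 1 differs from \<open>c * q ^ i\<close> by
  \<open>c \<le> 1\<close>, and factors of lower degree take at most
  \<open>i^2 * q ^ (i - 1)\<close> of it. Relative to \<open>q ^ i\<close> this is the error
  \<open>(1 + i^2) / q\<close>.\<close>

lemma irr_powers_density:
  assumes q: "primepow q" and M: "M \<ge> 1" and i: "i \<ge> 1"
  defines "a \<equiv> real (i * card (irr_powers M i))" and "c \<equiv> 1 / real (gcd M (q ^ i - 1))"
  shows "a \<le> real q ^ i" "\<bar>a / real q ^ i - c\<bar> \<le> (1 + real i ^ 2) / real q"
proof -
  let ?g = "gcd M (q ^ i - 1)" and ?m = "(q ^ i - 1) div gcd M (q ^ i - 1)"
  have q1: "real q \<ge> 1" using q_ge_2 by simp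
  have Q: "real q ^ i > 0" using q1 by simp
  have g: "?g \<ge> 1" using M by (simp add: Suc_leI)
  then have "real 1 \<le> real ?g" by (rule of_nat_mono)
  then have gr: "1 \<le> real ?g" unfolding of_nat_1 .
  moreover have "0 < 1 / x" "1 / x \<le> 1" if "x \<ge> 1" for x :: real using that by auto
  ultimately have c: "0 < c" "c \<le> 1" unfolding c_def by blast+
  have "real ?m * real ?g = real (q ^ i - 1)"
    by (metis dvd_div_mult_self gcd_dvd2 of_nat_mult)
  also have "\<dots> = real q ^ i - 1" using q_ge_2 by (simp add: of_nat_diff)
  finally have mg: "real ?m * real ?g = real q ^ i - 1" .
  have "y = 1 / x * z" if "y * x = z" "1 \<le> x" for x y z :: real using that by (auto simp: field_simps)
  from this[OF mg gr] have m: "real ?m = c * (real q ^ i - 1)" unfolding c_def .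
  have up: "a \<le> real ?m" unfolding a_def of_nat_le_iff by (rule card_irr_powers_bounds(1)[OF q M i])
  have "real ?m \<le> a + real (\<Sum>e<i. e * q ^ e)"
    unfolding a_def of_nat_add[symmetric] of_nat_le_iff by (rule card_irr_powers_bounds(2)[OF q M i])
  moreover have "real (\<Sum>e<i. e * q ^ e) \<le> real i ^ 2 * real q ^ (i - 1)"
  proof -
    have "(\<Sum>e<i. e * q ^ e) \<le> (\<Sum>e<i. i * q ^ (i - 1))"
      using q_ge_2 by (intro sum_mono mult_mono power_increasing) auto
    then have "(\<Sum>e<i. e * q ^ e) \<le> i * i * q ^ (i - 1)" by (simp add: mult.assoc)
    then have "real (\<Sum>e<i. e * q ^ e) \<le> real (i * i * q ^ (i - 1))" by (simp only: of_nat_le_iff)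
    then show ?thesis by (simp add: power2_eq_square)
  qed
  ultimately have lo: "c * (real q ^ i - 1) \<le> a + real i ^ 2 * real q ^ (i - 1)" using m by linarith
  have cQ: "c * real q ^ i \<le> real q ^ i" using c Q by simp
  show "a \<le> real q ^ i" using up m c cQ by (simp add: algebra_simps)
  have qi: "real q ^ i = real q * real q ^ (i - 1)" using i by (cases i) auto
  have pw: "real q ^ (i - 1) \<ge> 1" using q1 by simp
  have "a / real q ^ i - c = (a - c * real q ^ i) / real q ^ i" using Q by (simp add: field_simps)
  moreover have "\<bar>a - c * real q ^ i\<bar> \<le> (1 + real i ^ 2) * real q ^ (i - 1)"
  proof -
    have "a - c * real q ^ i \<le> 0" using up m c by (simp add: algebra_simps)
    moreover have "c * real q ^ i - a \<le> c + real i ^ 2 * real q ^ (i - 1)" using lo by (simp add: algebra_simps)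
    ultimately show ?thesis using c pw by (simp add: algebra_simps)
  qed
  ultimately have "\<bar>a / real q ^ i - c\<bar> \<le> (1 + real i ^ 2) * real q ^ (i - 1) / real q ^ i"
    using Q by (simp add: divide_right_mono)
  also have "\<dots> = (1 + real i ^ 2) / real q" unfolding qi using pw by simp
  finally show "\<bar>a / real q ^ i - c\<bar> \<le> (1 + real i ^ 2) / real q" .
qed

text \<open>The error \<open>2 + i^2\<close> has two sources: \<open>1 + i^2\<close> from replacing
  the density of irreducibles by its limit, and 1 from cofactors divisible by the marked
  factor.\<close>

lemma sqf_density_recursion:
  assumes q: "primepow q" and M: "M \<ge> 1"
  shows "\<bar>real n * sqf_density M n - (\<Sum>i=1..n. 1 / real (gcd M (q ^ i - 1)) * sqf_density M (n - i))\<bar>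
    \<le> (\<Sum>i=1..n. 2 + real i ^ 2) / real q"
proof -
  define t where "t = (\<lambda>i. \<Sum>p\<in>irr_powers M i. i * card {h \<in> sqf_powers M (n - i). \<not> p pdivides h})"
  have q1: "real q \<ge> 1" using q_ge_2 by simp
  have each: "\<bar>real (t i) / real q ^ n - 1 / real (gcd M (q ^ i - 1)) * sqf_density M (n - i)\<bar>
     \<le> (2 + real i ^ 2) / real q" if i: "i \<in> {1..n}" for i
  proof -
    have i1: "i \<ge> 1" "i \<le> n" using i by auto
    let ?c = "1 / real (gcd M (q ^ i - 1))"
    define a where "a = real (i * card (irr_powers M i))"
    let ?s = "card (sqf_powers M (n - i))"
    have a: "a \<le> real q ^ i" "\<bar>a / real q ^ i - ?c\<bar> \<le> (1 + real i ^ 2) / real q"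
      using irr_powers_density[OF q M i1(1)] by (simp_all add: a_def)
    have a0: "a \<ge> 0" by (simp add: a_def)
    have cnt: "?s \<le> card {h \<in> sqf_powers M (n - i). \<not> p pdivides h} + (if i \<le> n - i then q ^ (n - i - i) else 0)"
      "card {h \<in> sqf_powers M (n - i). \<not> p pdivides h} \<le> ?s" if "p \<in> irr_powers M i" for p
    proof -
      have p: "p \<in> monics i" using that irr_monic by (auto simp: irr_powers_def)
      have "?s = card ({h \<in> sqf_powers M (n - i). \<not> p pdivides h} \<union> {h \<in> sqf_powers M (n - i). p pdivides h})"
        by (rule arg_cong[where f = card]) auto
      also have "\<dots> \<le> card {h \<in> sqf_powers M (n - i). \<not> p pdivides h} + card {h \<in> sqf_powers M (n - i). p pdivides h}"
        by (rule card_Un_le)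
      finally show "?s \<le> card {h \<in> sqf_powers M (n - i). \<not> p pdivides h} + (if i \<le> n - i then q ^ (n - i - i) else 0)"
        using card_multiples_le[OF p, of M "n - i"] by linarith
      show "card {h \<in> sqf_powers M (n - i). \<not> p pdivides h} \<le> ?s"
        by (intro card_mono finite_sqf_powers) auto
    qed
    have mult: "(if i \<le> n - i then q ^ (n - i - i) else 0) \<le> q ^ (n - i - i)" by simp
    have up: "t i \<le> i * card (irr_powers M i) * ?s"
    proof -
      have "t i \<le> (\<Sum>p\<in>irr_powers M i. i * ?s)"
        unfolding t_def using cnt(2) by (intro sum_mono mult_left_mono) auto
      then show ?thesis by (simp add: mult_ac)
    qed
    have lo: "i * card (irr_powers M i) * ?s \<le> t i + i * card (irr_powers M i) * (if i \<le> n - i then q ^ (n - i - i) else 0)"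
    proof -
      have "(\<Sum>p\<in>irr_powers M i. i * ?s) \<le>
         (\<Sum>p\<in>irr_powers M i. i * card {h \<in> sqf_powers M (n - i). \<not> p pdivides h} + i * (if i \<le> n - i then q ^ (n - i - i) else 0))"
        unfolding add_mult_distrib2[symmetric] using cnt(1) by (intro sum_mono mult_left_mono) auto
      then show ?thesis by (simp add: t_def sum.distrib mult_ac split: if_splits)
    qed
    have qn: "real q ^ n = real q ^ i * real q ^ (n - i)" using i1 by (simp add: power_add[symmetric])
    have pos: "real q ^ i > 0" "real q ^ (n - i) > 0" "real q ^ n > 0" using q1 by simp_all
    have up': "real (t i) \<le> a * real ?s"
      unfolding a_def of_nat_mult[symmetric] of_nat_le_iff by (rule up)
    have "a * real ?s \<le> real (t i) + a * real (if i \<le> n - i then q ^ (n - i - i) else 0)"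
      unfolding a_def of_nat_mult[symmetric] of_nat_add[symmetric] of_nat_le_iff by (rule lo)
    \<comment> \<open>The loss is at most \<open>q ^ i\<close> times \<open>q ^ (n - 2 * i)\<close>,
      and \<open>i \<ge> 1\<close>.\<close>
    also have "a * real (if i \<le> n - i then q ^ (n - i - i) else 0) \<le> real q ^ (n - 1)"
    proof (cases "i \<le> n - i")
      case True
      have "a * real (q ^ (n - i - i)) \<le> real q ^ i * real q ^ (n - i - i)"
        using a a0 q1 by (simp add: mult_right_mono)
      also have "\<dots> = real q ^ (n - i)" using True by (simp add: power_add[symmetric])
      also have "\<dots> \<le> real q ^ (n - 1)" using i1 q1 by (intro power_increasing) auto
      finally show ?thesis using True by simp
    qed (use q1 in simp)
    finally have lo': "a * real ?s \<le> real (t i) + real q ^ (n - 1)" by simp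
    have "\<bar>real (t i) - a * real ?s\<bar> \<le> real q ^ (n - 1)" using up' lo' by simp
    then have "\<bar>(real (t i) - a * real ?s) / real q ^ n\<bar> \<le> real q ^ (n - 1) / real q ^ n"
      using pos by (simp add: divide_right_mono)
    also have "real q ^ (n - 1) / real q ^ n = 1 / real q"
      using i1 q1 by (cases n) auto
    finally have 1: "\<bar>real (t i) / real q ^ n - a / real q ^ i * sqf_density M (n - i)\<bar> \<le> 1 / real q"
      using pos unfolding sqf_density_def qn by (simp add: diff_divide_distrib)
    have "\<bar>a / real q ^ i * sqf_density M (n - i) - ?c * sqf_density M (n - i)\<bar> =
       \<bar>a / real q ^ i - ?c\<bar> * sqf_density M (n - i)"
      using sqf_density_bounds(1)[of M "n - i"] by (simp only: left_diff_distrib[symmetric] abs_mult abs_of_nonneg)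
    also have "\<dots> \<le> (1 + real i ^ 2) / real q * 1"
      using a sqf_density_bounds[of M "n - i"] by (intro mult_mono) auto
    finally have 2: "\<bar>a / real q ^ i * sqf_density M (n - i) - ?c * sqf_density M (n - i)\<bar> \<le> (1 + real i ^ 2) / real q" by simp
    have "1 / real q + (1 + real i ^ 2) / real q = (2 + real i ^ 2) / real q" by (simp add: add_divide_distrib[symmetric])
    then show ?thesis using 1 2 by linarith
  qed
  have "real n * sqf_density M n = (\<Sum>i=1..n. real (t i) / real q ^ n)"
  proof -
    have "real (n * card (sqf_powers M n)) = real (\<Sum>i=1..n. t i)" unfolding sqf_powers_recursion t_def ..
    then show ?thesis by (simp add: sqf_density_def sum_divide_distrib[symmetric])
  qed
  then have "\<bar>real n * sqf_density M n - (\<Sum>i=1..n. 1 / real (gcd M (q ^ i - 1)) * sqf_density M (n - i))\<bar>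
     \<le> (\<Sum>i=1..n. \<bar>real (t i) / real q ^ n - 1 / real (gcd M (q ^ i - 1)) * sqf_density M (n - i)\<bar>)"
    by (simp only: sum_subtractf[symmetric] sum_abs)
  also have "\<dots> \<le> (\<Sum>i=1..n. (2 + real i ^ 2) / real q)" by (intro sum_mono each)
  finally show ?thesis by (simp only: sum_divide_distrib)
qed

lemma sqf_density_0: "sqf_density M 0 = 1"
proof -
  have "sqf \<one>\<^bsub>P\<^esub>" unfolding sqf_def
  proof (intro allI ballI notI)
    fix d p assume p: "p \<in> irr d" and dv: "(p \<otimes>\<^bsub>P\<^esub> p) pdivides \<one>\<^bsub>P\<^esub>"
    have "p pdivides (p \<otimes>\<^bsub>P\<^esub> p)" using irr_closed[OF p] by (intro pdividesI[of p]) auto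
    then show False using pdivides_trans[OF _ dv irr_closed[OF p]] irr_divides_monic_unit[OF p] by blast
  qed
  moreover have "power_poly M \<one>\<^bsub>P\<^esub>"
  proof -
    have "\<one>\<^bsub>P\<^esub> pdivides (\<one>\<^bsub>P\<^esub> [^]\<^bsub>P\<^esub> M \<ominus>\<^bsub>P\<^esub> X)"
      by (rule pdividesI[of "\<one>\<^bsub>P\<^esub> [^]\<^bsub>P\<^esub> M \<ominus>\<^bsub>P\<^esub> X"]) auto
    moreover have "coeff \<one>\<^bsub>P\<^esub> 0 \<noteq> \<zero>" by (simp add: univ_poly_one)
    ultimately show ?thesis unfolding power_poly_def by blast
  qed
  ultimately have "sqf_powers M 0 = {\<one>\<^bsub>P\<^esub>}"
    using monics_0 one_monic unfolding sqf_powers_def by blast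
  then show ?thesis by (simp add: sqf_density_def)
qed

end

text \<open>
  For prime \<open>M\<close> not dividing \<open>q\<close> this says that \<open>o(q) = a\<close>. The case \<open>M = a = 1\<close> holds for every finite
  field; there \<open>sqf_powers 1 n\<close> consists of all squarefree monic \<open>f\<close> with \<open>f(0) \<noteq> 0\<close>.
\<close>

definition field_of_order :: "nat \<Rightarrow> nat \<Rightarrow> 'a ring \<Rightarrow> bool" where
  "field_of_order M a R \<longleftrightarrow> finite_field R \<and> primepow (card (carrier R)) \<and>
    (\<forall>i\<ge>1. gcd M (card (carrier R) ^ i - 1) = (if a dvd i then M else 1))"

text \<open>\<open>D\<close> precedes the quantifier over \<open>R\<close> because the field changes
  with \<open>q\<close>. Both sequences obey the same recursion up to an error of order
  \<open>1 / q\<close>, with weights at most 1, so the errors in smaller degrees just add up;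
  dividing by \<open>n \<ge> 1\<close> does not enlarge them.\<close>

lemma sqf_density_limit:
  assumes M: "M \<ge> 1"
  shows "\<exists>D\<ge>0. \<forall>R :: 'a ring. field_of_order M a R \<longrightarrow>
    \<bar>finite_field.sqf_density R M n - limit_proportion n M a\<bar> \<le> D / real (card (carrier R))"
proof (induction n rule: less_induct)
  case (less n)
  show ?case
  proof (cases "n = 0")
    case True
    have "finite_field.sqf_density R M 0 = 1" if "field_of_order M a R" for R :: "'a ring"
      using that finite_field.sqf_density_0 by (auto simp: field_of_order_def)
    then show ?thesis using True by (intro exI[of _ 0]) (auto simp: limit_proportion_0)
  next
    case False
    then have "\<forall>k\<in>{..<n}. \<exists>D\<ge>0. \<forall>R :: 'a ring. field_of_order M a R \<longrightarrow>
        \<bar>finite_field.sqf_density R M k - limit_proportion k M a\<bar> \<le> D / real (card (carrier R))"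
      using less.IH by blast
    then obtain D where D: "\<And>k. k < n \<Longrightarrow> D k \<ge> 0"
      "\<And>k R. k < n \<Longrightarrow> field_of_order M a (R :: 'a ring) \<Longrightarrow>
        \<bar>finite_field.sqf_density R M k - limit_proportion k M a\<bar> \<le> D k / real (card (carrier R))"
      by (metis lessThan_iff)
    define E where "E = (\<Sum>i=1..n. D (n - i)) + (\<Sum>i=1..n. 2 + real i ^ 2)"
    have E0: "E \<ge> 0" unfolding E_def using D(1) False by (intro add_nonneg_nonneg sum_nonneg) auto
    show ?thesis
    proof (intro exI[of _ E] conjI E0 allI impI)
      fix R :: "'a ring" assume R: "field_of_order M a R"
      interpret finite_field R using R by (simp add: field_of_order_def)
      have pq: "primepow q" and g: "\<And>i. i \<ge> 1 \<Longrightarrow> gcd M (q ^ i - 1) = (if a dvd i then M else 1)"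
        using R by (auto simp: field_of_order_def)
      have q0: "real q > 0" using q_ge_2 by simp
      have w: "1 / real (gcd M (q ^ i - 1)) = part_weight M a i" if "i \<ge> 1" for i
        using g[OF that] by (simp add: part_weight_def)
      have w01: "0 \<le> part_weight M a i" "part_weight M a i \<le> 1" for i
        using M by (auto simp: part_weight_def)
      let ?S = "\<Sum>i=1..n. part_weight M a i * sqf_density M (n - i)"
      let ?L = "\<Sum>i=1..n. part_weight M a i * limit_proportion (n - i) M a"
      have "(\<Sum>i=1..n. 1 / real (gcd M (q ^ i - 1)) * sqf_density M (n - i)) = ?S"
        using w by (intro sum.cong) auto
      then have 1: "\<bar>real n * sqf_density M n - ?S\<bar> \<le> (\<Sum>i=1..n. 2 + real i ^ 2) / real q"
        using sqf_density_recursion[OF pq M, of n] by simp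
      have "\<bar>?S - ?L\<bar> \<le> (\<Sum>i=1..n. \<bar>part_weight M a i * sqf_density M (n - i) - part_weight M a i * limit_proportion (n - i) M a\<bar>)"
        unfolding sum_subtractf[symmetric] by (rule sum_abs)
      also have "\<dots> \<le> (\<Sum>i=1..n. D (n - i) / real q)"
      proof (intro sum_mono)
        fix i assume i: "i \<in> {1..n}"
        then have lt: "n - i < n" using False by auto
        have "\<bar>part_weight M a i * sqf_density M (n - i) - part_weight M a i * limit_proportion (n - i) M a\<bar> =
          part_weight M a i * \<bar>sqf_density M (n - i) - limit_proportion (n - i) M a\<bar>"
          using w01(1)[of i] by (simp add: right_diff_distrib[symmetric] abs_mult)
        also have "\<dots> \<le> 1 * (D (n - i) / real q)" using w01[of i] D(2)[OF lt R] by (intro mult_mono) auto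
        finally show "\<bar>part_weight M a i * sqf_density M (n - i) - part_weight M a i * limit_proportion (n - i) M a\<bar>
          \<le> D (n - i) / real q" by simp
      qed
      also have "\<dots> = (\<Sum>i=1..n. D (n - i)) / real q" by (simp only: sum_divide_distrib)
      finally have 2: "\<bar>?S - ?L\<bar> \<le> (\<Sum>i=1..n. D (n - i)) / real q" .
      have "real n * limit_proportion n M a = ?L" by (rule limit_proportion_recursion)
      then have "\<bar>real n * sqf_density M n - real n * limit_proportion n M a\<bar> \<le> E / real q"
        using 1 2 unfolding E_def add_divide_distrib by linarith
      moreover have "\<bar>sqf_density M n - limit_proportion n M a\<bar> \<le> \<bar>real n * sqf_density M n - real n * limit_proportion n M a\<bar>"
      proof -
        have "real n * sqf_density M n - real n * limit_proportion n M a = real n * (sqf_density M n - limit_proportion n M a)"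
          by (simp add: right_diff_distrib)
        moreover have "1 * \<bar>sqf_density M n - limit_proportion n M a\<bar> \<le> real n * \<bar>sqf_density M n - limit_proportion n M a\<bar>"
          using False by (intro mult_right_mono) auto
        ultimately show ?thesis by (simp add: abs_mult)
      qed
      ultimately show "\<bar>sqf_density M n - limit_proportion n M a\<bar> \<le> E / real (card (carrier R))" by linarith
    qed
  qed
qed

text \<open>The polynomials to be counted need not be squarefree. Those that are not lie outside
  \<open>sqf_powers 1 n\<close>, whose density tends to \<open>limit_proportion n 1 1 = 1\<close> by
  the same limit lemma, so they cost at most \<open>D' / q\<close>.\<close>

lemma GL_power_proportion_limit:
  assumes n: "n \<ge> 1" and M: "M \<ge> 1"
  shows "\<exists>D\<ge>0. \<forall>R :: 'a ring. field_of_order M a R \<longrightarrow> 2 * n \<le> card (carrier R) \<longrightarrow>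
    \<bar>GL_power_proportion n R M - limit_proportion n M a\<bar> \<le> D / real (card (carrier R))"
proof -
  obtain D where D: "D \<ge> 0" "\<And>R :: 'a ring. field_of_order M a R \<Longrightarrow>
    \<bar>finite_field.sqf_density R M n - limit_proportion n M a\<bar> \<le> D / real (card (carrier R))"
    using sqf_density_limit[OF M, where 'a = 'a] by blast
  obtain D' where D': "D' \<ge> 0" "\<And>R :: 'a ring. field_of_order 1 1 R \<Longrightarrow>
    \<bar>finite_field.sqf_density R 1 n - limit_proportion n 1 1\<bar> \<le> D' / real (card (carrier R))"
    using sqf_density_limit[of 1, where 'a = 'a] by blast
  show ?thesis
  proof (intro exI[of _ "2 * real n + D + D'"] conjI allI impI)
    fix R :: "'a ring" assume R: "field_of_order M a R" and big: "2 * n \<le> card (carrier R)"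
    interpret finite_field R using R by (simp add: field_of_order_def)
    interpret matrix_space R n by unfold_locales
    have R1: "field_of_order 1 1 R" using R by (simp add: field_of_order_def)
    have Q: "real q ^ n > 0" using q_ge_2 by simp
    let ?G = "{f \<in> monics n. power_poly M f}"
    have lower: "sqf_powers M n \<subseteq> ?G" by (auto simp: sqf_powers_def)
    have upper: "?G \<subseteq> sqf_powers M n \<union> (monics n - sqf_powers 1 n)"
    proof
      fix f assume f: "f \<in> ?G"
      show "f \<in> sqf_powers M n \<union> (monics n - sqf_powers 1 n)"
        using f by (cases "sqf f") (auto simp: sqf_powers_def)
    qed
    have finG: "finite ?G" using finite_monics[of n] by simp
    have 1: "card (sqf_powers M n) \<le> card ?G" using lower finG by (intro card_mono)
    have "card ?G \<le> card (sqf_powers M n \<union> (monics n - sqf_powers 1 n))"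
      using upper finite_monics[of n] finite_sqf_powers[of M n] by (intro card_mono) auto
    also have "\<dots> \<le> card (sqf_powers M n) + card (monics n - sqf_powers 1 n)" by (rule card_Un_le)
    also have "card (monics n - sqf_powers 1 n) = q ^ n - card (sqf_powers 1 n)"
      using finite_sqf_powers[of 1 n] by (subst card_Diff_subset) (auto simp: sqf_powers_def card_monics)
    finally have 2: "card ?G \<le> card (sqf_powers M n) + (q ^ n - card (sqf_powers 1 n))" .
    have le1: "card (sqf_powers 1 n) \<le> q ^ n"
      unfolding card_monics[symmetric] by (intro card_mono finite_monics) (auto simp: sqf_powers_def)
    have 3: "real (card ?G) \<le> real (card (sqf_powers M n)) + (real q ^ n - real (card (sqf_powers 1 n)))"
      using 2 le1 by (metis of_nat_add of_nat_diff of_nat_le_iff of_nat_power)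
    have G1: "sqf_density M n \<le> real (card ?G) / real q ^ n"
      unfolding sqf_density_def using 1 Q by (intro divide_right_mono) auto
    have "real (card ?G) / real q ^ n \<le>
      (real (card (sqf_powers M n)) + (real q ^ n - real (card (sqf_powers 1 n)))) / real q ^ n"
      using 3 Q by (intro divide_right_mono) auto
    also have "\<dots> = sqf_density M n + (1 - sqf_density 1 n)"
      using Q by (simp add: sqf_density_def add_divide_distrib diff_divide_distrib)
    finally have G2: "real (card ?G) / real q ^ n \<le> sqf_density M n + (1 - sqf_density 1 n)" .
    have L1: "limit_proportion n 1 1 = 1" by (simp add: limit_proportion_closed binomial_partial_def)
    have a1: "\<bar>GL_power_proportion n R M - real (card ?G) / real q ^ n\<bar> \<le> 2 * real n / real q"
      using GL_power_proportion_approx[OF n big, of M] card_power_companions[OF n M] by simp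
    have a2: "1 - sqf_density 1 n \<le> D' / real q" using D'(2)[OF R1] L1 by linarith
    have a3: "\<bar>sqf_density M n - limit_proportion n M a\<bar> \<le> D / real q" using D(2)[OF R] .
    have "(2 * real n + D + D') / real q = 2 * real n / real q + D / real q + D' / real q"
      by (simp add: add_divide_distrib)
    then show "\<bar>GL_power_proportion n R M - limit_proportion n M a\<bar> \<le> (2 * real n + D + D') / real (card (carrier R))"
      using G1 G2 a1 a2 a3 sqf_density_bounds(2)[of 1 n] by linarith
  qed (use D D' in simp)
qed

section \<open>Orders modulo M and subsequential limits\<close>

lemma gcd_prime_power_minus_1:
  assumes M: "Factorial_Ring.prime (M::nat)" and cop: "coprime M q" and q: "q \<ge> 1"
  shows "gcd M (q ^ i - 1) = (if ord M q dvd i then M else 1)"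
proof -
  have "M dvd q ^ i - 1 \<longleftrightarrow> [q ^ i = 1] (mod M)"
    using mod_eq_dvd_iff_nat[of 1 "q ^ i" M] q by (simp add: cong_def)
  also have "\<dots> \<longleftrightarrow> ord M q dvd i" by (rule ord_divides)
  finally have iff: "M dvd q ^ i - 1 \<longleftrightarrow> ord M q dvd i" .
  show ?thesis
  proof (cases "M dvd q ^ i - 1")
    case True
    then show ?thesis using iff gcd_nat.absorb1[of M "q ^ i - 1"] by simp
  next
    case False
    then have "coprime M (q ^ i - 1)" using M by (rule prime_imp_coprime[rotated])
    then show ?thesis using iff False by simp
  qed
qed

lemma ord_dvd_prime_minus_1:
  assumes "Factorial_Ring.prime (M::nat)" "coprime M q" shows "ord M q dvd M - 1"
  using order_divides_totient[OF assms(2)] totient_prime[OF assms(1)] by simp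

lemma coprime_primepows_of_order:
  assumes M: "Factorial_Ring.prime (M::nat)" and a: "a dvd M - 1"
  shows "\<exists>r :: nat \<Rightarrow> nat. strict_mono r \<and> range r \<subseteq> {q \<in> coprime_primepows M. ord M q = a}"
proof -
  obtain p where p: "Factorial_Ring.prime p" "ord M p = M - 1" using exists_prime_primitive_root[OF M] by blast
  have M2: "M \<ge> 2" using prime_ge_2_nat[OF M] .
  then have cop: "coprime M p" using p(2) ord_eq_0[of M p] by fastforce
  obtain k where k: "M - 1 = a * k" using a by (rule dvdE)
  then have k0: "k > 0" and a0: "a > 0" using M2 by (auto intro!: gr0I)
  \<comment> \<open>All these exponents have greatest common divisor \<open>k\<close> with
    \<open>M - 1\<close>, so the order drops from \<open>M - 1\<close> to
    \<open>(M - 1) div k = a\<close>.\<close>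
  define r where "r = (\<lambda>j. p ^ (k + j * (M - 1)))"
  have "strict_mono r" unfolding r_def
    using prime_gt_1_nat[OF p(1)] M2 by (intro strict_monoI power_strict_increasing) auto
  moreover have "r j \<in> {q \<in> coprime_primepows M. ord M q = a}" for j
  proof -
    have "primepow (r j)" unfolding r_def using p(1) k0 by (auto simp: primepow_def)
    moreover have "coprime M (r j)" unfolding r_def using cop by simp
    moreover have "ord M (r j) = a"
    proof -
      have "ord M (r j) = (M - 1) div gcd (k + j * (M - 1)) (M - 1)"
        unfolding r_def ord_power[OF cop] p(2) ..
      also have "gcd (k + j * (M - 1)) (M - 1) = gcd k (M - 1)"
        using gcd_add_mult[of "M - 1" j k] by (simp add: gcd.commute add.commute)
      also have "\<dots> = k" using k by (simp add: gcd_nat.absorb1)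
      finally show ?thesis using k k0 by simp
    qed
    ultimately show ?thesis by (simp add: coprime_primepows_def)
  qed
  then have "range r \<subseteq> {q \<in> coprime_primepows M. ord M q = a}" by blast
  ultimately show ?thesis by blast
qed

lemma limit_proportion_eq_1_iff:
  assumes "a \<ge> 1" "M \<ge> 2" shows "limit_proportion n M a = 1 \<longleftrightarrow> a > n"
  using limit_proportion_eq_1[of n a M] limit_proportion_less_1[of a n M] assms by (cases "a > n") auto

lemma inj_limit_proportion:
  assumes "M \<ge> 2" shows "inj_on (limit_proportion n M) {a. 1 \<le> a \<and> a \<le> n \<and> a dvd m}"
proof (rule inj_onI)
  fix a b assume ab: "a \<in> {a. 1 \<le> a \<and> a \<le> n \<and> a dvd m}" "b \<in> {a. 1 \<le> a \<and> a \<le> n \<and> a dvd m}"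
    and eq: "limit_proportion n M a = limit_proportion n M b"
  show "a = b"
    using ab eq limit_proportion_strict_mono[of a b n M] limit_proportion_strict_mono[of b a n M] assms
    by (cases a b rule: linorder_cases) auto
qed

text \<open>Fixing \<open>ord M q = a\<close> is expressed by a filter, which is trivial if
  \<open>a\<close> does not divide \<open>M - 1\<close>. If \<open>M - 1 > n\<close>, the orders
  \<open>a > n\<close> share the limit 1, which is different from all those that
  \<open>num_divisors_upto\<close> counts; hence the two cases of the second part.\<close>

theorem proposition4p2:
  fixes n M :: nat and F :: "nat \<Rightarrow> 'a ring"
  assumes "1 \<le> n" and "Factorial_Ring.prime M"
    and "\<And>q. primepow q \<Longrightarrow> field (F q) \<and> card (carrier (F q)) = q"
  defines "P \<equiv> (\<lambda>q. GL_power_proportion n (F q) M)"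
  defines "S \<equiv> subsequential_limits P (coprime_primepows M)"
  shows "(\<forall>a. (P \<longlongrightarrow> limit_proportion n M a)
             (inf at_top (principal {q \<in> coprime_primepows M. ord M q = a}))) \<and>
         (if M - 1 \<le> n then card S = num_divisors_upto n (M - 1)
          else 1 \<in> S \<and> card (S - {1}) = num_divisors_upto n (M - 1))"
proof
  have M2: "M \<ge> 2" using prime_ge_2_nat[OF assms(2)] .
  let ?Q = "\<lambda>a. {q \<in> coprime_primepows M. ord M q = a}"
  let ?F = "\<lambda>a. inf at_top (principal (?Q a))"
  have field: "field_of_order M a (F q)" if "q \<in> ?Q a" for a q
  proof -
    have q: "primepow q" "coprime M q" "ord M q = a" using that by (auto simp: coprime_primepows_def)
    have Fq: "field (F q)" "card (carrier (F q)) = q" using assms(3)[OF q(1)] by auto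
    have q2: "q \<ge> 2" using primepow_gt_Suc_0[OF q(1)] by simp
    then have "finite (carrier (F q))" using Fq(2) by (intro card_ge_0_finite) simp
    then have "finite_field (F q)" using Fq(1) by (simp add: finite_field_def finite_field_axioms_def)
    then show ?thesis using q q2 gcd_prime_power_minus_1[OF assms(2) q(2)] Fq(2)
      by (simp add: field_of_order_def)
  qed
  have lim: "(P \<longlongrightarrow> limit_proportion n M a) (?F a)" for a
  proof -
    obtain D where D: "D \<ge> 0" "\<And>R :: 'a ring. field_of_order M a R \<Longrightarrow> 2 * n \<le> card (carrier R) \<Longrightarrow>
        \<bar>GL_power_proportion n R M - limit_proportion n M a\<bar> \<le> D / real (card (carrier R))"
      using GL_power_proportion_limit[OF assms(1), of M a, where 'a = 'a] M2 by auto
    show ?thesis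
    proof (rule tendstoI)
      fix e :: real assume e: "e > 0"
      have "eventually (\<lambda>q. q \<in> ?Q a \<longrightarrow> dist (P q) (limit_proportion n M a) < e) at_top"
        using eventually_ge_at_top[of "2 * n"] eventually_gt_at_top[of "nat \<lceil>D / e\<rceil>"]
      proof eventually_elim
        case (elim q)
        show ?case
        proof
          assume q: "q \<in> ?Q a"
          then have card: "card (carrier (F q)) = q" using assms(3)[of q] by (auto simp: coprime_primepows_def)
          have "D / e < real q" using elim(2) by linarith
          then have "D / real q < e" using e D(1) by (auto simp: divide_less_eq mult.commute split: if_splits)
          moreover have "\<bar>P q - limit_proportion n M a\<bar> \<le> D / real q"
            using D(2)[OF field[OF q]] elim(1) card by (simp add: P_def)
          ultimately show "dist (P q) (limit_proportion n M a) < e" by (simp add: dist_real_def)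
        qed
      qed
      then show "eventually (\<lambda>q. dist (P q) (limit_proportion n M a) < e) (?F a)"
        by (simp add: eventually_inf_principal)
    qed
  qed
  then show "\<forall>a. (P \<longlongrightarrow> limit_proportion n M a) (?F a)" by blast
  have S: "S = limit_proportion n M ` {a. a dvd M - 1}"
  proof (intro equalityI subsetI)
    fix l assume "l \<in> S"
    then obtain r where r: "strict_mono r" "range r \<subseteq> coprime_primepows M" "(\<lambda>k. P (r k)) \<longlonglongrightarrow> l"
      by (auto simp: S_def subsequential_limits_def)
    have ords: "(\<lambda>k. ord M (r k)) ` UNIV \<subseteq> {a. a dvd M - 1}"
      using r(2) ord_dvd_prime_minus_1[OF assms(2)] by (auto simp: coprime_primepows_def)
    have "finite {a. a dvd M - 1}" using M2 by (intro finite_divisors_nat) simp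
    then have "finite ((\<lambda>k. ord M (r k)) ` UNIV)" using ords by (rule finite_subset[rotated])
    \<comment> \<open>Only finitely many orders are possible, so one of them occurs infinitely often
      along \<open>r\<close>. On those indices both limits are available, and they agree because the
      filter \<open>?G\<close> is not trivial.\<close>
    then obtain k0 where inf: "infinite {k \<in> UNIV. ord M (r k) = ord M (r k0)}"
      using pigeonhole_infinite[of UNIV "\<lambda>k. ord M (r k)"] by auto
    let ?a = "ord M (r k0)" and ?K = "{k. ord M (r k) = ord M (r k0)}"
    let ?G = "inf sequentially (principal ?K)"
    have "?G \<noteq> bot"
      using inf by (auto simp: trivial_limit_def eventually_inf_principal eventually_sequentially
          infinite_nat_iff_unbounded_le)
    moreover have "((\<lambda>k. P (r k)) \<longlongrightarrow> l) ?G" using r(3) by (rule tendsto_mono[rotated]) simp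
    moreover have "((\<lambda>k. P (r k)) \<longlongrightarrow> limit_proportion n M ?a) ?G"
    proof (rule filterlim_compose[OF lim])
      show "filterlim r (?F ?a) ?G"
        unfolding filterlim_inf filterlim_principal
      proof
        show "filterlim r at_top ?G"
          using filterlim_subseq[OF r(1)] by (rule filterlim_mono) simp_all
        show "eventually (\<lambda>k. r k \<in> ?Q ?a) ?G"
          using r(2) by (auto simp: eventually_inf_principal intro!: always_eventually)
      qed
    qed
    ultimately have "l = limit_proportion n M ?a" by (rule tendsto_unique)
    then show "l \<in> limit_proportion n M ` {a. a dvd M - 1}" using ords by blast
  next
    fix l assume "l \<in> limit_proportion n M ` {a. a dvd M - 1}"
    then obtain a where a: "a dvd M - 1" "l = limit_proportion n M a" by blast
    obtain r :: "nat \<Rightarrow> nat" where r: "strict_mono r" "range r \<subseteq> ?Q a" using coprime_primepows_of_order[OF assms(2) a(1)] by blast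
    have "filterlim r (?F a) sequentially"
      unfolding filterlim_inf filterlim_principal
      using filterlim_subseq[OF r(1)] r(2) by (auto intro!: always_eventually)
    then have "(\<lambda>k. P (r k)) \<longlonglongrightarrow> l" unfolding a(2) by (rule filterlim_compose[OF lim])
    then show "l \<in> S" unfolding S_def subsequential_limits_def using r by auto
  qed
  have pos: "a \<ge> 1" if "a dvd M - 1" for a
    using that M2 by (metis One_nat_def Suc_leI dvd_0_left_iff gr0I diff_is_0_eq not_less_eq_eq numeral_2_eq_2)
  let ?A = "{a. 1 \<le> a \<and> a \<le> n \<and> a dvd M - 1}"
  have card: "card (limit_proportion n M ` ?A) = num_divisors_upto n (M - 1)"
    unfolding num_divisors_upto_def using M2 by (intro card_image inj_limit_proportion)
  show "if M - 1 \<le> n then card S = num_divisors_upto n (M - 1)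
          else 1 \<in> S \<and> card (S - {1}) = num_divisors_upto n (M - 1)"
  proof (cases "M - 1 \<le> n")
    case True
    have "a \<le> n" if "a dvd M - 1" for a
      using dvd_imp_le[OF that] M2 True by simp
    then have "{a. a dvd M - 1} = ?A" using pos by blast
    then show ?thesis using True card S by simp
  next
    case False
    then have "limit_proportion n M (M - 1) = 1" by (intro limit_proportion_eq_1) simp
    then have "1 \<in> S" unfolding S by (metis (mono_tags, lifting) dvd_refl image_eqI mem_Collect_eq)
    moreover have "S - {1} = limit_proportion n M ` ?A"
    proof (intro equalityI subsetI)
      fix l assume "l \<in> S - {1}"
      then obtain a where a: "a dvd M - 1" "l = limit_proportion n M a" "l \<noteq> 1" unfolding S by blast
      then have "a \<le> n" using limit_proportion_eq_1_iff[OF pos[OF a(1)] M2, of n] by simp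
      then show "l \<in> limit_proportion n M ` ?A" using a pos by blast
    next
      fix l assume "l \<in> limit_proportion n M ` ?A"
      then obtain a where a: "1 \<le> a" "a \<le> n" "a dvd M - 1" "l = limit_proportion n M a" by blast
      then have "l \<noteq> 1" using limit_proportion_eq_1_iff[OF a(1) M2, of n] by simp
      then show "l \<in> S - {1}" unfolding S using a by blast
    qed
    ultimately show ?thesis using False card by simp
  qed
qed

end
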